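(* Let $X\in\mathrm{Dom}(D)$ be such that $\mathbb{E}[X]=0$, and let $$\varphi_X(z):=\frac12\,\mathbb{E}\left[\int_0^\infty D_tX\,\mathbb{E}[D_tX\mid\tilde{\mathcal F}_t]\,dt\,\Big|\,X=z\right],\qquad z\in\mathbb{R}.$$ Then $$d_W(X,\mathcal N)\le \mathbb{E}[|1-\varphi_X(X)|]\le |1-\mathbb{E}[X^2]|+\big\|\varphi_X(X)-\mathbb{E}[\varphi_X(X)]\big\|_{L^2(\Omega)},$$ and $$d_{TV}(X,\mathcal N)\le 2\,\mathbb{E}[|1-\varphi_X(X)|]\le 2|1-\mathbb{E}[X^2]|+2\big\|\varphi_X(X)-\mathbb{E}[\varphi_X(X)]\big\|_{L^2(\Omega)}.$$ If moreover $\nu>0$ and $X$ is a.s. $(-\nu,\infty)$-valued, then $$d_{\mathcal H}(X,\Gamma_\nu)\le \mathbb{E}[|2(X+\nu)-\varphi_X(X)|]\le \big\|2(X+\nu)-\mathbb{E}[X^2]\big\|_{L^2(\Omega)}+\big\|\varphi_X(X)-\mathbb{E}[\varphi_X(X)]\big\|_{L^2(\Omega)}.$$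
   Context: $\mathbb{N}=\{0,1,2,\ldots\}$ and $\mathbb{R}_+=[0,\infty)$. $(U_k)_{k\in\mathbb N}$ is an i.i.d. sequence of random variables uniformly distributed on $[-1,1]$; $Y_t:=\sum_{k=0}^\infty \mathbf 1_{[2k+1+U_k,\infty)}(t)$, $t\in\mathbb{R}_+$; $(\mathcal F_t)_{t\ge 0}$ is the filtration generated by $(Y_t)_{t\ge0}$, and $\tilde{\mathcal F}_t:=\mathcal F_{2k}$ for $2k\le t<2k+2$, $k\in\mathbb N$. For $X=f(U_0,\ldots,U_n)$ with $f\in\mathcal C^1_b([-1,1]^{n+1})$, the gradient is $$D_tX:=\sum_{k=0}^n \partial_kf(U_0,\ldots,U_n)\Big((1-U_k)\mathbf 1_{(2k,2k+1+U_k]}(t)-(1+U_k)\mathbf 1_{(2k+1+U_k,2k+2]}(t)\Big),\quad t\in\mathbb R_+,$$ where $\partial_k$ is the partial derivative with respect to the variable evaluated at $U_k$. $D$ is closable as an operator from $L^2(\Omega)$ to $L^2(\Omega\times\mathbb R_+)$, and $\mathrm{Dom}(D)$ denotes the domain of its closure, still denoted by $D$. $\mathcal N$ is a standard normal random variable. $\Gamma_\nu:=2\Gamma(\nu/2)-\nu$, where $\Gamma(\nu/2)$ is a gamma random variable with parameters $(\nu/2,1)$. Distances: $d_W(X,Y)=\sup_{h}|\mathbb E[h(X)]-\mathbb E[h(Y)]|$ over Lipschitz functions $h:\mathbb R\to\mathbb R$ with Lipschitz constant at most $1$; $d_{TV}(X,Y)=\sup_{A}|\mathbb P(X\in A)-\mathbb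 P(Y\in A)|$ over Borel sets $A\subset\mathbb R$; $d_{\mathcal H}(X,Y)=\sup_{h\in\mathcal H}|\mathbb E[h(X)]-\mathbb E[h(Y)]|$ with $\mathcal H=\{h\in\mathcal C^2_b(\mathbb R):\max(\|h\|_\infty,\|h'\|_\infty,\|h''\|_\infty)\le1\}$. Norms on the right-hand sides may be $+\infty$. *)

theory Defs
  imports "HOL-Probability.Probability"
begin

section \<open>The jump process and its filtrations\<close>

definition uniform_iid :: "'a measure \<Rightarrow> (nat \<Rightarrow> 'a \<Rightarrow> real) \<Rightarrow> bool" where
  "uniform_iid M U \<longleftrightarrow>
     prob_space.indep_vars M (\<lambda>_. borel) U UNIV \<and>
     (\<forall>k. distr M borel (U k) = uniform_measure lborel {-1..1})"

definition jump_process :: "(nat \<Rightarrow> 'a \<Rightarrow> real) \<Rightarrow> real \<Rightarrow> 'a \<Rightarrow> real" where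
  "jump_process U t \<omega> = (\<Sum>k. indicator {2 * real k + 1 + U k \<omega> ..} t)"

definition jump_filtration :: "'a measure \<Rightarrow> (nat \<Rightarrow> 'a \<Rightarrow> real) \<Rightarrow> real \<Rightarrow> 'a measure" where
  "jump_filtration M U t =
     sigma (space M)
       {jump_process U s -` B \<inter> space M | s B. 0 \<le> s \<and> s \<le> t \<and> B \<in> sets borel}"

definition discrete_filtration :: "'a measure \<Rightarrow> (nat \<Rightarrow> 'a \<Rightarrow> real) \<Rightarrow> real \<Rightarrow> 'a measure" where
  "discrete_filtration M U t = jump_filtration M U (2 * of_int \<lfloor>t / 2\<rfloor>)"

section \<open>The gradient and its closure\<close>

abbreviation time :: "real measure" where
  "time \<equiv> restrict_space lborel {0..}"

text \<open>
  The cube \<open>[-1,1]\<^sup>n\<^sup>+\<^sup>1\<close> is the set of functions on \<open>{..n}\<close> (undefined elsewhere) with values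
  in \<open>[-1,1]\<close>. On it the product topology of \<^typ>\<open>nat \<Rightarrow> real\<close> is the Euclidean one.
\<close>
definition cube :: "nat \<Rightarrow> (nat \<Rightarrow> real) set" where
  "cube n = (\<Pi>\<^sub>E k\<in>{..n}. {-1..1})"

text \<open>
  \<open>f\<close> is of class \<open>C\<^sup>1\<close> with bounded derivatives on the closed cube, with partial derivatives
  \<open>f' 0, \<dots>, f' n\<close>; these are one-sided on the boundary. The values of \<open>f\<close> and \<open>f'\<close> outside
  the cube are irrelevant.
\<close>
definition C1b_cube :: "nat \<Rightarrow> ((nat \<Rightarrow> real) \<Rightarrow> real) \<Rightarrow> (nat \<Rightarrow> (nat \<Rightarrow> real) \<Rightarrow> real) \<Rightarrow> bool" where
  "C1b_cube n f f' \<longleftrightarrow>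
     continuous_on (cube n) f \<and> bounded (f ` cube n) \<and>
     (\<forall>k\<le>n. continuous_on (cube n) (f' k) \<and> bounded (f' k ` cube n) \<and>
       (\<forall>x\<in>cube n. ((\<lambda>s. f (x(k := s))) has_real_derivative f' k x) (at (x k) within {-1..1})))"

text \<open>
  \<open>simple_gradient M U X Z\<close>: \<open>X = f(U\<^sub>0,\<dots>,U\<^sub>n)\<close> and \<open>Z = DX\<close>, as elements of
  \<open>L\<^sup>2(\<Omega>)\<close> and \<open>L\<^sup>2(\<Omega> \<times> \<real>\<^sub>+)\<close>, i.e. almost everywhere. The variables \<open>U\<^sub>k\<close> are only
  almost surely \<open>[-1,1]\<close>-valued, so that \<open>f(U\<^sub>0,\<dots>,U\<^sub>n)\<close> is only almost surely specified.
\<close>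
definition simple_gradient ::
    "'a measure \<Rightarrow> (nat \<Rightarrow> 'a \<Rightarrow> real) \<Rightarrow> ('a \<Rightarrow> real) \<Rightarrow> ('a \<Rightarrow> real \<Rightarrow> real) \<Rightarrow> bool" where
  "simple_gradient M U X Z \<longleftrightarrow>
     X \<in> borel_measurable M \<and> case_prod Z \<in> borel_measurable (M \<Otimes>\<^sub>M time) \<and>
     (\<exists>n f f'. C1b_cube n f f' \<and>
       (AE \<omega> in M. X \<omega> = f (\<lambda>k\<in>{..n}. U k \<omega>)) \<and>
       (AE (\<omega>, t) in M \<Otimes>\<^sub>M time. Z \<omega> t =
         (\<Sum>k\<le>n. f' k (\<lambda>j\<in>{..n}. U j \<omega>) *
           ((1 - U k \<omega>) * indicator {2 * real k <.. 2 * real k + 1 + U k \<omega>} t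
          - (1 + U k \<omega>) * indicator {2 * real k + 1 + U k \<omega> <.. 2 * real k + 2} t))))"

text \<open>
  The graph of the closure of the gradient as an operator from \<open>L\<^sup>2(\<Omega>)\<close> to
  \<open>L\<^sup>2(\<Omega> \<times> \<real>\<^sub>+)\<close>: \<open>is_gradient M U X Z\<close> says that \<open>X \<in> Dom(D)\<close> and that \<open>Z\<close> is a version
  of \<open>DX\<close>.
\<close>
definition is_gradient ::
    "'a measure \<Rightarrow> (nat \<Rightarrow> 'a \<Rightarrow> real) \<Rightarrow> ('a \<Rightarrow> real) \<Rightarrow> ('a \<Rightarrow> real \<Rightarrow> real) \<Rightarrow> bool" where
  "is_gradient M U X Z \<longleftrightarrow>
     X \<in> borel_measurable M \<and> integrable M (\<lambda>\<omega>. (X \<omega>)\<^sup>2) \<and>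
     case_prod Z \<in> borel_measurable (M \<Otimes>\<^sub>M time) \<and>
     integrable (M \<Otimes>\<^sub>M time) (\<lambda>(\<omega>, t). (Z \<omega> t)\<^sup>2) \<and>
     (\<exists>Xs Zs. (\<forall>m. simple_gradient M U (Xs m) (Zs m)) \<and>
       (\<lambda>m::nat. \<integral>\<omega>. (Xs m \<omega> - X \<omega>)\<^sup>2 \<partial>M) \<longlonglongrightarrow> 0 \<and>
       (\<lambda>m. \<integral>(\<omega>, t). (Zs m \<omega> t - Z \<omega> t)\<^sup>2 \<partial>(M \<Otimes>\<^sub>M time)) \<longlonglongrightarrow> 0)"

definition gradient_domain :: "'a measure \<Rightarrow> (nat \<Rightarrow> 'a \<Rightarrow> real) \<Rightarrow> ('a \<Rightarrow> real) set" where
  "gradient_domain M U = {X. \<exists>Z. is_gradient M U X Z}"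

text \<open>
  \<open>P \<omega> t\<close> is a jointly measurable version of \<open>E[Z\<^sub>t | discrete_filtration]\<close>. Joint measurability
  has to be required, because \<^const>\<open>real_cond_exp\<close> chooses its value separately for each \<open>t\<close>;
  \<open>Z\<^sub>t\<close> is integrable for almost every \<open>t\<close> only.
\<close>
definition is_predictable_gradient ::
    "'a measure \<Rightarrow> (nat \<Rightarrow> 'a \<Rightarrow> real) \<Rightarrow> ('a \<Rightarrow> real \<Rightarrow> real) \<Rightarrow> ('a \<Rightarrow> real \<Rightarrow> real) \<Rightarrow> bool" where
  "is_predictable_gradient M U Z P \<longleftrightarrow>
     case_prod P \<in> borel_measurable (M \<Otimes>\<^sub>M time) \<and>
     (AE t in time. AE \<omega> in M.
       P \<omega> t = real_cond_exp M (discrete_filtration M U t) (\<lambda>\<omega>. Z \<omega> t) \<omega>)"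

text \<open>\<open>g\<close> is a version of \<open>z \<mapsto> E[V | X = z]\<close>.\<close>
definition is_cond_exp_given_value ::
    "'a measure \<Rightarrow> ('a \<Rightarrow> real) \<Rightarrow> ('a \<Rightarrow> real) \<Rightarrow> (real \<Rightarrow> real) \<Rightarrow> bool" where
  "is_cond_exp_given_value M X V g \<longleftrightarrow>
     g \<in> borel_measurable borel \<and>
     (AE \<omega> in M. g (X \<omega>) = real_cond_exp M (vimage_algebra (space M) X borel) V \<omega>)"

text \<open>
  \<open>\<phi>\<close> is a version of \<open>z \<mapsto> 1/2 E[\<integral>\<^sub>0\<^sup>\<infinity> D\<^sub>tX E[D\<^sub>tX | discrete_filtration] dt | X = z]\<close>.
  Versions exist by \<open>is_phi_exists\<close> at the end of the theory.
\<close>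
definition is_phi ::
    "'a measure \<Rightarrow> (nat \<Rightarrow> 'a \<Rightarrow> real) \<Rightarrow> ('a \<Rightarrow> real) \<Rightarrow> (real \<Rightarrow> real) \<Rightarrow> bool" where
  "is_phi M U X \<phi> \<longleftrightarrow>
     (\<exists>DX P g. is_gradient M U X DX \<and> is_predictable_gradient M U DX P \<and>
       is_cond_exp_given_value M X (\<lambda>\<omega>. \<integral>t. DX \<omega> t * P \<omega> t \<partial>time) g \<and>
       (\<forall>z. \<phi> z = 1 / 2 * g z))"

section \<open>Target laws, distances and norms\<close>

definition std_normal_law :: "real measure" where
  "std_normal_law = density lborel std_normal_density"

definition gamma_density :: "real \<Rightarrow> real \<Rightarrow> real" where
  "gamma_density a x = (if 0 < x then x powr (a - 1) * exp (- x) / Gamma a else 0)"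

definition centered_gamma_law :: "real \<Rightarrow> real measure" where
  "centered_gamma_law \<nu> =
     distr (density lborel (gamma_density (\<nu> / 2))) borel (\<lambda>x. 2 * x - \<nu>)"

text \<open>
  The distances are taken between laws on the real line; for \<open>d_W\<close> the laws are meant to have a
  finite first moment.
\<close>
definition d_W :: "real measure \<Rightarrow> real measure \<Rightarrow> ennreal" where
  "d_W \<mu> \<eta> = (SUP h \<in> {h :: real \<Rightarrow> real. 1-lipschitz_on UNIV h}.
     ennreal \<bar>(\<integral>x. h x \<partial>\<mu>) - (\<integral>x. h x \<partial>\<eta>)\<bar>)"

definition d_TV :: "real measure \<Rightarrow> real measure \<Rightarrow> ennreal" where
  "d_TV \<mu> \<eta> = (SUP A \<in> sets borel. ennreal \<bar>measure \<mu> A - measure \<eta> A\<bar>)"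

definition C2b_unit :: "(real \<Rightarrow> real) set" where
  "C2b_unit = {h. \<exists>h' h''.
     (\<forall>x. (h has_real_derivative h' x) (at x)) \<and>
     (\<forall>x. (h' has_real_derivative h'' x) (at x)) \<and>
     continuous_on UNIV h'' \<and>
     (\<forall>x. \<bar>h x\<bar> \<le> 1 \<and> \<bar>h' x\<bar> \<le> 1 \<and> \<bar>h'' x\<bar> \<le> 1)}"

definition d_H :: "real measure \<Rightarrow> real measure \<Rightarrow> ennreal" where
  "d_H \<mu> \<eta> = (SUP h \<in> C2b_unit. ennreal \<bar>(\<integral>x. h x \<partial>\<mu>) - (\<integral>x. h x \<partial>\<eta>)\<bar>)"

definition L2_norm :: "'a measure \<Rightarrow> ('a \<Rightarrow> real) \<Rightarrow> ennreal" where
  "L2_norm M f = (let I = \<integral>\<^sup>+\<omega>. ennreal ((f \<omega>)\<^sup>2) \<partial>M in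
     if I = \<infinity> then \<infinity> else ennreal (sqrt (enn2real I)))"

section \<open>Existence of versions of \<open>\<phi>\<^sub>X\<close>\<close>

lemma subalgebra_jump_filtration:
  assumes [measurable]: "\<And>k. U k \<in> borel_measurable M"
  shows "subalgebra M (jump_filtration M U t)"
proof -
  have [measurable]: "jump_process U s \<in> borel_measurable M" for s
    unfolding jump_process_def indicator_def atLeast_iff by measurable
  have "sigma_sets (space M)
       {jump_process U s -` B \<inter> space M | s B. 0 \<le> s \<and> s \<le> t \<and> B \<in> sets borel} \<subseteq> sets M"
    by (rule sets.sigma_sets_subset) (auto intro!: measurable_sets)
  then show ?thesis
    unfolding subalgebra_def jump_filtration_def by (subst sets_measure_of) (auto simp: space_measure_of_conv)
qed

lemma joint_nn_cond_exp_sets: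
  assumes "prob_space M" "subalgebra M F" "A \<in> sets (M \<Otimes>\<^sub>M T)"
  shows "\<exists>P\<in>borel_measurable (F \<Otimes>\<^sub>M T). \<forall>t\<in>space T. \<forall>B\<in>sets F.
    (\<integral>\<^sup>+\<omega>\<in>B. indicator A (\<omega>, t) \<partial>M) = (\<integral>\<^sup>+\<omega>\<in>B. (P (\<omega>, t) :: ennreal) \<partial>M)"
proof -
  interpret prob_space M by fact
  interpret finite_measure_subalgebra M F by unfold_locales fact
  have sets_FM: "B \<in> sets M" if "B \<in> sets F" for B
    using that assms(2) by (auto simp: subalgebra_def)
  have from_F: "f \<in> borel_measurable M" if "f \<in> borel_measurable F" for f :: "'a \<Rightarrow> ennreal"
    using measurable_from_subalg[OF assms(2) that] .
  have spF: "space F = space M" using assms(2) by (auto simp: subalgebra_def)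
  have "A \<in> sigma_sets (space M \<times> space T) {a \<times> b | a b. a \<in> sets M \<and> b \<in> sets T}"
    using assms(3) by (simp add: sets_pair_measure)
  then show ?thesis
  proof (induction rule: sigma_sets_induct_disjoint[OF Int_stable_pair_measure_generator
        pair_measure_closed, consumes 1, case_names basic empty compl union])
    case (basic A)
    then obtain a b where ab: "A = a \<times> b" and [measurable]: "a \<in> sets M" "b \<in> sets T" by auto
    let ?P = "\<lambda>(\<omega>, t). nn_cond_exp M F (indicator a) \<omega> * indicator b t"
    have "?P \<in> borel_measurable (F \<Otimes>\<^sub>M T)" by measurable
    moreover have "(\<integral>\<^sup>+\<omega>\<in>B. indicator A (\<omega>, t) \<partial>M) = (\<integral>\<^sup>+\<omega>\<in>B. ?P (\<omega>, t) \<partial>M)"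
      if "t \<in> space T" and B: "B \<in> sets F" for t B
    proof -
      have [measurable]: "B \<in> sets M" using sets_FM B .
      have "(\<integral>\<^sup>+\<omega>\<in>B. indicator A (\<omega>, t) \<partial>M)
          = (\<integral>\<^sup>+\<omega>. indicator B \<omega> * indicator a \<omega> * indicator b t \<partial>M)"
        by (intro nn_integral_cong) (auto simp: ab indicator_def)
      also have "\<dots> = (\<integral>\<^sup>+\<omega>. indicator B \<omega> * indicator a \<omega> \<partial>M) * indicator b t"
        by (rule nn_integral_multc) measurable
      also have "(\<integral>\<^sup>+\<omega>. indicator B \<omega> * indicator a \<omega> \<partial>M)
          = (\<integral>\<^sup>+\<omega>. indicator B \<omega> * nn_cond_exp M F (indicator a) \<omega> \<partial>M)"
        by (rule nn_cond_exp_intg[symmetric]) (use B in measurable)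
      also have "\<dots> * indicator b t
          = (\<integral>\<^sup>+\<omega>. indicator B \<omega> * nn_cond_exp M F (indicator a) \<omega> * indicator b t \<partial>M)"
        by (rule nn_integral_multc[symmetric]) measurable
      also have "\<dots> = (\<integral>\<^sup>+\<omega>\<in>B. ?P (\<omega>, t) \<partial>M)"
        by (intro nn_integral_cong) (auto simp: indicator_def)
      finally show ?thesis .
    qed
    ultimately show ?case by blast
  next
    case empty
    show ?case by (intro bexI[of _ "\<lambda>_. 0"]) auto
  next
    case (compl A)
    then obtain P where P[measurable]: "P \<in> borel_measurable (F \<Otimes>\<^sub>M T)"
      and eq: "\<And>t B. t \<in> space T \<Longrightarrow> B \<in> sets F \<Longrightarrow>
        (\<integral>\<^sup>+\<omega>\<in>B. indicator A (\<omega>, t) \<partial>M) = (\<integral>\<^sup>+\<omega>\<in>B. (P (\<omega>, t) :: ennreal) \<partial>M)"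
      by blast
    have A[measurable]: "A \<in> sets (M \<Otimes>\<^sub>M T)"
      using compl by (simp add: sets_pair_measure)
    let ?P = "\<lambda>x. 1 - P x"
    have "(\<integral>\<^sup>+\<omega>\<in>B. indicator (space M \<times> space T - A) (\<omega>, t) \<partial>M) = (\<integral>\<^sup>+\<omega>\<in>B. ?P (\<omega>, t) \<partial>M)"
      if t: "t \<in> space T" and B: "B \<in> sets F" for t B
    proof -
      have [measurable]: "B \<in> sets M" using sets_FM B .
      have At[measurable]: "(\<lambda>\<omega>. indicator A (\<omega>, t) :: ennreal) \<in> borel_measurable M"
        using t A by (intro borel_measurable_indicator') measurable
      have PtF[measurable]: "(\<lambda>\<omega>. P (\<omega>, t)) \<in> borel_measurable F" using t by measurable
      note Pt[measurable] = from_F[OF PtF]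
      have "AE \<omega> in M. P (\<omega>, t) = nn_cond_exp M F (\<lambda>\<omega>. indicator A (\<omega>, t)) \<omega>"
        by (rule nn_cond_exp_charact) (use eq[OF t] in auto)
      moreover have "AE \<omega> in M. nn_cond_exp M F (\<lambda>\<omega>. indicator A (\<omega>, t)) \<omega> \<le> nn_cond_exp M F (\<lambda>_. 1) \<omega>"
        by (rule nn_cond_exp_mono) (use At in \<open>auto split: split_indicator\<close>)
      moreover have "AE \<omega> in M. 1 = nn_cond_exp M F (\<lambda>_. 1) \<omega>"
        using nn_cond_exp_F_meas[of "\<lambda>_. 1"] by auto
      ultimately have le: "AE \<omega> in M. P (\<omega>, t) \<le> 1" by eventually_elim simp
      have fin: "(\<integral>\<^sup>+\<omega>\<in>B. indicator A (\<omega>, t) \<partial>M) \<noteq> \<infinity>"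
      proof -
        have "(\<integral>\<^sup>+\<omega>\<in>B. indicator A (\<omega>, t) \<partial>M) \<le> (\<integral>\<^sup>+\<omega>. 1 \<partial>M)"
          by (intro nn_integral_mono) (auto simp: indicator_def)
        also have "\<dots> = 1" by (simp add: emeasure_space_1)
        finally show ?thesis by (auto simp: top_unique)
      qed
      have "(\<integral>\<^sup>+\<omega>\<in>B. indicator (space M \<times> space T - A) (\<omega>, t) \<partial>M)
          = (\<integral>\<^sup>+\<omega>. indicator B \<omega> - indicator A (\<omega>, t) * indicator B \<omega> \<partial>M)"
        using t by (intro nn_integral_cong) (auto simp: indicator_def)
      also have "\<dots> = (\<integral>\<^sup>+\<omega>. indicator B \<omega> \<partial>M) - (\<integral>\<^sup>+\<omega>\<in>B. indicator A (\<omega>, t) \<partial>M)"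
        using fin At by (intro nn_integral_diff) (auto split: split_indicator)
      also have "\<dots> = (\<integral>\<^sup>+\<omega>. indicator B \<omega> \<partial>M) - (\<integral>\<^sup>+\<omega>\<in>B. P (\<omega>, t) \<partial>M)"
        using eq[OF t B] by simp
      also have "\<dots> = (\<integral>\<^sup>+\<omega>. indicator B \<omega> - P (\<omega>, t) * indicator B \<omega> \<partial>M)"
        using fin eq[OF t B] le
        by (intro nn_integral_diff[symmetric]) (auto simp: indicator_def)
      also have "\<dots> = (\<integral>\<^sup>+\<omega>\<in>B. ?P (\<omega>, t) \<partial>M)"
        by (intro nn_integral_cong) (auto simp: indicator_def)
      finally show ?thesis .
    qed
    then show ?case by (intro bexI[of _ ?P]) auto
  next
    case (union A)
    then have "\<forall>i. \<exists>P. P \<in> borel_measurable (F \<Otimes>\<^sub>M T) \<and> (\<forall>t\<in>space T. \<forall>B\<in>sets F.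
        (\<integral>\<^sup>+\<omega>\<in>B. indicator (A i) (\<omega>, t) \<partial>M) = (\<integral>\<^sup>+\<omega>\<in>B. (P (\<omega>, t) :: ennreal) \<partial>M))"
      by blast
    from choice[OF this] obtain P where P': "\<forall>i. P i \<in> borel_measurable (F \<Otimes>\<^sub>M T) \<and>
        (\<forall>t\<in>space T. \<forall>B\<in>sets F.
        (\<integral>\<^sup>+\<omega>\<in>B. indicator (A i) (\<omega>, t) \<partial>M) = (\<integral>\<^sup>+\<omega>\<in>B. (P i (\<omega>, t) :: ennreal) \<partial>M))"
      ..
    have P[measurable]: "\<And>i. P i \<in> borel_measurable (F \<Otimes>\<^sub>M T)"
      and eq: "\<And>i t B. t \<in> space T \<Longrightarrow> B \<in> sets F \<Longrightarrow>
        (\<integral>\<^sup>+\<omega>\<in>B. indicator (A i) (\<omega>, t) \<partial>M) = (\<integral>\<^sup>+\<omega>\<in>B. (P i (\<omega>, t) :: ennreal) \<partial>M)"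
      using P' by blast+
    have A[measurable]: "A i \<in> sets (M \<Otimes>\<^sub>M T)" for i
      using union(2) by (auto simp: sets_pair_measure)
    let ?P = "\<lambda>x. \<Sum>i. P i x"
    have "(\<integral>\<^sup>+\<omega>\<in>B. indicator (\<Union>i. A i) (\<omega>, t) \<partial>M) = (\<integral>\<^sup>+\<omega>\<in>B. ?P (\<omega>, t) \<partial>M)"
      if t: "t \<in> space T" and B: "B \<in> sets F" for t B
    proof -
      have [measurable]: "B \<in> sets M" using sets_FM B .
      have [measurable]: "(\<lambda>\<omega>. indicator (A i) (\<omega>, t) :: ennreal) \<in> borel_measurable M" for i
        using t by measurable
      have [measurable]: "(\<lambda>\<omega>. P i (\<omega>, t)) \<in> borel_measurable M" for i
        by (rule from_F) (use t in measurable)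
      have "(\<integral>\<^sup>+\<omega>\<in>B. indicator (\<Union>i. A i) (\<omega>, t) \<partial>M)
          = (\<integral>\<^sup>+\<omega>. (\<Sum>i. indicator (A i) (\<omega>, t) * indicator B \<omega>) \<partial>M)"
        by (intro nn_integral_cong) (simp only: ennreal_suminf_multc suminf_indicator[OF union(1)])
      also have "\<dots> = (\<Sum>i. \<integral>\<^sup>+\<omega>\<in>B. indicator (A i) (\<omega>, t) \<partial>M)"
        by (rule nn_integral_suminf) measurable
      also have "\<dots> = (\<Sum>i. \<integral>\<^sup>+\<omega>\<in>B. P i (\<omega>, t) \<partial>M)"
        using eq[OF t B] by simp
      also have "\<dots> = (\<integral>\<^sup>+\<omega>. (\<Sum>i. P i (\<omega>, t) * indicator B \<omega>) \<partial>M)"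
        by (rule nn_integral_suminf[symmetric]) measurable
      also have "\<dots> = (\<integral>\<^sup>+\<omega>\<in>B. ?P (\<omega>, t) \<partial>M)" by simp
      finally show ?thesis .
    qed
    then show ?case by (intro bexI[of _ ?P]) auto
  qed
qed

lemma joint_nn_cond_exp:
  fixes f :: "'a \<times> 'b \<Rightarrow> ennreal"
  assumes "prob_space M" "subalgebra M F" "f \<in> borel_measurable (M \<Otimes>\<^sub>M T)"
  shows "\<exists>P\<in>borel_measurable (F \<Otimes>\<^sub>M T). \<forall>t\<in>space T. \<forall>B\<in>sets F.
    (\<integral>\<^sup>+\<omega>\<in>B. f (\<omega>, t) \<partial>M) = (\<integral>\<^sup>+\<omega>\<in>B. (P (\<omega>, t) :: ennreal) \<partial>M)"
proof -
  interpret prob_space M by fact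
  interpret finite_measure_subalgebra M F by unfold_locales fact
  have sets_FM: "B \<in> sets M" if "B \<in> sets F" for B
    using that assms(2) by (auto simp: subalgebra_def)
  have from_F: "f \<in> borel_measurable M" if "f \<in> borel_measurable F" for f :: "'a \<Rightarrow> ennreal"
    using measurable_from_subalg[OF assms(2) that] .
  show ?thesis
    using assms(3)
  proof (induction rule: borel_measurable_induct)
    case (cong f g)
    then obtain P where P: "P \<in> borel_measurable (F \<Otimes>\<^sub>M T)"
      "\<forall>t\<in>space T. \<forall>B\<in>sets F. (\<integral>\<^sup>+\<omega>\<in>B. g (\<omega>, t) \<partial>M) = (\<integral>\<^sup>+\<omega>\<in>B. P (\<omega>, t) \<partial>M)"
      by blast
    have "(\<integral>\<^sup>+\<omega>\<in>B. f (\<omega>, t) \<partial>M) = (\<integral>\<^sup>+\<omega>\<in>B. g (\<omega>, t) \<partial>M)" if "t \<in> space T" for t B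
      using that cong(3) by (intro nn_integral_cong) (auto simp: space_pair_measure)
    then show ?case using P by (intro bexI[of _ P]) auto
  next
    case (set A)
    then show ?case using joint_nn_cond_exp_sets[OF assms(1,2)] by blast
  next
    case (mult u c)
    then obtain P where [measurable]: "P \<in> borel_measurable (F \<Otimes>\<^sub>M T)"
      and eq: "\<And>t B. t \<in> space T \<Longrightarrow> B \<in> sets F \<Longrightarrow>
        (\<integral>\<^sup>+\<omega>\<in>B. u (\<omega>, t) \<partial>M) = (\<integral>\<^sup>+\<omega>\<in>B. P (\<omega>, t) \<partial>M)"
      by blast
    have "(\<integral>\<^sup>+\<omega>\<in>B. c * u (\<omega>, t) \<partial>M) = (\<integral>\<^sup>+\<omega>\<in>B. c * P (\<omega>, t) \<partial>M)"
      if t: "t \<in> space T" and B: "B \<in> sets F" for t B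
    proof -
      have [measurable]: "B \<in> sets M" using sets_FM B .
      have [measurable]: "(\<lambda>\<omega>. u (\<omega>, t)) \<in> borel_measurable M" using t mult(2) by measurable
      have [measurable]: "(\<lambda>\<omega>. P (\<omega>, t)) \<in> borel_measurable M"
        by (rule from_F) (use t in measurable)
      show ?thesis using eq[OF t B] by (simp add: nn_integral_cmult mult.assoc)
    qed
    then show ?case by (intro bexI[of _ "\<lambda>x. c * P x"]) auto
  next
    case (add u v)
    then obtain P Q where [measurable]: "P \<in> borel_measurable (F \<Otimes>\<^sub>M T)" "Q \<in> borel_measurable (F \<Otimes>\<^sub>M T)"
      and eq: "\<And>t B. t \<in> space T \<Longrightarrow> B \<in> sets F \<Longrightarrow>
        (\<integral>\<^sup>+\<omega>\<in>B. u (\<omega>, t) \<partial>M) = (\<integral>\<^sup>+\<omega>\<in>B. P (\<omega>, t) \<partial>M)"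
      "\<And>t B. t \<in> space T \<Longrightarrow> B \<in> sets F \<Longrightarrow>
        (\<integral>\<^sup>+\<omega>\<in>B. v (\<omega>, t) \<partial>M) = (\<integral>\<^sup>+\<omega>\<in>B. Q (\<omega>, t) \<partial>M)"
      by blast
    have "(\<integral>\<^sup>+\<omega>\<in>B. v (\<omega>, t) + u (\<omega>, t) \<partial>M) = (\<integral>\<^sup>+\<omega>\<in>B. Q (\<omega>, t) + P (\<omega>, t) \<partial>M)"
      if t: "t \<in> space T" and B: "B \<in> sets F" for t B
    proof -
      have [measurable]: "B \<in> sets M" using sets_FM B .
      have [measurable]: "(\<lambda>\<omega>. u (\<omega>, t)) \<in> borel_measurable M" "(\<lambda>\<omega>. v (\<omega>, t)) \<in> borel_measurable M"
        using t add(1,3) by measurable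
      have [measurable]: "(\<lambda>\<omega>. P (\<omega>, t)) \<in> borel_measurable M"
        by (rule from_F) (use t in measurable)
      have [measurable]: "(\<lambda>\<omega>. Q (\<omega>, t)) \<in> borel_measurable M"
        by (rule from_F) (use t in measurable)
      show ?thesis using eq[OF t B] by (simp add: nn_integral_add distrib_right)
    qed
    then show ?case by (intro bexI[of _ "\<lambda>x. Q x + P x"]) auto
  next
    case (seq u)
    have "\<forall>i. \<exists>P. P \<in> borel_measurable (F \<Otimes>\<^sub>M T) \<and> (\<forall>t\<in>space T. \<forall>B\<in>sets F.
        (\<integral>\<^sup>+\<omega>\<in>B. u i (\<omega>, t) \<partial>M) = (\<integral>\<^sup>+\<omega>\<in>B. (P (\<omega>, t) :: ennreal) \<partial>M))"
      using seq.IH by blast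
    from choice[OF this] obtain P where P': "\<forall>i. P i \<in> borel_measurable (F \<Otimes>\<^sub>M T) \<and>
        (\<forall>t\<in>space T. \<forall>B\<in>sets F.
        (\<integral>\<^sup>+\<omega>\<in>B. u i (\<omega>, t) \<partial>M) = (\<integral>\<^sup>+\<omega>\<in>B. (P i (\<omega>, t) :: ennreal) \<partial>M))"
      ..
    have P[measurable]: "\<And>i. P i \<in> borel_measurable (F \<Otimes>\<^sub>M T)"
      and eq: "\<And>i t B. t \<in> space T \<Longrightarrow> B \<in> sets F \<Longrightarrow>
        (\<integral>\<^sup>+\<omega>\<in>B. u i (\<omega>, t) \<partial>M) = (\<integral>\<^sup>+\<omega>\<in>B. (P i (\<omega>, t) :: ennreal) \<partial>M)"
      using P' by blast+
    let ?P = "\<lambda>x. SUP i. P i x"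
    have "(\<integral>\<^sup>+\<omega>\<in>B. (SUP i. u i) (\<omega>, t) \<partial>M) = (\<integral>\<^sup>+\<omega>\<in>B. ?P (\<omega>, t) \<partial>M)"
      if t: "t \<in> space T" and B: "B \<in> sets F" for t B
    proof -
      have [measurable]: "B \<in> sets M" using sets_FM B .
      have ut[measurable]: "(\<lambda>\<omega>. u i (\<omega>, t)) \<in> borel_measurable M" for i
        using t seq(1)[of i] by measurable
      have PF[measurable]: "(\<lambda>\<omega>. P i (\<omega>, t)) \<in> borel_measurable F" for i
        using t by measurable
      have [measurable]: "(\<lambda>\<omega>. P i (\<omega>, t)) \<in> borel_measurable M" for i
        by (rule from_F[OF PF])
      have ch: "AE \<omega> in M. P i (\<omega>, t) = nn_cond_exp M F (\<lambda>\<omega>. u i (\<omega>, t)) \<omega>" for i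
        by (rule nn_cond_exp_charact) (use eq[OF t] in auto)
      have le: "u i x \<le> u (Suc i) x" for i x
        using incseq_SucD[OF \<open>incseq u\<close>, of i] by (rule le_funD)
      have mono: "AE \<omega> in M. P i (\<omega>, t) \<le> P (Suc i) (\<omega>, t)" for i
      proof -
        have "AE \<omega> in M. nn_cond_exp M F (\<lambda>\<omega>. u i (\<omega>, t)) \<omega> \<le> nn_cond_exp M F (\<lambda>\<omega>. u (Suc i) (\<omega>, t)) \<omega>"
          by (rule nn_cond_exp_mono) (auto simp: le)
        then show ?thesis using ch[of i] ch[of "Suc i"] by eventually_elim simp
      qed
      have "(\<integral>\<^sup>+\<omega>\<in>B. (SUP i. u i) (\<omega>, t) \<partial>M) = (\<integral>\<^sup>+\<omega>. (SUP i. u i (\<omega>, t) * indicator B \<omega>) \<partial>M)"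
        by (intro nn_integral_cong) (simp only: SUP_apply SUP_mult_right_ennreal)
      also have "\<dots> = (SUP i. \<integral>\<^sup>+\<omega>\<in>B. u i (\<omega>, t) \<partial>M)"
      proof (rule nn_integral_monotone_convergence_SUP)
        show "incseq (\<lambda>i \<omega>. u i (\<omega>, t) * indicator B \<omega>)"
          by (intro incseq_SucI le_funI mult_right_mono le) simp
      qed measurable
      also have "\<dots> = (SUP i. \<integral>\<^sup>+\<omega>\<in>B. P i (\<omega>, t) \<partial>M)"
        using eq[OF t B] by simp
      also have "\<dots> = (\<integral>\<^sup>+\<omega>. (SUP i. P i (\<omega>, t) * indicator B \<omega>) \<partial>M)"
      proof (rule nn_integral_monotone_convergence_SUP_AE[symmetric])
        show "AE \<omega> in M. P i (\<omega>, t) * indicator B \<omega> \<le> P (Suc i) (\<omega>, t) * indicator B \<omega>" for i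
          using mono[of i] by eventually_elim (auto intro: mult_right_mono)
      qed measurable
      also have "\<dots> = (\<integral>\<^sup>+\<omega>\<in>B. ?P (\<omega>, t) \<partial>M)"
        by (intro nn_integral_cong) (simp only: SUP_mult_right_ennreal)
      finally show ?thesis .
    qed
    then show ?case by (intro bexI[of _ ?P]) auto
  qed
qed

lemma joint_real_cond_exp:
  fixes Z :: "'a \<Rightarrow> 'b \<Rightarrow> real"
  assumes "prob_space M" "subalgebra M F" "case_prod Z \<in> borel_measurable (M \<Otimes>\<^sub>M T)"
  shows "\<exists>P. case_prod P \<in> borel_measurable (M \<Otimes>\<^sub>M T) \<and>
    (\<forall>t\<in>space T. AE \<omega> in M. P \<omega> t = real_cond_exp M F (\<lambda>\<omega>. Z \<omega> t) \<omega>)"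
proof -
  interpret prob_space M by fact
  interpret finite_measure_subalgebra M F by unfold_locales fact
  note [measurable] = assms(3)
  have pos: "\<exists>P\<in>borel_measurable (M \<Otimes>\<^sub>M T). \<forall>t\<in>space T. AE \<omega> in M.
      P (\<omega>, t) = nn_cond_exp M F (\<lambda>\<omega>. f (\<omega>, t)) \<omega>"
    if f[measurable]: "f \<in> borel_measurable (M \<Otimes>\<^sub>M T)" for f
  proof -
    obtain P where P[measurable]: "P \<in> borel_measurable (F \<Otimes>\<^sub>M T)" and
      eq: "\<And>t B. t \<in> space T \<Longrightarrow> B \<in> sets F \<Longrightarrow>
        (\<integral>\<^sup>+\<omega>\<in>B. f (\<omega>, t) \<partial>M) = (\<integral>\<^sup>+\<omega>\<in>B. (P (\<omega>, t) :: ennreal) \<partial>M)"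
      using joint_nn_cond_exp[OF assms(1,2) f] by blast
    have "(\<lambda>x. x) \<in> measurable M F"
      using assms(2) by (auto simp: subalgebra_def measurable_def)
    then have "(\<lambda>x. P (fst x, snd x)) \<in> borel_measurable (M \<Otimes>\<^sub>M T)"
      by (intro measurable_compose[OF measurable_Pair P])
        (auto intro: measurable_compose[OF measurable_fst])
    moreover have "AE \<omega> in M. P (\<omega>, t) = nn_cond_exp M F (\<lambda>\<omega>. f (\<omega>, t)) \<omega>"
      if t: "t \<in> space T" for t
      by (rule nn_cond_exp_charact) (use t eq[OF t] in \<open>auto intro: measurable_compose[OF measurable_Pair2' f]\<close>)
    ultimately show ?thesis by auto
  qed
  obtain P where [measurable]: "P \<in> borel_measurable (M \<Otimes>\<^sub>M T)" and
    P: "\<And>t. t \<in> space T \<Longrightarrow> AE \<omega> in M. P (\<omega>, t) = nn_cond_exp M F (\<lambda>\<omega>. ennreal (Z \<omega> t)) \<omega>"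
    using pos[of "\<lambda>x. ennreal (case_prod Z x)"] by auto
  obtain Q where [measurable]: "Q \<in> borel_measurable (M \<Otimes>\<^sub>M T)" and
    Q: "\<And>t. t \<in> space T \<Longrightarrow> AE \<omega> in M. Q (\<omega>, t) = nn_cond_exp M F (\<lambda>\<omega>. ennreal (- Z \<omega> t)) \<omega>"
    using pos[of "\<lambda>x. ennreal (- case_prod Z x)"] by auto
  show ?thesis
  proof (intro exI[of _ "\<lambda>\<omega> t. enn2real (P (\<omega>, t)) - enn2real (Q (\<omega>, t))"] conjI ballI)
    show "AE \<omega> in M. enn2real (P (\<omega>, t)) - enn2real (Q (\<omega>, t)) = real_cond_exp M F (\<lambda>\<omega>. Z \<omega> t) \<omega>"
      if "t \<in> space T" for t
      using P[OF that] Q[OF that] by eventually_elim (simp add: real_cond_exp_def)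
  qed measurable
qed

lemma is_predictable_gradient_exists:
  assumes "prob_space M" and U: "\<And>k. U k \<in> borel_measurable M"
    and Z: "case_prod Z \<in> borel_measurable (M \<Otimes>\<^sub>M time)"
  shows "\<exists>P. is_predictable_gradient M U Z P"
proof -
  have "\<forall>k::int. \<exists>P. case_prod P \<in> borel_measurable (M \<Otimes>\<^sub>M time) \<and>
    (\<forall>t\<in>space time. AE \<omega> in M.
      P \<omega> t = real_cond_exp M (jump_filtration M U (2 * of_int k)) (\<lambda>\<omega>. Z \<omega> t) \<omega>)"
    by (intro allI joint_real_cond_exp assms(1) subalgebra_jump_filtration U Z)
  from choice[OF this] obtain P where P': "\<forall>k. case_prod (P k) \<in> borel_measurable (M \<Otimes>\<^sub>M time) \<and>
    (\<forall>t\<in>space time. AE \<omega> in M.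
      P k \<omega> t = real_cond_exp M (jump_filtration M U (2 * of_int k)) (\<lambda>\<omega>. Z \<omega> t) \<omega>)"
    ..
  have [measurable]: "\<And>k. case_prod (P k) \<in> borel_measurable (M \<Otimes>\<^sub>M time)" and
    P: "\<And>k t. t \<in> space time \<Longrightarrow> AE \<omega> in M.
      P k \<omega> t = real_cond_exp M (jump_filtration M U (2 * of_int k)) (\<lambda>\<omega>. Z \<omega> t) \<omega>"
    using P' by auto
  have fl: "(\<lambda>x. \<lfloor>snd x / 2\<rfloor>) \<in> measurable (M \<Otimes>\<^sub>M time) (count_space UNIV)"
    by (rule measurable_compose[OF measurable_snd]) (auto intro!: measurable_restrict_space1)
  have "(\<lambda>x. case_prod (P \<lfloor>snd x / 2\<rfloor>) x) \<in> borel_measurable (M \<Otimes>\<^sub>M time)"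
    by (rule measurable_compose_countable[OF _ fl]) measurable
  then have "is_predictable_gradient M U Z (\<lambda>\<omega> t. P \<lfloor>t / 2\<rfloor> \<omega> t)"
    unfolding is_predictable_gradient_def discrete_filtration_def
    using P by (auto simp: case_prod_beta')
  then show ?thesis by blast
qed

lemma nn_factorization:
  fixes g :: "'a \<Rightarrow> ennreal"
  assumes X: "X \<in> S \<rightarrow> space N" and "g \<in> borel_measurable (vimage_algebra S X N)"
  shows "\<exists>h\<in>borel_measurable N. \<forall>\<omega>\<in>S. g \<omega> = h (X \<omega>)"
  using assms(2)
proof (induction rule: borel_measurable_induct)
  case (cong f g)
  then show ?case by (auto simp: space_vimage_algebra)
next
  case (set A)
  then obtain B where "B \<in> sets N" "A = X -` B \<inter> S" using X by (auto simp: sets_vimage_algebra2)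
  then show ?case by (intro bexI[of _ "indicator B"]) (auto simp: indicator_def)
next
  case (mult u c)
  then obtain h where "h \<in> borel_measurable N" "\<forall>\<omega>\<in>S. u \<omega> = h (X \<omega>)" by blast
  then show ?case by (intro bexI[of _ "\<lambda>x. c * h x"]) auto
next
  case (add u v)
  then obtain h k where "h \<in> borel_measurable N" "\<forall>\<omega>\<in>S. u \<omega> = h (X \<omega>)"
    "k \<in> borel_measurable N" "\<forall>\<omega>\<in>S. v \<omega> = k (X \<omega>)" by blast
  then show ?case by (intro bexI[of _ "\<lambda>x. k x + h x"]) auto
next
  case (seq u)
  then have "\<forall>i. \<exists>h. h \<in> borel_measurable N \<and> (\<forall>\<omega>\<in>S. u i \<omega> = h (X \<omega>))" by blast
  then obtain h where "\<And>i. h i \<in> borel_measurable N" "\<And>i. \<forall>\<omega>\<in>S. u i \<omega> = h i (X \<omega>)" by metis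
  then show ?case by (intro bexI[of _ "\<lambda>x. SUP i. h i x"]) (auto simp: image_comp)
qed

lemma is_cond_exp_given_value_exists:
  "\<exists>g. is_cond_exp_given_value M X V g"
proof -
  let ?F = "vimage_algebra (space M) X borel"
  have ex: "\<exists>h\<in>borel_measurable borel. \<forall>\<omega>\<in>space M. nn_cond_exp M ?F f \<omega> = h (X \<omega>)" for f
    by (rule nn_factorization) auto
  obtain h where [measurable]: "h \<in> borel_measurable borel"
    and "\<forall>\<omega>\<in>space M. nn_cond_exp M ?F (\<lambda>\<omega>. ennreal (V \<omega>)) \<omega> = h (X \<omega>)"
    using ex[of "\<lambda>\<omega>. ennreal (V \<omega>)"] ..
  moreover obtain k where [measurable]: "k \<in> borel_measurable borel"
    and "\<forall>\<omega>\<in>space M. nn_cond_exp M ?F (\<lambda>\<omega>. ennreal (- V \<omega>)) \<omega> = k (X \<omega>)"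
    using ex[of "\<lambda>\<omega>. ennreal (- V \<omega>)"] ..
  ultimately have "is_cond_exp_given_value M X V (\<lambda>x. enn2real (h x) - enn2real (k x))"
    by (auto simp: is_cond_exp_given_value_def real_cond_exp_def)
  then show ?thesis by blast
qed

lemma is_phi_exists:
  assumes "prob_space M" "uniform_iid M U" "X \<in> gradient_domain M U"
  shows "\<exists>\<phi>. is_phi M U X \<phi>"
proof -
  obtain DX where DX: "is_gradient M U X DX" using assms(3) by (auto simp: gradient_domain_def)
  have "U k \<in> borel_measurable M" for k
    using assms by (auto simp: uniform_iid_def prob_space.indep_vars_def)
  then obtain P where P: "is_predictable_gradient M U DX P"
    using is_predictable_gradient_exists[of M U DX] assms(1) DX unfolding is_gradient_def by blast
  obtain g where "is_cond_exp_given_value M X (\<lambda>\<omega>. \<integral>t. DX \<omega> t * P \<omega> t \<partial>time) g"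
    using is_cond_exp_given_value_exists by blast
  then have "is_phi M U X (\<lambda>z. 1 / 2 * g z)"
    unfolding is_phi_def using DX P by blast
  then show ?thesis by blast
qed

end

theory Submission
  imports Defs "HOL-Real_Asymp.Real_Asymp"
begin

text \<open>
  Write \<open>E\<^sub>k\<close> for the conditional expectation given \<open>U\<^sub>0, \<dots>, U\<^sub>k\<^sub>-\<^sub>1\<close>, which up to null sets is
  that given \<open>\<F>\<^sub>2\<^sub>k\<close>. For \<open>F = f(U\<^sub>0, \<dots>, U\<^sub>n)\<close> and \<open>t = 2k + 1 + s\<close>, integration by parts in the
  single variable \<open>U\<^sub>k\<close> shows that \<open>E\<^sub>k[D\<^sub>t F]\<close> is \<open>E\<^sub>k F\<close> minus the value of \<open>E\<^sub>k\<^sub>+\<^sub>1 F\<close> at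
  \<open>U\<^sub>k = s\<close>. Integrating the product of two such
  differences over \<open>s\<close> gives the covariance of the increments \<open>E\<^sub>k\<^sub>+\<^sub>1 - E\<^sub>k\<close>, and the sum over \<open>k\<close>
  telescopes to \<open>Cov(F, X) = 1/2 E[\<integral> D\<^sub>t F E[D\<^sub>t X | discrete filtration] dt]\<close>. Since \<open>D\<close> is a
  derivation, \<open>F = h(X)\<close> yields \<open>E[X h(X)] = E[h'(X) \<phi>(X)]\<close>, and the bounds follow from Stein's method.

  For Lipschitz \<open>h\<close> the normal Stein equation is solved by interpolating between \<open>x\<close> and a Gaussian
  variable, which gives \<open>|f'| \<le> E|N| \<le> 1\<close>; for \<open>h\<close> with values in \<open>[0,1]\<close> the explicit solution satisfies
  \<open>|x f(x)| \<le> 1\<close>, hence \<open>|f'| \<le> 2\<close>. For the gamma law, the derivative of the Stein solution satisfies a second order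
  equation with zeroth order coefficient \<open>-2\<close> and right-hand side \<open>h''\<close>, so it is bounded by a maximum principle.
\<close>

section \<open>Lipschitz test functions and square integrability\<close>

text \<open>The obstacle is that \<open>X\<close> is only an L2 limit, while the computation slot by
  slot needs functions of finitely many variables. The covariance formula is therefore used
  asymmetrically: it is extended by continuity to \<open>X\<close> in the factor that carries the
  plain gradient. Self-adjointness of conditional expectation then moves the projection onto
  \<open>DX\<close>, whose version \<open>P\<close> stays fixed while the other factor runs through
  h(X_m) with X_m cylindrical. Since D h(X_m) = h'(X_m) D X_m, boundedness and continuity of h'
  suffice for the limit. The identity is thus available for h with bounded continuous derivative,
  and the remaining work is to meet that class. Lipschitz test functions are smoothed before Stein's
  equation is solved; Borel sets are reached from continuous functions through closed sets and inner
  regularity; gamma solutions, which live on (-\<nu>, \<infinity>), are shifted inward. The factor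
  1/2 in \<open>\<phi>\<close> reflects that a slot of time has length 2 while the uniform law has
  mass 1.\<close>

lemma bounded_deriv_lipschitz:
  fixes h h' :: "real \<Rightarrow> real"
  assumes "\<And>x. (h has_real_derivative h' x) (at x)" "\<And>x. \<bar>h' x\<bar> \<le> L"
  shows "\<bar>h x - h y\<bar> \<le> L * \<bar>x - y\<bar>"
  using field_differentiable_bound[of UNIV h h' L x y] assms by auto

lemma borel_measurable_DERIV:
  fixes h h' :: "real \<Rightarrow> real"
  assumes "\<And>x. (h has_real_derivative h' x) (at x)"
  shows "h \<in> borel_measurable borel"
  by (rule borel_measurable_continuous_onI[OF DERIV_continuous_on[OF assms]])

lemma integrable_bounded_mult:
  fixes a Y :: "'a \<Rightarrow> real"
  assumes Y: "integrable M Y" and [measurable]: "a \<in> borel_measurable M" and a: "\<And>x. \<bar>a x\<bar> \<le> L"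
  shows "integrable M (\<lambda>x. a x * Y x)"
proof (rule Bochner_Integration.integrable_bound)
  show "integrable M (\<lambda>x. L * \<bar>Y x\<bar>)" using Y by simp
  show "(\<lambda>x. a x * Y x) \<in> borel_measurable M"
    using borel_measurable_integrable[OF Y] by measurable
  have "\<bar>a x * Y x\<bar> \<le> L * \<bar>Y x\<bar>" for x
    unfolding abs_mult by (rule mult_right_mono[OF a]) simp
  then show "AE x in M. norm (a x * Y x) \<le> norm (L * \<bar>Y x\<bar>)"
    by (intro AE_I2) (simp add: order_trans[OF _ abs_ge_self])
qed

lemma integrable_mult_L2:
  fixes a b :: "'a \<Rightarrow> real"
  assumes [measurable]: "a \<in> borel_measurable M" "b \<in> borel_measurable M"
    and "integrable M (\<lambda>x. (a x)\<^sup>2)" "integrable M (\<lambda>x. (b x)\<^sup>2)"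
  shows "integrable M (\<lambda>x. a x * b x)"
proof (rule Bochner_Integration.integrable_bound[OF Bochner_Integration.integrable_add[OF assms(3,4)]])
  show "AE x in M. norm (a x * b x) \<le> norm ((a x)\<^sup>2 + (b x)\<^sup>2)"
  proof (intro AE_I2)
    fix x
    have "2 * (\<bar>a x\<bar> * \<bar>b x\<bar>) \<le> (a x)\<^sup>2 + (b x)\<^sup>2"
      using sum_squares_bound[of "\<bar>a x\<bar>" "\<bar>b x\<bar>"] by (simp add: mult.assoc)
    moreover have "0 \<le> \<bar>a x\<bar> * \<bar>b x\<bar>" by simp
    ultimately have "\<bar>a x\<bar> * \<bar>b x\<bar> \<le> (a x)\<^sup>2 + (b x)\<^sup>2" by linarith
    then show "norm (a x * b x) \<le> norm ((a x)\<^sup>2 + (b x)\<^sup>2)" by (simp add: abs_mult)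
  qed
qed measurable

lemma integrable_diff_L2:
  fixes a b :: "'a \<Rightarrow> real"
  assumes "a \<in> borel_measurable M" "b \<in> borel_measurable M"
    and "integrable M (\<lambda>x. (a x)\<^sup>2)" "integrable M (\<lambda>x. (b x)\<^sup>2)"
  shows "integrable M (\<lambda>x. (a x - b x)\<^sup>2)"
proof -
  have "integrable M (\<lambda>x. (a x)\<^sup>2 + (b x)\<^sup>2 - 2 * (a x * b x))"
    using integrable_mult_L2[OF assms] assms(3,4) by auto
  then show ?thesis by (simp add: power2_diff mult.assoc)
qed

text \<open>Cauchy-Schwarz in the weighted form 2ab \<le> e a^2 + b^2 / e: the first term is small
  through \<open>e\<close>, the second through the convergence in L2.\<close>

lemma tendsto_integral_mult_L2:
  fixes h u :: "'a \<Rightarrow> real" and us :: "nat \<Rightarrow> 'a \<Rightarrow> real"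
  assumes [measurable]: "h \<in> borel_measurable M" "u \<in> borel_measurable M" "\<And>n. us n \<in> borel_measurable M"
    and h: "integrable M (\<lambda>x. (h x)\<^sup>2)" and u: "integrable M (\<lambda>x. (u x)\<^sup>2)"
    and us: "\<And>n. integrable M (\<lambda>x. (us n x)\<^sup>2)"
    and lim: "(\<lambda>n. \<integral>x. (us n x - u x)\<^sup>2 \<partial>M) \<longlonglongrightarrow> 0"
  shows "integrable M (\<lambda>x. \<bar>h x\<bar> * \<bar>us n x - u x\<bar>)"
    and "(\<lambda>n. \<integral>x. \<bar>h x\<bar> * \<bar>us n x - u x\<bar> \<partial>M) \<longlonglongrightarrow> 0"
    and "(\<lambda>n. \<integral>x. h x * us n x \<partial>M) \<longlonglongrightarrow> (\<integral>x. h x * u x \<partial>M)"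
proof -
  have d: "integrable M (\<lambda>x. (us n x - u x)\<^sup>2)" for n
    by (intro integrable_diff_L2 us u) auto
  show hd: "integrable M (\<lambda>x. \<bar>h x\<bar> * \<bar>us n x - u x\<bar>)" for n
    by (rule integrable_mult_L2) (use h d in auto)
  let ?I = "\<lambda>n. \<integral>x. \<bar>h x\<bar> * \<bar>us n x - u x\<bar> \<partial>M"
  let ?H = "\<integral>x. (h x)\<^sup>2 \<partial>M"
  have H0: "0 \<le> ?H" by simp
  have le: "?I n \<le> (e * ?H + (1 / e) * (\<integral>x. (us n x - u x)\<^sup>2 \<partial>M)) / 2" if e: "e > 0" for n e
  proof -
    have "?I n \<le> (\<integral>x. (e * (h x)\<^sup>2 + (1 / e) * (us n x - u x)\<^sup>2) / 2 \<partial>M)"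
    proof (rule integral_mono[OF hd])
      show "integrable M (\<lambda>x. (e * (h x)\<^sup>2 + (1 / e) * (us n x - u x)\<^sup>2) / 2)"
        using h d by (auto intro!: Bochner_Integration.integrable_add)
      fix x
      have "0 \<le> (e * \<bar>h x\<bar> - \<bar>us n x - u x\<bar>)\<^sup>2" by simp
      also have "\<dots> = e * (e * (h x)\<^sup>2 + (1 / e) * (us n x - u x)\<^sup>2 - 2 * (\<bar>h x\<bar> * \<bar>us n x - u x\<bar>))"
        using e by (simp add: power2_eq_square algebra_simps)
      finally show "\<bar>h x\<bar> * \<bar>us n x - u x\<bar> \<le> (e * (h x)\<^sup>2 + (1 / e) * (us n x - u x)\<^sup>2) / 2"
        using e by (simp add: zero_le_mult_iff)
    qed
    also have "\<dots> = (e * ?H + (1 / e) * (\<integral>x. (us n x - u x)\<^sup>2 \<partial>M)) / 2"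
      using Bochner_Integration.integral_add[OF integrable_mult_right[OF h, of e] integrable_mult_right[OF d[of n], of "1 / e"]]
      by simp
    finally show ?thesis .
  qed
  show I0: "?I \<longlonglongrightarrow> 0"
  proof (rule LIMSEQ_I)
    fix r :: real assume r: "0 < r"
    \<comment> \<open>Keeps the first weighted term e * ?H below r; the summand 1 covers ?H = 0. The
      second term is below r once the squared L2 distance is below e * r, and half the sum is then
      below r.\<close>
    define e where "e = r / (?H + 1)"
    have e: "e > 0" unfolding e_def by (rule divide_pos_pos) (use r H0 in linarith)+
    have "?H + 1 \<noteq> 0" using H0 by linarith
    then have "e * (?H + 1) = r" by (simp add: e_def)
    then have eH: "e * ?H < r" using e by (simp add: distrib_left)
    from LIMSEQ_D[OF lim, of "e * r"] e r obtain N where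
      N: "\<And>n. n \<ge> N \<Longrightarrow> norm ((\<integral>x. (us n x - u x)\<^sup>2 \<partial>M) - 0) < e * r" by auto
    show "\<exists>N. \<forall>n\<ge>N. norm (?I n - 0) < r"
    proof (intro exI allI impI)
      fix n assume n: "N \<le> n"
      have "(1 / e) * (\<integral>x. (us n x - u x)\<^sup>2 \<partial>M) < r"
        using N[OF n] e by (simp add: field_simps)
      with eH have "e * ?H + (1 / e) * (\<integral>x. (us n x - u x)\<^sup>2 \<partial>M) < r + r" by (rule add_strict_mono)
      then have "(e * ?H + (1 / e) * (\<integral>x. (us n x - u x)\<^sup>2 \<partial>M)) / 2 < r" by simp
      with le[OF e, of n] have "?I n < r" by (rule le_less_trans)
      moreover have "0 \<le> ?I n" by (rule integral_nonneg_AE) simp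
      ultimately show "norm (?I n - 0) < r" by simp
    qed
  qed
  have "(\<lambda>n. (\<integral>x. h x * us n x \<partial>M) - (\<integral>x. h x * u x \<partial>M)) \<longlonglongrightarrow> 0"
  proof (rule Lim_null_comparison[OF _ I0])
    have "norm ((\<integral>x. h x * us n x \<partial>M) - (\<integral>x. h x * u x \<partial>M)) \<le> ?I n" for n
    proof -
      have "(\<integral>x. h x * us n x \<partial>M) - (\<integral>x. h x * u x \<partial>M) = (\<integral>x. h x * (us n x - u x) \<partial>M)"
        using integrable_mult_L2[of h M "us n"] integrable_mult_L2[of h M u] h u us by (simp add: right_diff_distrib)
      then show ?thesis
        using integral_abs_bound[of M "\<lambda>x. h x * (us n x - u x)"] by (simp add: abs_mult)
    qed
    then show "\<forall>\<^sub>F n in sequentially. norm ((\<integral>x. h x * us n x \<partial>M) - (\<integral>x. h x * u x \<partial>M)) \<le> ?I n"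
      by simp
  qed
  then show "(\<lambda>n. \<integral>x. h x * us n x \<partial>M) \<longlonglongrightarrow> (\<integral>x. h x * u x \<partial>M)"
    by (rule LIM_zero_cancel)
qed

lemma (in prob_space) abs_integral_le_const:
  fixes f :: "'a \<Rightarrow> real"
  assumes "f \<in> borel_measurable M" "\<And>x. \<bar>f x\<bar> \<le> B"
  shows "\<bar>\<integral>x. f x \<partial>M\<bar> \<le> B"
proof -
  have "integrable M f"
    by (rule integrable_const_bound[of _ B]) (use assms in auto)
  then have "expectation f \<le> B" "- B \<le> expectation f"
    using assms(2) by (auto intro!: integral_le_const integral_ge_const simp: abs_le_iff minus_le_iff)
  then show ?thesis by (simp add: abs_le_iff)
qed

lemma (in prob_space) integrable_lipschitz_L2:
  assumes [measurable]: "Y \<in> borel_measurable M" and Y: "integrable M (\<lambda>\<omega>. (Y \<omega>)\<^sup>2)"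
    and h: "\<And>x. (h has_real_derivative h' x) (at x)" and L: "\<And>x. \<bar>h' x\<bar> \<le> (L :: real)"
  shows "integrable M (\<lambda>\<omega>. (h (Y \<omega>))\<^sup>2)"
proof (rule Bochner_Integration.integrable_bound)
  note [measurable] = borel_measurable_DERIV[OF h]
  show "(\<lambda>\<omega>. (h (Y \<omega>))\<^sup>2) \<in> borel_measurable M" by measurable
  show "integrable M (\<lambda>\<omega>. 2 * L\<^sup>2 * (Y \<omega>)\<^sup>2 + 2 * (h 0)\<^sup>2)" using Y by simp
  have "(h y)\<^sup>2 \<le> 2 * L\<^sup>2 * y\<^sup>2 + 2 * (h 0)\<^sup>2" for y
  proof -
    \<comment> \<open>The right side minus the left side is the square of h y - 2 h 0.\<close>
    have "(h y)\<^sup>2 \<le> 2 * (h y - h 0)\<^sup>2 + 2 * (h 0)\<^sup>2"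
      using sum_squares_ge_zero[of "h y - 2 * h 0" 0] by (simp add: power2_eq_square algebra_simps)
    moreover have "(h y - h 0)\<^sup>2 \<le> L\<^sup>2 * y\<^sup>2"
      using power_mono[OF bounded_deriv_lipschitz[OF h L, of y 0], of 2] by (simp add: power_mult_distrib)
    ultimately show ?thesis by simp
  qed
  then show "AE \<omega> in M. norm ((h (Y \<omega>))\<^sup>2) \<le> norm (2 * L\<^sup>2 * (Y \<omega>)\<^sup>2 + 2 * (h 0)\<^sup>2)"
    by (intro AE_I2) (simp add: order_trans[OF _ abs_ge_self])
qed

section \<open>Independent uniform variables on the sequence space\<close>

abbreviation unif :: "real measure" where
  "unif \<equiv> uniform_measure lborel {-1..1}"

abbreviation unif_seq :: "(nat \<Rightarrow> real) measure" where
  "unif_seq \<equiv> PiM UNIV (\<lambda>_. unif)"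

lemma prob_space_unif: "prob_space unif"
  by (rule prob_space_uniform_measure) auto

lemma sets_unif [measurable_cong]: "sets unif = sets borel"
  by simp

lemma unif_eq_density: "unif = density lborel (\<lambda>x. ennreal (indicator {-1..1} x / 2))"
proof -
  have "1 / 2 = ennreal (1 / 2)"
    using divide_ennreal[of 1 2] by simp
  then show ?thesis
    unfolding uniform_measure_def by (intro density_cong) (auto simp: indicator_def)
qed

lemma integral_unif:
  fixes f :: "real \<Rightarrow> real"
  assumes [measurable]: "f \<in> borel_measurable borel"
  shows "(\<integral>x. f x \<partial>unif) = (\<integral>x. indicator {-1..1} x * f x \<partial>lborel) / 2"
  unfolding unif_eq_density by (subst integral_density) auto

text \<open>The end point -1 is left out on purpose: the value -1 of \<open>U k\<close> would put a
  jump at time 2k, where the filtration at time 2k already sees it. With values in (-1, 1] the jump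
  falls into the slot (2k, 2k + 2].\<close>

lemma AE_unif: "AE x in unif. -1 < x \<and> x \<le> 1"
proof -
  have "AE x in lborel. x \<noteq> (-1::real)" by (rule AE_lborel_singleton)
  then show ?thesis
    unfolding unif_eq_density by (subst AE_density) (auto simp: indicator_def elim!: eventually_mono)
qed

interpretation unif: prob_space unif by (rule prob_space_unif)
interpretation unif_prod: product_prob_space "\<lambda>_::nat. unif" UNIV ..

lemma sets_unif_seq [measurable_cong]: "sets unif_seq = sets (PiM UNIV (\<lambda>_. borel))"
  by (rule sets_PiM_cong) auto

lemma sets_unif_seq_borel: "sets unif_seq = sets borel"
  by (simp add: sets_unif_seq sets_PiM_equal_borel)

lemma space_unif_seq [simp]: "space unif_seq = UNIV"
  by (simp add: space_PiM PiE_UNIV_domain)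

lemma distr_unif_seq_component: "distr unif_seq borel (\<lambda>u. u k) = unif"
proof -
  have "distr unif_seq unif (\<lambda>u. u k) = unif"
    by (rule unif_prod.PiM_component) auto
  then show ?thesis
    by (metis distr_cong sets_unif)
qed

lemma AE_unif_seq: "AE u in unif_seq. \<forall>k. -1 < u k \<and> u k \<le> 1"
proof -
  have "AE u in unif_seq. -1 < u k \<and> u k \<le> 1" for k
  proof -
    have "AE x in distr unif_seq borel (\<lambda>u. u k). -1 < x \<and> x \<le> 1"
      unfolding distr_unif_seq_component by (rule AE_unif)
    then show ?thesis by (subst (asm) AE_distr_iff) auto
  qed
  then show ?thesis by (simp add: AE_all_countable)
qed

section \<open>Gluing and resampling of coordinates\<close>

definition glue :: "nat set \<Rightarrow> (nat \<Rightarrow> real) \<Rightarrow> (nat \<Rightarrow> real) \<Rightarrow> nat \<Rightarrow> real" where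
  "glue J u v j = (if j \<in> J then u j else v j)"

lemma measurable_glue [measurable]:
  "(\<lambda>(u, v). glue J u v) \<in> measurable (unif_seq \<Otimes>\<^sub>M unif_seq) unif_seq"
proof (rule measurable_PiM_single')
  show "(\<lambda>x. (case x of (u, v) \<Rightarrow> glue J u v) j) \<in> measurable (unif_seq \<Otimes>\<^sub>M unif_seq) unif" for j
    by (cases "j \<in> J") (simp_all add: glue_def case_prod_beta')
qed simp

text \<open>On a cylinder the event factors into a condition on each of two independent copies, and
  the product over the index set splits accordingly. Integrating out some of the coordinates thus
  becomes integration over a second full copy, all on the same space.\<close>

lemma distr_glue:
  "distr (unif_seq \<Otimes>\<^sub>M unif_seq) unif_seq (\<lambda>(u, v). glue J u v) = unif_seq"
proof (rule unif_prod.PiM_eq)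
  interpret P: pair_prob_space unif_seq unif_seq ..
  fix K :: "nat set" and F :: "nat \<Rightarrow> real set"
  assume K: "finite K" "K \<subseteq> UNIV" and F: "\<And>j. j \<in> K \<Longrightarrow> F j \<in> sets unif"
  let ?E = "\<lambda>L. prod_emb UNIV (\<lambda>_. unif) L (\<Pi>\<^sub>E j\<in>L. F j)"
  have E [measurable]: "?E L \<in> sets unif_seq" if "L \<subseteq> K" for L
    using that K F by (intro sets_PiM_I) (auto intro: finite_subset)
  have E_em: "emeasure unif_seq (?E L) = (\<Prod>j\<in>L. emeasure unif (F j))" if "L \<subseteq> K" for L
    using that K F by (intro unif_prod.emeasure_PiM_emb) (auto intro: finite_subset)
  have "emeasure (distr (unif_seq \<Otimes>\<^sub>M unif_seq) unif_seq (\<lambda>(u, v). glue J u v)) (?E K)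
      = emeasure (unif_seq \<Otimes>\<^sub>M unif_seq) (?E (K \<inter> J) \<times> ?E (K - J))"
  proof (subst emeasure_distr)
    show "?E K \<in> sets unif_seq" by (rule E) simp
    have "(\<lambda>(u, v). glue J u v) -` ?E K \<inter> space (unif_seq \<Otimes>\<^sub>M unif_seq)
        = ?E (K \<inter> J) \<times> ?E (K - J)"
      by (auto simp: prod_emb_def glue_def space_pair_measure PiE_iff; metis)
    then show "emeasure (unif_seq \<Otimes>\<^sub>M unif_seq)
        ((\<lambda>(u, v). glue J u v) -` ?E K \<inter> space (unif_seq \<Otimes>\<^sub>M unif_seq))
      = emeasure (unif_seq \<Otimes>\<^sub>M unif_seq) (?E (K \<inter> J) \<times> ?E (K - J))" by simp
  qed measurable
  also have "\<dots> = emeasure unif_seq (?E (K \<inter> J)) * emeasure unif_seq (?E (K - J))"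
    by (intro unif_prod.P.emeasure_pair_measure_Times) auto
  also have "\<dots> = (\<Prod>j\<in>K. emeasure unif (F j))"
    by (simp add: E_em prod.Int_Diff[OF K(1), of _ J])
  finally show "emeasure (distr (unif_seq \<Otimes>\<^sub>M unif_seq) unif_seq (\<lambda>(u, v). glue J u v)) (?E K)
      = (\<Prod>j\<in>K. emeasure unif (F j))" .
qed simp

lemma integral_glue:
  fixes f :: "(nat \<Rightarrow> real) \<Rightarrow> real"
  assumes [measurable]: "f \<in> borel_measurable unif_seq" and B: "\<And>u. \<bar>f u\<bar> \<le> B"
  shows "(\<integral>u. f u \<partial>unif_seq) = (\<integral>u. \<integral>v. f (glue J u v) \<partial>unif_seq \<partial>unif_seq)"
proof -
  interpret P: pair_prob_space unif_seq unif_seq ..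
  have "(\<integral>u. f u \<partial>unif_seq) = (\<integral>x. f (case x of (u, v) \<Rightarrow> glue J u v) \<partial>(unif_seq \<Otimes>\<^sub>M unif_seq))"
    by (subst distr_glue[of J, symmetric], subst integral_distr) auto
  also have "\<dots> = (\<integral>(u, v). f (glue J u v) \<partial>(unif_seq \<Otimes>\<^sub>M unif_seq))"
    by (simp add: case_prod_beta')
  also have "\<dots> = (\<integral>u. \<integral>v. f (glue J u v) \<partial>unif_seq \<partial>unif_seq)"
  proof (rule P.integral_fst[symmetric])
    show "integrable (unif_seq \<Otimes>\<^sub>M unif_seq) (\<lambda>(u, v). f (glue J u v))"
      by (rule P.P.integrable_const_bound[of _ B]) (auto simp: B)
  qed
  finally show ?thesis .
qed


lemma measurable_seq_upd [measurable (raw)]: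
  assumes [measurable]: "u \<in> measurable N unif_seq" "r \<in> borel_measurable N"
  shows "(\<lambda>x. (u x)(k := r x)) \<in> measurable N unif_seq"
proof (rule measurable_PiM_single')
  show "(\<lambda>x. ((u x)(k := r x)) j) \<in> measurable N unif" for j
    by (cases "j = k") simp_all
qed simp

lemma seq_upd_measurable [measurable]: "(\<lambda>r. u(k := r)) \<in> measurable borel unif_seq"
  by measurable

text \<open>Gluing that keeps all coordinates but \<open>k\<close>: of the second copy only its k-th
  coordinate matters, and that has law \<open>unif\<close>.\<close>

lemma integral_resample:
  fixes f :: "(nat \<Rightarrow> real) \<Rightarrow> real"
  assumes [measurable]: "f \<in> borel_measurable unif_seq" and B: "\<And>u. \<bar>f u\<bar> \<le> B"
  shows "(\<integral>u. f u \<partial>unif_seq) = (\<integral>u. \<integral>r. f (u(k := r)) \<partial>unif \<partial>unif_seq)"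
proof -
  have "(\<integral>u. f u \<partial>unif_seq) = (\<integral>u. \<integral>v. f (glue (- {k}) u v) \<partial>unif_seq \<partial>unif_seq)"
    by (rule integral_glue) fact+
  also have "\<dots> = (\<integral>u. \<integral>v. f (u(k := v k)) \<partial>unif_seq \<partial>unif_seq)"
    by (intro Bochner_Integration.integral_cong refl arg_cong[where f=f]) (auto simp: glue_def)
  also have "\<dots> = (\<integral>u. \<integral>r. f (u(k := r)) \<partial>unif \<partial>unif_seq)"
  proof (intro Bochner_Integration.integral_cong refl)
    fix u :: "nat \<Rightarrow> real"
    show "(\<integral>v. f (u(k := v k)) \<partial>unif_seq) = (\<integral>r. f (u(k := r)) \<partial>unif)"
      by (subst distr_unif_seq_component[of k, symmetric], subst integral_distr) auto
  qed
  finally show ?thesis .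
qed

section \<open>Conditional expectation given the first coordinates\<close>

definition trunc :: "nat \<Rightarrow> (nat \<Rightarrow> real) \<Rightarrow> nat \<Rightarrow> real" where
  "trunc k u = glue {..<k} u (\<lambda>_. 0)"

lemma measurable_trunc [measurable]: "trunc k \<in> measurable unif_seq unif_seq"
proof (rule measurable_PiM_single')
  show "(\<lambda>u. trunc k u j) \<in> measurable unif_seq unif" for j
    by (cases "j < k") (simp_all add: trunc_def glue_def)
qed simp

lemma trunc_glue: "k \<le> m \<Longrightarrow> trunc k (glue {..<m} u v) = trunc k u"
  by (auto simp: trunc_def glue_def)

lemma trunc_upd: "k \<le> m \<Longrightarrow> trunc k (u(m := s)) = trunc k u"
  by (auto simp: trunc_def glue_def)

lemma trunc_trunc: "k \<le> m \<Longrightarrow> trunc k (trunc m u) = trunc k u"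
  by (auto simp: trunc_def glue_def)

text \<open>The conditional expectation given the first \<open>k\<close> coordinates, in the version
  that integrates the others out. It is defined at every point, so it can be evaluated at a
  prescribed value of a coordinate, as \<open>incr\<close> does below.\<close>

definition cexp :: "nat \<Rightarrow> ((nat \<Rightarrow> real) \<Rightarrow> real) \<Rightarrow> (nat \<Rightarrow> real) \<Rightarrow> real" where
  "cexp k f u = (\<integral>v. f (glue {..<k} u v) \<partial>unif_seq)"

lemma measurable_glue' [measurable (raw)]:
  assumes [measurable]: "u \<in> measurable N unif_seq" "v \<in> measurable N unif_seq"
  shows "(\<lambda>x. glue J (u x) (v x)) \<in> measurable N unif_seq"
  using measurable_compose[OF measurable_Pair[OF assms] measurable_glue[of J]] by simp

lemma measurable_cexp [measurable]:
  assumes [measurable]: "f \<in> borel_measurable unif_seq"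
  shows "cexp k f \<in> borel_measurable unif_seq"
  unfolding cexp_def [abs_def] by measurable

lemma abs_cexp_le:
  assumes [measurable]: "f \<in> borel_measurable unif_seq" and "\<And>u. \<bar>f u\<bar> \<le> B"
  shows "\<bar>cexp k f u\<bar> \<le> B"
  unfolding cexp_def using assms(2) by (intro unif_prod.P.abs_integral_le_const) auto

lemma glue_trunc: "glue {..<k} (trunc k u) v = glue {..<k} u v"
  by (auto simp: trunc_def glue_def)

lemma cexp_trunc: "cexp k f (trunc k u) = cexp k f u"
  by (simp add: cexp_def glue_trunc)

lemma cexp_eq_self:
  assumes "\<And>u. f (trunc k u) = f u"
  shows "cexp k f u = f u"
proof -
  have "f (glue {..<k} u v) = f u" for v
    using trunc_glue[of k k u v] assms[of u] assms[of "glue {..<k} u v"] by simp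
  then show ?thesis using unif_prod.P.prob_space by (simp add: cexp_def)
qed

lemma cexp_0: "cexp 0 f u = (\<integral>v. f v \<partial>unif_seq)"
  by (simp add: cexp_def glue_def[abs_def])

text \<open>Gluing leaves the first \<open>k\<close> coordinates alone, so the weight
  \<open>q\<close> comes out of the inner integral. Dependence on these coordinates alone is
  expressed as invariance under \<open>trunc k\<close>; the value 0 that it inserts elsewhere is
  arbitrary.\<close>

lemma integral_mult_cexp:
  fixes f q :: "(nat \<Rightarrow> real) \<Rightarrow> real"
  assumes [measurable]: "f \<in> borel_measurable unif_seq" "q \<in> borel_measurable unif_seq"
    and B: "\<And>u. \<bar>f u\<bar> \<le> B" "\<And>u. \<bar>q u\<bar> \<le> C" and q: "\<And>u. q (trunc k u) = q u"
  shows "(\<integral>u. q u * f u \<partial>unif_seq) = (\<integral>u. q u * cexp k f u \<partial>unif_seq)"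
proof -
  have *: "q (glue {..<k} u v) = q u" for u v
    using trunc_glue[of k k u v] q[of u] q[of "glue {..<k} u v"] by simp
  have "\<bar>q u * f u\<bar> \<le> C * B" for u
    unfolding abs_mult using B[of u] by (intro mult_mono) auto
  then have "(\<integral>u. q u * f u \<partial>unif_seq)
      = (\<integral>u. \<integral>v. q (glue {..<k} u v) * f (glue {..<k} u v) \<partial>unif_seq \<partial>unif_seq)"
    by (intro integral_glue) auto
  also have "\<dots> = (\<integral>u. q u * cexp k f u \<partial>unif_seq)"
    by (simp add: * cexp_def)
  finally show ?thesis .
qed

text \<open>
  For \<open>t = 2k + 1 + s\<close> in the \<open>k\<close>-th slot, \<open>D\<^sub>t F\<close> is the \<open>k\<close>-th partial derivative times
  \<open>kern U\<^sub>k s\<close>, and \<open>incr k f U s\<close> is its conditional expectation given \<open>U\<^sub>0, \<dots>, U\<^sub>k\<^sub>-\<^sub>1\<close>.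
\<close>

definition incr :: "nat \<Rightarrow> ((nat \<Rightarrow> real) \<Rightarrow> real) \<Rightarrow> (nat \<Rightarrow> real) \<Rightarrow> real \<Rightarrow> real" where
  "incr k f u s = cexp k f u - cexp (Suc k) f (u(k := s))"

definition kern :: "real \<Rightarrow> real \<Rightarrow> real" where
  "kern r s = (if s \<le> r then 1 - r else - (1 + r))"

lemma measurable_kern [measurable (raw)]:
  assumes [measurable]: "a \<in> borel_measurable N" "b \<in> borel_measurable N"
  shows "(\<lambda>x. kern (a x) (b x)) \<in> borel_measurable N"
  unfolding kern_def by measurable

lemma incr_trunc: "incr k f (trunc k u) s = incr k f u s"
proof -
  have "trunc (Suc k) ((trunc k u)(k := s)) = trunc (Suc k) (u(k := s))"
    by (auto simp: trunc_def glue_def)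
  then have "cexp (Suc k) f ((trunc k u)(k := s)) = cexp (Suc k) f (u(k := s))"
    using cexp_trunc[of "Suc k" f] by metis
  then show ?thesis by (simp add: incr_def cexp_trunc)
qed

lemma measurable_incr [measurable (raw)]:
  assumes [measurable]: "f \<in> borel_measurable unif_seq"
    "u \<in> measurable N unif_seq" "r \<in> borel_measurable N"
  shows "(\<lambda>x. incr k f (u x) (r x)) \<in> borel_measurable N"
  unfolding incr_def by measurable

lemma abs_incr_le:
  assumes "f \<in> borel_measurable unif_seq" and "\<And>u. \<bar>f u\<bar> \<le> B"
  shows "\<bar>incr k f u s\<bar> \<le> 2 * B"
  using abs_cexp_le[OF assms, of k u] abs_cexp_le[OF assms, of "Suc k" "u(k := s)"]
  unfolding incr_def by linarith

section \<open>Integration by parts in a single variable\<close>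

lemma integral_kern:
  fixes g g' :: "real \<Rightarrow> real"
  assumes [measurable]: "g \<in> borel_measurable borel" "g' \<in> borel_measurable borel"
    and B: "\<And>r. \<bar>g r\<bar> \<le> B" "\<And>r. \<bar>g' r\<bar> \<le> B"
    and deriv: "\<And>r. r \<in> {-1..1} \<Longrightarrow> (g has_real_derivative g' r) (at r within {-1..1})"
    and s: "s \<in> {-1..1}"
  shows "(\<integral>r. g' r * kern r s \<partial>unif) = (\<integral>r. g r \<partial>unif) - g s"
proof -
  \<comment> \<open>The factors 1 - r and 1 + r of the kernel vanish at the end points 1 and -1, so
    only boundary terms at \<open>s\<close> survive: -(1 - s) g s - (1 + s) g s = -2 g s. The
    density 1/2 of \<open>unif\<close> then leaves - g s.\<close>
  have 1: "((\<lambda>r. g' r * (1 - r) - g r) has_integral (g 1 * (1 - 1) - g s * (1 - s))) {s..1}"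
  proof (rule fundamental_theorem_of_calculus)
    show "((\<lambda>r. g r * (1 - r)) has_vector_derivative g' r * (1 - r) - g r) (at r within {s..1})"
      if "r \<in> {s..1}" for r
      using DERIV_subset[OF deriv[of r], of "{s..1}"] that s
      unfolding has_real_derivative_iff_has_vector_derivative[symmetric]
      by (auto intro!: derivative_eq_intros)
  qed (use s in auto)
  have 2: "((\<lambda>r. - (g' r * (1 + r)) - g r) has_integral (- (g s * (1 + s)) - - (g (-1) * (1 + (-1))))) {-1..s}"
  proof (rule fundamental_theorem_of_calculus)
    show "((\<lambda>r. - (g r * (1 + r))) has_vector_derivative - (g' r * (1 + r)) - g r) (at r within {-1..s})"
      if "r \<in> {-1..s}" for r
      using DERIV_subset[OF deriv[of r], of "{-1..s}"] that s
      unfolding has_real_derivative_iff_has_vector_derivative[symmetric]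
      by (auto intro!: derivative_eq_intros)
  qed (use s in auto)
  let ?k = "\<lambda>r. g' r * kern r s - g r"
  have right: "(?k has_integral (g 1 * (1 - 1) - g s * (1 - s))) {s..1}"
    by (rule has_integral_eq[OF _ 1]) (auto simp: kern_def)
  \<comment> \<open>At r = s the kernel takes its other branch, so the integrands agree only off
    that point.\<close>
  have left: "(?k has_integral (- (g s * (1 + s)) - - (g (-1) * (1 + (-1))))) {-1..s}"
    by (rule has_integral_spike[OF negligible_sing[of s] _ 2]) (auto simp: kern_def algebra_simps)
  have hk: "(?k has_integral (- 2 * g s)) {-1..1}"
    using has_integral_combine[OF _ _ left right] s by (simp add: algebra_simps)
  have k_le: "\<bar>kern r s\<bar> \<le> 2" if "r \<in> {-1..1}" for r
    using that by (auto simp: kern_def)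
  have int1: "integrable unif (\<lambda>r. g' r * kern r s)"
  proof (rule unif.integrable_const_bound[of _ "B * 2"])
    show "AE r in unif. norm (g' r * kern r s) \<le> B * 2"
      using AE_unif
    proof eventually_elim
      case (elim r)
      have "0 \<le> B" using B(1)[of 0] by linarith
      then show ?case using elim B(2)[of r] k_le[of r] by (auto simp: abs_mult intro!: mult_mono)
    qed
  qed simp
  have int2: "integrable unif g"
    by (rule unif.integrable_const_bound[of _ B]) (auto simp: B)
  have "set_integrable lborel {-1..1} ?k"
  proof (rule set_integrable_bound[where f="\<lambda>_. B * 2 + B"])
    show "set_integrable lborel {-1..1::real} (\<lambda>_. B * 2 + B)"
      by (simp add: set_integrable_def)
    show "set_borel_measurable lborel {-1..1} ?k"
      unfolding set_borel_measurable_def by measurable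
    show "AE r in lborel. r \<in> {-1..1} \<longrightarrow> norm (?k r) \<le> norm (B * 2 + B)"
    proof (intro AE_I2 impI)
      fix r :: real assume r: "r \<in> {-1..1}"
      have "0 \<le> B" using B(1)[of 0] by linarith
      then have "\<bar>g' r * kern r s\<bar> \<le> B * 2"
        using B(2)[of r] k_le[OF r] by (auto simp: abs_mult intro!: mult_mono)
      then show "norm (?k r) \<le> norm (B * 2 + B)" using B(1)[of r] by auto
    qed
  qed
  then have "(LINT r:{-1..1}|lborel. ?k r) = - 2 * g s"
    using set_borel_integral_eq_integral(2) integral_unique[OF hk] by metis
  then have "(\<integral>r. ?k r \<partial>unif) = - g s"
    by (simp add: integral_unif set_lebesgue_integral_def)
  then show ?thesis using int1 int2 by simp
qed

text \<open>
  The counterpart of \<^const>\<open>C1b_cube\<close> on all of \<open>\<real>\<^sup>\<nat>\<close>: clipping the arguments to \<open>[-1,1]\<close> turns a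
  function on the cube, arbitrary outside, into a bounded measurable one.
\<close>

definition C1_cyl ::
    "nat \<Rightarrow> ((nat \<Rightarrow> real) \<Rightarrow> real) \<Rightarrow> (nat \<Rightarrow> (nat \<Rightarrow> real) \<Rightarrow> real) \<Rightarrow> bool" where
  "C1_cyl n f f' \<longleftrightarrow>
     f \<in> borel_measurable unif_seq \<and> (\<exists>B. \<forall>u. \<bar>f u\<bar> \<le> B) \<and> (\<forall>u. f (trunc (Suc n) u) = f u) \<and>
     (\<forall>k. f' k \<in> borel_measurable unif_seq \<and> (\<exists>B. \<forall>u. \<bar>f' k u\<bar> \<le> B) \<and>
       (n < k \<longrightarrow> (\<forall>u. f' k u = 0)) \<and>
       (\<forall>u. \<forall>s\<in>{-1..1}. ((\<lambda>s. f (u(k := s))) has_real_derivative f' k (u(k := s)))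
         (at s within {-1..1})))"

text \<open>Given the first \<open>k\<close> coordinates the weight \<open>q\<close> is constant, so
  coordinate \<open>k\<close> can be averaged first, and \<open>integral_kern\<close> turns the
  derivative into a difference of values of \<open>f\<close>. The weights will be indicators of past
  events, and also the increments of a second functional.\<close>

lemma integral_mult_gradient:
  assumes f: "C1_cyl n f f'"
    and [measurable]: "q \<in> borel_measurable unif_seq"
    and q: "\<And>u. \<bar>q u\<bar> \<le> C" "\<And>u. q (trunc k u) = q u" and s: "s \<in> {-1..1}"
  shows "(\<integral>u. q u * (f' k u * kern (u k) s) \<partial>unif_seq) = (\<integral>u. q u * incr k f u s \<partial>unif_seq)"
proof -
  have [measurable]: "f \<in> borel_measurable unif_seq" "f' k \<in> borel_measurable unif_seq"
    using f by (auto simp: C1_cyl_def)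
  obtain B1 B2 where B': "\<And>u. \<bar>f u\<bar> \<le> B1" "\<And>u. \<bar>f' k u\<bar> \<le> B2"
    using f unfolding C1_cyl_def by metis
  define B where "B = max B1 B2"
  have B: "\<bar>f u\<bar> \<le> B" "\<bar>f' k u\<bar> \<le> B" for u using B'[of u] by (auto simp: B_def)
  have B0: "0 \<le> B" using B(1)[of undefined] by linarith
  have C0: "0 \<le> C" using q(1)[of undefined] by linarith
  have q_upd: "q (u(k := r)) = q u" for u r
    using trunc_upd[of k k u r] q(2)[of u] q(2)[of "u(k := r)"] by simp
  \<comment> \<open>The kernel is bounded only for arguments in [-1, 1], whereas
    \<open>integral_resample\<close> asks for a bound at every point. Clipping alters the integrand
    on a null set only.\<close>
  define clip where "clip r = max (-1) (min 1 r)" for r :: real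
  have [measurable]: "clip \<in> borel_measurable borel" unfolding clip_def [abs_def] by measurable
  have clip: "clip r = r" if "r \<in> {-1..1}" for r using that by (auto simp: clip_def)
  have clip_in: "clip r \<in> {-1..1}" for r by (auto simp: clip_def)
  have k_le: "\<bar>kern (clip r) s\<bar> \<le> 2" for r
    using clip_in[of r] s by (auto simp: kern_def)
  have qf: "\<bar>q u * f u\<bar> \<le> C * B" for u
    unfolding abs_mult using q(1) B(1) by (intro mult_mono) (auto simp: C0)
  have "(\<integral>u. q u * (f' k u * kern (u k) s) \<partial>unif_seq)
      = (\<integral>u. q u * (f' k u * kern (clip (u k)) s) \<partial>unif_seq)"
  proof (rule integral_cong_AE)
    show "AE u in unif_seq. q u * (f' k u * kern (u k) s) = q u * (f' k u * kern (clip (u k)) s)"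
      using AE_unif_seq
    proof eventually_elim
      case (elim u)
      then have "clip (u k) = u k" by (intro clip) (auto simp: less_imp_le)
      then show ?case by simp
    qed
  qed measurable
  also have "\<dots> = (\<integral>u. \<integral>r. q (u(k := r)) * (f' k (u(k := r)) * kern (clip ((u(k := r)) k)) s) \<partial>unif \<partial>unif_seq)"
  proof (rule integral_resample)
    show "\<bar>q u * (f' k u * kern (clip (u k)) s)\<bar> \<le> C * (B * 2)" for u
      unfolding abs_mult using q(1)[of u] B(2)[of u] k_le by (intro mult_mono) (auto simp: B0 C0)
  qed measurable
  also have "\<dots> = (\<integral>u. q u * (\<integral>r. f' k (u(k := r)) * kern r s \<partial>unif) \<partial>unif_seq)"
  proof (intro Bochner_Integration.integral_cong refl)
    fix u
    have "(\<integral>r. f' k (u(k := r)) * kern (clip r) s \<partial>unif) = (\<integral>r. f' k (u(k := r)) * kern r s \<partial>unif)"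
    proof (rule integral_cong_AE)
      show "AE r in unif. f' k (u(k := r)) * kern (clip r) s = f' k (u(k := r)) * kern r s"
        using AE_unif by eventually_elim (simp add: clip)
    qed measurable
    then show "(\<integral>r. q (u(k := r)) * (f' k (u(k := r)) * kern (clip ((u(k := r)) k)) s) \<partial>unif)
        = q u * (\<integral>r. f' k (u(k := r)) * kern r s \<partial>unif)"
      by (simp add: q_upd)
  qed
  also have "\<dots> = (\<integral>u. q u * ((\<integral>r. f (u(k := r)) \<partial>unif) - f (u(k := s))) \<partial>unif_seq)"
  proof (intro Bochner_Integration.integral_cong refl arg_cong2[where f="(*)"])
    fix u show "(\<integral>r. f' k (u(k := r)) * kern r s \<partial>unif) = (\<integral>r. f (u(k := r)) \<partial>unif) - f (u(k := s))"
      by (rule integral_kern[where B=B])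
        (use f s in \<open>auto simp: C1_cyl_def B\<close>)
  qed
  also have "\<dots> = (\<integral>u. \<integral>r. q (u(k := r)) * f (u(k := r)) \<partial>unif \<partial>unif_seq) - (\<integral>u. q u * f (u(k := s)) \<partial>unif_seq)"
  proof -
    have m: "(\<lambda>u. (\<integral>r. f (u(k := r)) \<partial>unif)) \<in> borel_measurable unif_seq" by measurable
    have "\<bar>\<integral>r. f (u(k := r)) \<partial>unif\<bar> \<le> B" for u
      by (rule unif.abs_integral_le_const) (auto simp: B)
    then have i1: "integrable unif_seq (\<lambda>u. q u * (\<integral>r. f (u(k := r)) \<partial>unif))"
      using m q(1) by (intro unif_prod.P.integrable_const_bound[of _ "C * B"])
        (auto simp: abs_mult C0 intro!: mult_mono)
    have i2: "integrable unif_seq (\<lambda>u. q u * f (u(k := s)))"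
      using q(1) B by (intro unif_prod.P.integrable_const_bound[of _ "C * B"])
        (auto simp: abs_mult C0 intro!: mult_mono)
    show ?thesis using i1 i2 by (simp add: q_upd right_diff_distrib)
  qed
  also have "(\<integral>u. \<integral>r. q (u(k := r)) * f (u(k := r)) \<partial>unif \<partial>unif_seq) = (\<integral>u. q u * f u \<partial>unif_seq)"
    by (rule integral_resample[symmetric]) (use qf in measurable)
  also have "\<dots> = (\<integral>u. q u * cexp k f u \<partial>unif_seq)"
    by (rule integral_mult_cexp) (use B q in auto)
  also have "(\<integral>u. q u * f (u(k := s)) \<partial>unif_seq) = (\<integral>u. q u * cexp k (\<lambda>u. f (u(k := s))) u \<partial>unif_seq)"
    by (rule integral_mult_cexp) (use B q in auto)
  \<comment> \<open>Freezing coordinate \<open>k\<close> at \<open>s\<close> and averaging from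
    \<open>k\<close> on is the same as averaging from \<open>Suc k\<close> on, started at
    \<open>u(k := s)\<close>.\<close>
  also have "cexp k (\<lambda>u. f (u(k := s))) = (\<lambda>u. cexp (Suc k) f (u(k := s)))"
    unfolding cexp_def
    by (intro ext Bochner_Integration.integral_cong refl arg_cong[where f=f]) (auto simp: glue_def)
  also have "(\<integral>u. q u * cexp k f u \<partial>unif_seq) - (\<integral>u. q u * cexp (Suc k) f (u(k := s)) \<partial>unif_seq)
      = (\<integral>u. q u * incr k f u s \<partial>unif_seq)"
  proof -
    have i1: "integrable unif_seq (\<lambda>u. q u * cexp k f u)"
      using q(1) abs_cexp_le[of f B] B by (intro unif_prod.P.integrable_const_bound[of _ "C * B"])
        (auto simp: abs_mult C0 intro!: mult_mono)
    have i2: "integrable unif_seq (\<lambda>u. q u * cexp (Suc k) f (u(k := s)))"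
      using q(1) abs_cexp_le[of f B] B by (intro unif_prod.P.integrable_const_bound[of _ "C * B"])
        (auto simp: abs_mult C0 intro!: mult_mono)
    show ?thesis using i1 i2 by (simp add: incr_def right_diff_distrib)
  qed
  finally show ?thesis .
qed

text \<open>The increment of \<open>f\<close> is the weight against the gradient of
  \<open>g\<close>, which leaves a product of two increments. Averaging over \<open>s\<close>
  amounts to resampling coordinate \<open>k\<close>, so the result is the expected product of the
  k-th martingale differences, and the tower property disposes of the cross terms.\<close>

lemma integral_incr_gradient:
  assumes f: "C1_cyl n f f'" and g: "C1_cyl m g g'"
  shows "(\<integral>s. \<integral>u. incr k f u s * (g' k u * kern (u k) s) \<partial>unif_seq \<partial>unif)
     = (\<integral>u. cexp (Suc k) f u * cexp (Suc k) g u \<partial>unif_seq) - (\<integral>u. cexp k f u * cexp k g u \<partial>unif_seq)"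
proof -
  have [measurable]: "f \<in> borel_measurable unif_seq" "g \<in> borel_measurable unif_seq"
      "g' k \<in> borel_measurable unif_seq"
    using f g by (auto simp: C1_cyl_def)
  obtain B1 B2 where B': "\<And>u. \<bar>f u\<bar> \<le> B1" "\<And>u. \<bar>g u\<bar> \<le> B2"
    using f g unfolding C1_cyl_def by metis
  define B where "B = max B1 B2"
  have B: "\<bar>f u\<bar> \<le> B" "\<bar>g u\<bar> \<le> B" for u using B'[of u] by (auto simp: B_def)
  have B0: "0 \<le> B" using B(1)[of undefined] by linarith
  have cB: "\<bar>cexp j f u\<bar> \<le> B" "\<bar>cexp j g u\<bar> \<le> B" for u j
    by (auto intro!: abs_cexp_le B)
  have iB: "\<bar>incr j f u s\<bar> \<le> 2 * B" "\<bar>incr j g u s\<bar> \<le> 2 * B" for u j s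
    by (auto intro!: abs_incr_le B)
  let ?h = "\<lambda>u. (cexp k f u - cexp (Suc k) f u) * (cexp k g u - cexp (Suc k) g u)"
  interpret P: pair_prob_space unif_seq unif ..
  have upd: "cexp k f' (u(k := s)) = cexp k f' u" for f' u s
    using cexp_trunc[of k f' u] cexp_trunc[of k f' "u(k := s)"] trunc_upd[of k k u s] by simp
  have "(\<integral>s. \<integral>u. incr k f u s * (g' k u * kern (u k) s) \<partial>unif_seq \<partial>unif)
      = (\<integral>s. \<integral>u. incr k f u s * incr k g u s \<partial>unif_seq \<partial>unif)"
  proof (rule integral_cong_AE)
    show "AE s in unif. (\<integral>u. incr k f u s * (g' k u * kern (u k) s) \<partial>unif_seq)
        = (\<integral>u. incr k f u s * incr k g u s \<partial>unif_seq)"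
      using AE_unif
    proof eventually_elim
      case (elim s)
      then show ?case
        by (intro integral_mult_gradient[OF g, where C="2 * B"]) (auto simp: incr_trunc iB)
    qed
  qed measurable
  \<comment> \<open>\<open>cexp k\<close> ignores coordinate \<open>k\<close>, so the product of
    increments at \<open>s\<close> is \<open>?h\<close> with \<open>s\<close> put into that
    coordinate.\<close>
  also have "\<dots> = (\<integral>u. \<integral>s. ?h (u(k := s)) \<partial>unif \<partial>unif_seq)"
    unfolding upd incr_def[symmetric]
  proof (rule P.Fubini_integral)
    show "integrable (unif_seq \<Otimes>\<^sub>M unif) (\<lambda>(u, s). incr k f u s * incr k g u s)"
    proof (rule P.P.integrable_const_bound[of _ "(2 * B) * (2 * B)"])
      show "AE x in unif_seq \<Otimes>\<^sub>M unif. norm (case x of (u, s) \<Rightarrow> incr k f u s * incr k g u s) \<le> 2 * B * (2 * B)"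
        using iB B0 by (intro AE_I2) (auto simp only: split_beta real_norm_def abs_mult intro!: mult_mono)
    qed measurable
  qed
  also have "\<dots> = (\<integral>u. ?h u \<partial>unif_seq)"
  proof (rule integral_resample[symmetric])
    have "\<bar>cexp k f u - cexp (Suc k) f u\<bar> \<le> 2 * B" "\<bar>cexp k g u - cexp (Suc k) g u\<bar> \<le> 2 * B" for u
      using cB[of k u] cB[of "Suc k" u] by linarith+
    then show "\<bar>?h u\<bar> \<le> (2 * B) * (2 * B)" for u
      unfolding abs_mult using B0 by (intro mult_mono) auto
  qed measurable
  also have "\<dots> = (\<integral>u. cexp (Suc k) f u * cexp (Suc k) g u \<partial>unif_seq)
      - (\<integral>u. cexp k f u * cexp k g u \<partial>unif_seq)"
  proof -
    have i: "integrable unif_seq (\<lambda>u. cexp i f u * cexp j g u)" for i j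
      using cB by (intro unif_prod.P.integrable_const_bound[of _ "B * B"])
        (auto simp: abs_mult B0 intro!: mult_mono)
    have tr: "cexp k h (trunc (Suc k) u) = cexp k h u" for h u
      using trunc_trunc[of k "Suc k" u] cexp_trunc[of k h] by (metis le_SucI order_refl)
    \<comment> \<open>Tower property: \<open>cexp k g\<close> is an admissible weight both at level
      \<open>k\<close> and at level \<open>Suc k\<close>, so each side equals the integral of
      \<open>f\<close> against it.\<close>
    have 1: "(\<integral>u. cexp (Suc k) f u * cexp k g u \<partial>unif_seq) = (\<integral>u. cexp k f u * cexp k g u \<partial>unif_seq)"
      using integral_mult_cexp[of f "cexp k g" B B k] integral_mult_cexp[of f "cexp k g" B B "Suc k"] B cB
      by (simp add: tr cexp_trunc mult.commute)
    have 2: "(\<integral>u. cexp k f u * cexp (Suc k) g u \<partial>unif_seq) = (\<integral>u. cexp k f u * cexp k g u \<partial>unif_seq)"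
      using integral_mult_cexp[of g "cexp k f" B B k] integral_mult_cexp[of g "cexp k f" B B "Suc k"] B cB
      by (simp add: tr cexp_trunc)
    have "(\<integral>u. ?h u \<partial>unif_seq) = (\<integral>u. cexp k f u * cexp k g u \<partial>unif_seq)
        - (\<integral>u. cexp k f u * cexp (Suc k) g u \<partial>unif_seq)
        - ((\<integral>u. cexp (Suc k) f u * cexp k g u \<partial>unif_seq)
        - (\<integral>u. cexp (Suc k) f u * cexp (Suc k) g u \<partial>unif_seq))"
      using i by (simp add: left_diff_distrib right_diff_distrib)
    then show ?thesis using 1 2 by simp
  qed
  finally show ?thesis .
qed

section \<open>Identification of the filtration\<close>

text \<open>The augmentation of \<open>F\<close> by null events. \<open>M\<close> is not assumed
  complete, hence the restriction to \<open>sets M\<close>. It is needed because the jump process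
  determines the past variables only where all of them lie in (-1, 1], that is, up to a null
  set.\<close>

definition null_completion :: "'a measure \<Rightarrow> 'a measure \<Rightarrow> 'a measure" where
  "null_completion M F =
     sigma (space M) {T \<in> sets M. \<exists>A\<in>sets F. AE x in M. x \<in> T \<longleftrightarrow> x \<in> A}"

lemma space_null_completion [simp]: "space (null_completion M F) = space M"
  unfolding null_completion_def by (rule space_measure_of) (auto dest: sets.sets_into_space)

lemma sets_null_completion:
  assumes "space F = space M"
  shows "sets (null_completion M F) = {T \<in> sets M. \<exists>A\<in>sets F. AE x in M. x \<in> T \<longleftrightarrow> x \<in> A}"
proof -
  let ?S = "{T \<in> sets M. \<exists>A\<in>sets F. AE x in M. x \<in> T \<longleftrightarrow> x \<in> A}"
  have "sigma_algebra (space M) ?S"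
    unfolding sigma_algebra_iff2
  proof (intro conjI ballI allI impI)
    show "?S \<subseteq> Pow (space M)" by (auto dest: sets.sets_into_space)
    show "{} \<in> ?S" by auto
    fix T assume "T \<in> ?S"
    then obtain A where "T \<in> sets M" "A \<in> sets F" "AE x in M. x \<in> T \<longleftrightarrow> x \<in> A" by auto
    moreover from this have "AE x in M. x \<in> space M - T \<longleftrightarrow> x \<in> space F - A"
      using AE_space[of M] by (auto simp: assms)
    ultimately show "space M - T \<in> ?S" by blast
  next
    fix T :: "nat \<Rightarrow> 'a set" assume "range T \<subseteq> ?S"
    then have "\<forall>i. \<exists>A. A \<in> sets F \<and> (AE x in M. x \<in> T i \<longleftrightarrow> x \<in> A)" and T: "\<And>i. T i \<in> sets M" by auto
    then obtain A where A: "\<And>i. A i \<in> sets F" "\<And>i. AE x in M. x \<in> T i \<longleftrightarrow> x \<in> A i" by metis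
    have "AE x in M. \<forall>i. x \<in> T i \<longleftrightarrow> x \<in> A i" using A(2) by (simp add: AE_all_countable)
    then have "AE x in M. x \<in> (\<Union>i. T i) \<longleftrightarrow> x \<in> (\<Union>i. A i)" by eventually_elim auto
    moreover have "(\<Union>i. A i) \<in> sets F" using A(1) by auto
    ultimately show "(\<Union>i. T i) \<in> ?S" using T by blast
  qed
  then show ?thesis
    unfolding null_completion_def by (rule sigma_algebra.sets_measure_of_eq)
qed

lemma null_completionI:
  assumes "space F = space M" "T \<in> sets M" "A \<in> sets F" "AE x in M. x \<in> T \<longleftrightarrow> x \<in> A"
  shows "T \<in> sets (null_completion M F)"
  unfolding sets_null_completion[OF assms(1)] using assms(2-) by blast

lemma null_completionE:
  assumes "T \<in> sets (null_completion M F)" "space F = space M"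
  obtains A where "T \<in> sets M" "A \<in> sets F" "AE x in M. x \<in> T \<longleftrightarrow> x \<in> A"
  using assms(1) unfolding sets_null_completion[OF assms(2)] by blast

lemma subalgebra_null_completion:
  "space F = space M \<Longrightarrow> subalgebra M (null_completion M F)"
  by (auto simp: subalgebra_def sets_null_completion)

text \<open>Both sides are compared with the conditional expectation on the augmentation of
  \<open>F\<close>: an event there is almost surely equal to one of \<open>F\<close>, hence to one
  of \<open>G\<close>, and the characterizing integrals do not notice null sets.\<close>

lemma real_cond_exp_mod_null:
  assumes "prob_space M" and F: "subalgebra M F" and G: "subalgebra M G"
    and FG: "sets F \<subseteq> sets (null_completion M G)" and GF: "sets G \<subseteq> sets (null_completion M F)"
    and f: "integrable M f"
  shows "AE x in M. real_cond_exp M F f x = real_cond_exp M G f x"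
proof -
  interpret prob_space M by fact
  interpret F: finite_measure_subalgebra M F by unfold_locales fact
  interpret G: finite_measure_subalgebra M G by unfold_locales fact
  have sp: "space F = space M" "space G = space M" using F G by (auto simp: subalgebra_def)
  let ?H = "null_completion M F"
  interpret H: finite_measure_subalgebra M ?H
    by unfold_locales (rule subalgebra_null_completion[OF sp(1)])
  have FH: "sets F \<subseteq> sets ?H"
    using F by (auto simp: subalgebra_def intro!: null_completionI)
  have set_cong: "(\<integral>x\<in>T. h x \<partial>M) = (\<integral>x\<in>A. h x \<partial>M)"
    if "T \<in> sets M" "A \<in> sets M" "AE x in M. x \<in> T \<longleftrightarrow> x \<in> A" "integrable M h" for T A and h :: "'a \<Rightarrow> real"
  proof -
    note [measurable] = that(1,2) borel_measurable_integrable[OF that(4)]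
    show ?thesis
      unfolding set_lebesgue_integral_def
      by (intro integral_cong_AE) (use that(3) in \<open>auto simp: indicator_def elim!: eventually_mono\<close>)
  qed
  have "AE x in M. real_cond_exp M ?H f x = real_cond_exp M F f x"
  proof (rule H.real_cond_exp_charact[OF _ f F.real_cond_exp_int(1)[OF f]])
    show "(\<integral>x\<in>T. f x \<partial>M) = (\<integral>x\<in>T. real_cond_exp M F f x \<partial>M)" if T: "T \<in> sets ?H" for T
    proof -
      obtain A where A: "T \<in> sets M" "A \<in> sets F" "AE x in M. x \<in> T \<longleftrightarrow> x \<in> A"
        by (rule null_completionE[OF T sp(1)])
      then have "A \<in> sets M" using F by (auto simp: subalgebra_def)
      then show ?thesis
        using set_cong[OF A(1) _ A(3)] F.real_cond_exp_intA[OF f A(2)] f F.real_cond_exp_int(1)[OF f] by metis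
    qed
    show "real_cond_exp M F f \<in> borel_measurable ?H"
      using measurable_from_subalg[of ?H F "real_cond_exp M F f" borel] FH sp by (auto simp: subalgebra_def)
  qed
  moreover have "AE x in M. real_cond_exp M ?H f x = real_cond_exp M G f x"
  proof (rule H.real_cond_exp_charact[OF _ f G.real_cond_exp_int(1)[OF f]])
    show "(\<integral>x\<in>T. f x \<partial>M) = (\<integral>x\<in>T. real_cond_exp M G f x \<partial>M)" if T: "T \<in> sets ?H" for T
    proof -
      obtain A where A: "T \<in> sets M" "A \<in> sets F" "AE x in M. x \<in> T \<longleftrightarrow> x \<in> A"
        by (rule null_completionE[OF T sp(1)])
      obtain B where B: "B \<in> sets G" "AE x in M. x \<in> A \<longleftrightarrow> x \<in> B"
        by (rule null_completionE[OF subsetD[OF FG A(2)] sp(2)])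
      have "AE x in M. x \<in> T \<longleftrightarrow> x \<in> B" using A(3) B(2) by eventually_elim simp
      moreover have "B \<in> sets M" using B G by (auto simp: subalgebra_def)
      ultimately show ?thesis
        using set_cong[OF A(1)] G.real_cond_exp_intA[OF f B(1)] f G.real_cond_exp_int(1)[OF f] by metis
    qed
    show "real_cond_exp M G f \<in> borel_measurable ?H"
      using measurable_from_subalg[of ?H G "real_cond_exp M G f" borel] GF sp by (auto simp: subalgebra_def)
  qed
  ultimately show ?thesis by eventually_elim simp
qed

section \<open>The jump filtration and the past of the sequence\<close>

locale uniform_sequence = prob_space M for M :: "'a measure" +
  fixes U :: "nat \<Rightarrow> 'a \<Rightarrow> real"
  assumes uniform_iid: "uniform_iid M U"
begin

definition seq :: "'a \<Rightarrow> nat \<Rightarrow> real" where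
  "seq \<omega> = (\<lambda>k. U k \<omega>)"

lemma measurable_U [measurable]: "U k \<in> borel_measurable M"
  using uniform_iid by (auto simp: uniform_iid_def indep_vars_def)

lemma measurable_seq [measurable]: "seq \<in> measurable M unif_seq"
  unfolding seq_def [abs_def] by (rule measurable_PiM_single') auto

lemma distr_seq: "distr M unif_seq seq = unif_seq"
proof -
  have "distr M (PiM UNIV (\<lambda>_. borel)) (\<lambda>\<omega>. \<lambda>k\<in>UNIV. U k \<omega>) = PiM UNIV (\<lambda>k. distr M borel (U k))"
    using uniform_iid by (subst indep_vars_iff_distr_eq_PiM[symmetric]) (auto simp: uniform_iid_def)
  also have "\<dots> = unif_seq" using uniform_iid by (simp add: uniform_iid_def)
  finally show ?thesis
    unfolding seq_def [abs_def] restrict_UNIV by (metis distr_cong sets_unif_seq)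
qed

lemma integral_seq:
  fixes f :: "(nat \<Rightarrow> real) \<Rightarrow> real"
  assumes "f \<in> borel_measurable unif_seq"
  shows "(\<integral>\<omega>. f (seq \<omega>) \<partial>M) = (\<integral>u. f u \<partial>unif_seq)"
  using integral_distr[OF measurable_seq assms] by (simp add: distr_seq)

lemma AE_U: "AE \<omega> in M. \<forall>k. -1 < U k \<omega> \<and> U k \<omega> \<le> 1"
proof -
  have "AE u in distr M unif_seq seq. \<forall>k. -1 < u k \<and> u k \<le> 1"
    unfolding distr_seq by (rule AE_unif_seq)
  moreover have "{u \<in> space unif_seq. \<forall>k. -1 < u k \<and> u k \<le> 1} \<in> sets unif_seq" by measurable
  ultimately show ?thesis using AE_distr_iff[OF measurable_seq] by (auto simp: seq_def)
qed

text \<open>Because of the strict inequality -1 < \<open>U k\<close>, every jump of index at least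
  \<open>m\<close> comes strictly after time 2m.\<close>

lemma jump_process_eq:
  assumes U: "\<And>k. -1 < U k \<omega> \<and> U k \<omega> \<le> 1" and s: "s \<le> 2 * real m"
  shows "jump_process U s \<omega> = (\<Sum>k<m. indicator {2 * real k + 1 + U k \<omega> ..} s)"
  unfolding jump_process_def
proof (rule suminf_finite)
  fix k assume "k \<notin> {..<m}"
  then have "real m \<le> real k" by simp
  then show "(indicator {2 * real k + 1 + U k \<omega> ..} s :: real) = 0"
    using U[of k] s by (auto simp: indicator_def)
qed simp

text \<open>Generated by the truncated sequence as a whole, so that the indicator of a past event is
  a function of \<open>trunc k (seq \<omega>)\<close>, which is the kind of weight that
  \<open>integral_mult_gradient\<close> accepts.\<close>

definition past :: "nat \<Rightarrow> 'a measure" where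
  "past k = vimage_algebra (space M) (\<lambda>\<omega>. trunc k (seq \<omega>)) unif_seq"

lemma measurable_trunc_past [measurable]: "(\<lambda>\<omega>. trunc k (seq \<omega>)) \<in> measurable (past k) unif_seq"
  unfolding past_def by (rule measurable_vimage_algebra1) simp

lemma space_past [simp]: "space (past k) = space M"
  by (simp add: past_def)

lemma sets_past: "sets (past k) = {(\<lambda>\<omega>. trunc k (seq \<omega>)) -` S \<inter> space M | S. S \<in> sets unif_seq}"
  unfolding past_def by (rule sets_vimage_algebra2) simp

lemma subalgebra_past: "subalgebra M (past k)"
  by (auto simp: subalgebra_def sets_past intro!: measurable_sets[of _ M unif_seq])

lemma measurable_jump_process [measurable]: "jump_process U s \<in> borel_measurable M"
  unfolding jump_process_def indicator_def atLeast_iff by measurable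

lemma space_jump_filtration [simp]: "space (jump_filtration M U s) = space M"
  using subalgebra_jump_filtration[of U M s] by (auto simp: subalgebra_def)

lemma jump_filtration_sub_past:
  "sets (jump_filtration M U (2 * real k)) \<subseteq> sets (null_completion M (past k))"
proof -
  let ?G = "{jump_process U s -` B \<inter> space M | s B. 0 \<le> s \<and> s \<le> 2 * real k \<and> B \<in> sets borel}"
  have "?G \<subseteq> sets (null_completion M (past k))"
  proof safe
    fix s B assume s: "0 \<le> s" "s \<le> 2 * real k" and [measurable]: "B \<in> sets (borel :: real measure)"
    let ?Y = "\<lambda>\<omega>. \<Sum>j<k. indicator {2 * real j + 1 + trunc k (seq \<omega>) j ..} s :: real"
    have "(\<lambda>\<omega>. trunc k (seq \<omega>) j) \<in> borel_measurable (past k)" for j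
      by (rule measurable_compose[OF measurable_trunc_past]) measurable
    then have [measurable]: "?Y \<in> borel_measurable (past k)"
      unfolding indicator_def atLeast_iff by measurable
    have "?Y -` B \<inter> space (past k) \<in> sets (past k)" by measurable
    moreover have "AE \<omega> in M. \<omega> \<in> jump_process U s -` B \<inter> space M \<longleftrightarrow> \<omega> \<in> ?Y -` B \<inter> space (past k)"
      using AE_U
    proof eventually_elim
      case (elim \<omega>)
      then have "jump_process U s \<omega> = ?Y \<omega>"
        using s by (subst jump_process_eq[of _ _ k]) (auto simp: trunc_def glue_def seq_def intro!: sum.cong)
      then show ?case by simp
    qed
    moreover have "jump_process U s -` B \<inter> space M \<in> sets M" by measurable
    ultimately show "jump_process U s -` B \<inter> space M \<in> sets (null_completion M (past k))"
      by (intro null_completionI) auto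
  qed
  then have "sigma_sets (space (null_completion M (past k))) ?G \<subseteq> sets (null_completion M (past k))"
    by (rule sets.sigma_sets_subset)
  then show ?thesis
    unfolding jump_filtration_def by (subst sets_measure_of) (auto simp: space_measure_of_conv)
qed

lemma jump_filtration_event:
  assumes "0 \<le> s" "s \<le> t"
  shows "jump_process U s -` {x..} \<inter> space M \<in> sets (jump_filtration M U t)"
  unfolding jump_filtration_def using assms
  by (subst sets_measure_of) (auto intro!: sigma_sets.Basic exI[of _ s] exI[of _ "{x..}"])

text \<open>\<open>U j \<le> r\<close> says that jump number j has happened by time 2j + 1 + r. At
  that time all earlier jumps have happened and no later one has, so the event is that the counting
  process has reached j + 1.\<close>

lemma past_sub_jump_filtration:
  "sets (past k) \<subseteq> sets (null_completion M (jump_filtration M U (2 * real k)))"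
proof -
  let ?F = "jump_filtration M U (2 * real k)"
  let ?H = "null_completion M ?F"
  have spF: "space ?F = space M" by simp
  have U_H: "U j \<in> borel_measurable ?H" if j: "j < k" for j
  proof (rule borel_measurable_iff_le[THEN iffD2, rule_format])
    fix r :: real
    let ?T = "{\<omega> \<in> space M. U j \<omega> \<le> r}"
    have "\<exists>A\<in>sets ?F. AE \<omega> in M. \<omega> \<in> ?T \<longleftrightarrow> \<omega> \<in> A"
    proof -
      \<comment> \<open>Outside [-1, 1) the event is null or almost sure. Inside, the time 2j + 1 +
        r lies in [2j, 2j + 2), hence before 2k.\<close>
      consider "r < -1" | "-1 \<le> r" "r < 1" | "1 \<le> r" by linarith
      then show ?thesis
      proof cases
        case 1
        have "AE \<omega> in M. \<omega> \<in> ?T \<longleftrightarrow> \<omega> \<in> {}"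
          using AE_U by eventually_elim (use 1 in \<open>force dest: spec[of _ j]\<close>)
        then show ?thesis by blast
      next
        case 2
        let ?s = "2 * real j + 1 + r"
        let ?A = "jump_process U ?s -` {real j + 1..} \<inter> space M"
        have jk: "real j + 1 \<le> real k" using j by linarith
        have "?A \<in> sets ?F" using 2 jk by (intro jump_filtration_event) auto
        moreover have "AE \<omega> in M. \<omega> \<in> ?T \<longleftrightarrow> \<omega> \<in> ?A"
          using AE_U AE_space
        proof eventually_elim
          case (elim \<omega>)
          have "jump_process U ?s \<omega> = (\<Sum>i<Suc j. indicator {2 * real i + 1 + U i \<omega> ..} ?s)"
            using elim 2 by (intro jump_process_eq) auto
          also have "\<dots> = (\<Sum>i<j. indicator {2 * real i + 1 + U i \<omega> ..} ?s) + indicator {U j \<omega>..} r"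
            by (simp add: indicator_def)
          also have "(\<Sum>i<j. indicator {2 * real i + 1 + U i \<omega> ..} ?s :: real) = (\<Sum>i<j. 1)"
          proof (intro sum.cong refl)
            fix i assume "i \<in> {..<j}"
            then have "real i + 1 \<le> real j" by auto
            then show "(indicator {2 * real i + 1 + U i \<omega> ..} ?s :: real) = 1"
              using elim(1)[rule_format, of i] 2 by (auto simp: indicator_def)
          qed
          finally show ?case using elim by (auto simp: indicator_def)
        qed
        ultimately show ?thesis by blast
      next
        case 3
        have "AE \<omega> in M. \<omega> \<in> ?T \<longleftrightarrow> \<omega> \<in> space ?F"
          using AE_U AE_space by eventually_elim (use 3 in \<open>force dest: spec[of _ j]\<close>)
        then show ?thesis by blast
      qed
    qed
    moreover have "?T \<in> sets M" by measurable
    ultimately show "{\<omega> \<in> space ?H. U j \<omega> \<le> r} \<in> sets ?H"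
      by (simp add: sets_null_completion[OF spF])
  qed
  have m: "(\<lambda>\<omega>. trunc k (seq \<omega>)) \<in> measurable ?H unif_seq"
  proof (rule measurable_PiM_single')
    show "(\<lambda>\<omega>. trunc k (seq \<omega>) j) \<in> measurable ?H unif" for j
      using U_H[of j] by (cases "j < k") (simp_all add: trunc_def glue_def seq_def)
  qed simp
  show ?thesis
    using measurable_sets[OF m] by (auto simp: sets_past)
qed

lemma cond_exp_jump_filtration:
  assumes "integrable M f"
  shows "AE \<omega> in M. real_cond_exp M (jump_filtration M U (2 * real k)) f \<omega> = real_cond_exp M (past k) f \<omega>"
  by (rule real_cond_exp_mod_null[OF prob_space_axioms subalgebra_jump_filtration[OF measurable_U] subalgebra_past
        jump_filtration_sub_past past_sub_jump_filtration assms])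

lemma cond_exp_kern:
  assumes f: "C1_cyl n f f'" and s: "s \<in> {-1..1}"
  shows "integrable M (\<lambda>\<omega>. f' k (seq \<omega>) * kern (U k \<omega>) s)"
    and "AE \<omega> in M. real_cond_exp M (past k) (\<lambda>\<omega>. f' k (seq \<omega>) * kern (U k \<omega>) s) \<omega> = incr k f (seq \<omega>) s"
proof -
  have [measurable]: "f \<in> borel_measurable unif_seq" "f' k \<in> borel_measurable unif_seq"
    using f by (auto simp: C1_cyl_def)
  obtain B1 B2 where B: "\<And>u. \<bar>f u\<bar> \<le> B1" "\<And>u. \<bar>f' k u\<bar> \<le> B2"
    using f unfolding C1_cyl_def by metis
  interpret P: finite_measure_subalgebra M "past k" by unfold_locales (rule subalgebra_past)
  show int: "integrable M (\<lambda>\<omega>. f' k (seq \<omega>) * kern (U k \<omega>) s)"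
  proof (rule integrable_const_bound[of _ "B2 * 2"])
    show "AE \<omega> in M. norm (f' k (seq \<omega>) * kern (U k \<omega>) s) \<le> B2 * 2"
      using AE_U
    proof eventually_elim
      case (elim \<omega>)
      have "\<bar>kern (U k \<omega>) s\<bar> \<le> 2" using elim[rule_format, of k] s by (auto simp: kern_def)
      then show ?case using B(2)[of "seq \<omega>"] by (auto simp: abs_mult intro!: mult_mono)
    qed
  qed measurable
  have int': "integrable M (\<lambda>\<omega>. incr k f (seq \<omega>) s)"
    by (rule integrable_const_bound[of _ "2 * B1"]) (auto intro!: abs_incr_le B)
  show "AE \<omega> in M. real_cond_exp M (past k) (\<lambda>\<omega>. f' k (seq \<omega>) * kern (U k \<omega>) s) \<omega> = incr k f (seq \<omega>) s"
  proof (rule P.real_cond_exp_charact[OF _ int int'])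
    have "(\<lambda>\<omega>. incr k f (trunc k (seq \<omega>)) s) \<in> borel_measurable (past k)" by measurable
    then show "(\<lambda>\<omega>. incr k f (seq \<omega>) s) \<in> borel_measurable (past k)" by (simp add: incr_trunc)
    fix A assume "A \<in> sets (past k)"
    then obtain S where A: "A = (\<lambda>\<omega>. trunc k (seq \<omega>)) -` S \<inter> space M" and [measurable]: "S \<in> sets unif_seq"
      by (auto simp: sets_past)
    let ?q = "\<lambda>u. indicator S (trunc k u) :: real"
    have ind: "indicator A \<omega> = ?q (seq \<omega>)" if "\<omega> \<in> space M" for \<omega>
      using that by (auto simp: A indicator_def)
    have "(\<integral>\<omega>\<in>A. f' k (seq \<omega>) * kern (U k \<omega>) s \<partial>M)
        = (\<integral>\<omega>. (\<lambda>u. ?q u * (f' k u * kern (u k) s)) (seq \<omega>) \<partial>M)"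
      unfolding set_lebesgue_integral_def
      by (intro Bochner_Integration.integral_cong) (auto simp: ind seq_def)
    also have "\<dots> = (\<integral>u. ?q u * (f' k u * kern (u k) s) \<partial>unif_seq)"
      by (rule integral_seq) measurable
    also have "\<dots> = (\<integral>u. ?q u * incr k f u s \<partial>unif_seq)"
      by (rule integral_mult_gradient[OF f, where C=1])
        (use s in \<open>auto simp: trunc_trunc indicator_def\<close>)
    also have "\<dots> = (\<integral>\<omega>. (\<lambda>u. ?q u * incr k f u s) (seq \<omega>) \<partial>M)"
      by (rule integral_seq[symmetric]) measurable
    also have "\<dots> = (\<integral>\<omega>\<in>A. incr k f (seq \<omega>) s \<partial>M)"
      unfolding set_lebesgue_integral_def
      by (intro Bochner_Integration.integral_cong) (auto simp: ind)
    finally show "(\<integral>\<omega>\<in>A. f' k (seq \<omega>) * kern (U k \<omega>) s \<partial>M) = (\<integral>\<omega>\<in>A. incr k f (seq \<omega>) s \<partial>M)" .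
  qed
qed

end

section \<open>The gradient and its predictable projection\<close>

lemma measurable_snd_time [measurable]: "snd \<in> borel_measurable (N \<Otimes>\<^sub>M time)"
  by (rule measurable_compose[OF measurable_snd]) (simp add: measurable_restrict_space1)

lemma sigma_finite_time: "sigma_finite_measure time"
  by (intro sigma_finite_measure_restrict_space sigma_finite_lborel) simp

abbreviation slot :: "nat \<Rightarrow> real set" where
  "slot k \<equiv> {2 * real k <.. 2 * real k + 2}"

text \<open>Lebesgue measure gives a slot mass 2, against the mass 1 of \<open>unif\<close>. This is
  the 2 that the factor 1/2 in \<open>\<phi>\<close> cancels.\<close>

lemma integral_time_slot:
  fixes h :: "real \<Rightarrow> real"
  assumes [measurable]: "h \<in> borel_measurable borel"
  shows "(\<integral>t. indicator (slot k) t * h (t - 2 * real k - 1) \<partial>time) = 2 * (\<integral>s. h s \<partial>unif)"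
proof -
  have "(\<integral>t. indicator (slot k) t * h (t - 2 * real k - 1) \<partial>time)
      = (\<integral>t. indicator {0..} t * (indicator (slot k) t * h (t - 2 * real k - 1)) \<partial>lborel)"
    by (subst integral_restrict_space) auto
  also have "\<dots> = (\<integral>t. indicator (slot k) t * h (t - 2 * real k - 1) \<partial>lborel)"
    by (intro Bochner_Integration.integral_cong) (auto simp: indicator_def)
  also have "\<dots> = (\<integral>s. indicator {-1<..1} s * h s \<partial>lborel)"
    by (subst lborel_integral_real_affine[of 1 _ "2 * real k + 1"])
      (auto intro!: Bochner_Integration.integral_cong simp: indicator_def)
  also have "\<dots> = (\<integral>s. indicator {-1..1} s * h s \<partial>lborel)"
    by (intro integral_cong_AE)
      (use AE_lborel_singleton[of "-1"] in \<open>auto simp: indicator_def elim!: eventually_mono\<close>)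
  finally show ?thesis by (simp add: integral_unif)
qed

context uniform_sequence begin

sublocale MT: pair_sigma_finite M time
  by (intro pair_sigma_finite.intro sigma_finite_time sigma_finite_measure_axioms)

definition grad :: "nat \<Rightarrow> (nat \<Rightarrow> (nat \<Rightarrow> real) \<Rightarrow> real) \<Rightarrow> 'a \<Rightarrow> real \<Rightarrow> real" where
  "grad n f' \<omega> t = (\<Sum>k\<le>n. f' k (seq \<omega>) *
      ((1 - U k \<omega>) * indicator {2 * real k <.. 2 * real k + 1 + U k \<omega>} t
     - (1 + U k \<omega>) * indicator {2 * real k + 1 + U k \<omega> <.. 2 * real k + 2} t))"

text \<open>The projection of the gradient on the discrete filtration in closed form. As an explicit
  formula it is jointly measurable in \<omega> and t, bounded, and defined at every time.\<close>

definition pgrad :: "nat \<Rightarrow> ((nat \<Rightarrow> real) \<Rightarrow> real) \<Rightarrow> 'a \<Rightarrow> real \<Rightarrow> real" where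
  "pgrad n f \<omega> t = (\<Sum>k\<le>n. indicator (slot k) t * incr k f (seq \<omega>) (t - 2 * real k - 1))"

lemma measurable_grad:
  assumes "C1_cyl n f f'"
  shows "case_prod (grad n f') \<in> borel_measurable (M \<Otimes>\<^sub>M time)"
proof -
  have [measurable]: "f' k \<in> borel_measurable unif_seq" for k using assms by (auto simp: C1_cyl_def)
  show ?thesis
    unfolding grad_def case_prod_beta' indicator_def greaterThanAtMost_iff by measurable
qed

lemma measurable_pgrad:
  assumes "C1_cyl n f f'"
  shows "case_prod (pgrad n f) \<in> borel_measurable (M \<Otimes>\<^sub>M time)"
proof -
  have [measurable]: "f \<in> borel_measurable unif_seq" using assms by (auto simp: C1_cyl_def)
  show ?thesis
    unfolding pgrad_def case_prod_beta' by measurable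
qed

lemma slot_eq:
  assumes "t \<in> slot k" "t \<in> slot j"
  shows "j = k"
proof -
  have "real j < real k + 1" "real k < real j + 1" using assms by auto
  then show ?thesis by linarith
qed

lemma sum_slot:
  fixes a :: "nat \<Rightarrow> real"
  assumes "t \<in> slot k" "\<And>j. n < j \<Longrightarrow> a j = 0"
  shows "(\<Sum>j\<le>n. indicator (slot j) t * a j) = a k"
proof -
  have "(\<Sum>j\<le>n. indicator (slot j) t * a j) = (\<Sum>j\<le>n. if j = k then a k else 0)"
    using slot_eq[OF assms(1)] assms(1) by (intro sum.cong) (auto simp: indicator_def)
  also have "\<dots> = a k" using assms(2)[of k] by (auto simp: not_le)
  finally show ?thesis .
qed

lemma grad_eq:
  assumes "\<And>k. -1 < U k \<omega> \<and> U k \<omega> \<le> 1"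
  shows "grad n f' \<omega> t = (\<Sum>k\<le>n. indicator (slot k) t *
      (f' k (seq \<omega>) * kern (U k \<omega>) (t - 2 * real k - 1)))"
  unfolding grad_def
proof (intro sum.cong refl)
  fix k
  show "f' k (seq \<omega>) *
      ((1 - U k \<omega>) * indicator {2 * real k <.. 2 * real k + 1 + U k \<omega>} t
     - (1 + U k \<omega>) * indicator {2 * real k + 1 + U k \<omega> <.. 2 * real k + 2} t) =
     indicator (slot k) t *
      (f' k (seq \<omega>) * kern (U k \<omega>) (t - 2 * real k - 1))"
    using assms[of k] by (auto simp: indicator_def kern_def)
qed

lemma incr_eq_0:
  assumes "C1_cyl n f f'" "n < k"
  shows "incr k f u s = 0"
proof -
  have tr: "f (trunc j u) = f u" if "n < j" for j u
    using assms that trunc_trunc[of "Suc n" j u] unfolding C1_cyl_def by (metis Suc_leI)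
  have "f (u(k := s)) = f u"
    using assms trunc_upd[of "Suc n" k u s] unfolding C1_cyl_def by (metis Suc_leI)
  then show ?thesis
    using cexp_eq_self[of f k] cexp_eq_self[of f "Suc k"] tr assms(2) by (simp add: incr_def)
qed

lemma pgrad_slot:
  assumes "C1_cyl n f f'" "t \<in> slot k"
  shows "pgrad n f \<omega> t = incr k f (seq \<omega>) (t - 2 * real k - 1)"
  unfolding pgrad_def using assms by (subst sum_slot[of t k]) (auto simp: incr_eq_0)

lemma grad_slot:
  assumes "C1_cyl n f f'" "t \<in> slot k" "\<And>k. -1 < U k \<omega> \<and> U k \<omega> \<le> 1"
  shows "grad n f' \<omega> t = f' k (seq \<omega>) * kern (U k \<omega>) (t - 2 * real k - 1)"
  unfolding grad_eq[OF assms(3)] using assms(1,2) by (subst sum_slot[of t k]) (auto simp: C1_cyl_def)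

text \<open>The time axis has infinite measure, so boundedness has to be paired with a bounded time
  support; gradients of cylinder functions vanish after time 2n + 2.\<close>

lemma integrable_bounded_support:
  fixes h :: "'a \<Rightarrow> real \<Rightarrow> real"
  assumes [measurable]: "case_prod h \<in> borel_measurable (M \<Otimes>\<^sub>M time)"
    and b: "AE \<omega> in M. \<forall>t\<ge>0. \<bar>h \<omega> t\<bar> \<le> C * indicator {0..T} t"
  shows "integrable (M \<Otimes>\<^sub>M time) (case_prod h)"
proof (rule Bochner_Integration.integrable_bound)
  have "{0..T} \<inter> {0..} \<in> sets time" unfolding sets_restrict_space by auto
  then have T [measurable]: "{0..T} \<in> sets time" by (simp add: Int_absorb2)
  have "emeasure (M \<Otimes>\<^sub>M time) (space M \<times> {0..T}) = emeasure M (space M) * emeasure time {0..T}"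
    by (rule sigma_finite_measure.emeasure_pair_measure_Times[OF sigma_finite_time]) auto
  also have "\<dots> < \<infinity>"
    by (subst emeasure_restrict_space) (auto simp: emeasure_space_1 emeasure_lborel_Icc_eq)
  finally show "integrable (M \<Otimes>\<^sub>M time) (\<lambda>x. C * indicator (space M \<times> {0..T}) x)"
    by (intro integrable_mult_right integrable_real_indicator) auto
  show "AE x in M \<Otimes>\<^sub>M time. norm (case_prod h x) \<le> norm (C * indicator (space M \<times> {0..T}) x :: real)"
  proof (rule MT.AE_pair_measure)
    show "AE \<omega> in M. AE t in time. norm (case_prod h (\<omega>, t)) \<le> norm (C * indicator (space M \<times> {0..T}) (\<omega>, t) :: real)"
      using b AE_space
    proof eventually_elim
      case (elim \<omega>)
      show ?case
      proof (rule AE_I2)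
        fix t assume "t \<in> space time"
        then have "\<bar>h \<omega> t\<bar> \<le> C * indicator {0..T} t" using elim by auto
        also have "\<dots> \<le> \<bar>C * indicator {0..T} t\<bar>" by simp
        also have "(indicator {0..T} t :: real) = indicator (space M \<times> {0..T}) (\<omega>, t)"
          using elim by (auto simp: indicator_def)
        finally show "norm (case_prod h (\<omega>, t)) \<le> norm (C * indicator (space M \<times> {0..T}) (\<omega>, t) :: real)"
          by simp
      qed
    qed
  qed measurable
qed measurable

lemma bounds_C1_cyl:
  assumes "C1_cyl n f f'"
  obtains B where "0 \<le> B" "\<And>u. \<bar>f u\<bar> \<le> B" "\<And>k u. \<bar>f' k u\<bar> \<le> B"
proof -
  obtain b where b: "\<And>u. \<bar>f u\<bar> \<le> b" using assms unfolding C1_cyl_def by blast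
  have "\<forall>k. \<exists>B. \<forall>u. \<bar>f' k u\<bar> \<le> B" using assms unfolding C1_cyl_def by blast
  then obtain c where c: "\<And>k u. \<bar>f' k u\<bar> \<le> c k" by metis
  have c0: "0 \<le> c k" for k using c[of k undefined] by linarith
  have b0: "0 \<le> b" using b[of undefined] by linarith
  show thesis
  proof (rule that[of "b + (\<Sum>k\<le>n. c k)"])
    show "0 \<le> b + (\<Sum>k\<le>n. c k)" using b0 c0 by (simp add: sum_nonneg)
    show "\<bar>f u\<bar> \<le> b + (\<Sum>k\<le>n. c k)" for u using b[of u] c0 by (smt (verit) sum_nonneg)
    show "\<bar>f' k u\<bar> \<le> b + (\<Sum>k\<le>n. c k)" for k u
    proof (cases "k \<le> n")
      case True
      have "c k \<le> (\<Sum>k\<le>n. c k)" using True c0 by (intro member_le_sum) auto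
      then show ?thesis using c[of k u] b0 by linarith
    next
      case False
      then show ?thesis using assms b0 c0 by (auto simp: C1_cyl_def sum_nonneg)
    qed
  qed
qed

lemma slot_cases:
  assumes "0 < t"
  obtains k where "t \<in> slot k"
proof
  \<comment> \<open>Slots are open on the left and closed on the right, so the index is a ceiling
    minus 1 and not a floor.\<close>
  let ?k = "nat (\<lceil>t / 2\<rceil> - 1)"
  have "0 < \<lceil>t / 2\<rceil>" using assms by simp
  then have "real ?k = of_int \<lceil>t / 2\<rceil> - 1" by simp
  moreover have "of_int \<lceil>t / 2\<rceil> - 1 < t / 2" "t / 2 \<le> of_int \<lceil>t / 2\<rceil>"
    using ceiling_correct[of "t / 2"] by auto
  ultimately show "t \<in> slot ?k"
    unfolding greaterThanAtMost_iff by linarith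
qed

lemma abs_pgrad_le:
  assumes f: "C1_cyl n f f'" and B: "\<And>u. \<bar>f u\<bar> \<le> B" and t: "0 \<le> t"
  shows "\<bar>pgrad n f \<omega> t\<bar> \<le> 2 * B * indicator {0..2 * real n + 2} t"
proof (cases "t = 0")
  case True
  have "0 \<le> B" using B[of undefined] by linarith
  then show ?thesis using True by (simp add: pgrad_def)
next
  case False
  then obtain k where k: "t \<in> slot k" using slot_cases[of t] t by auto
  have "f \<in> borel_measurable unif_seq" using f by (auto simp: C1_cyl_def)
  from abs_incr_le[OF this B] have "\<bar>pgrad n f \<omega> t\<bar> \<le> 2 * B" by (simp add: pgrad_slot[OF f k])
  moreover have "pgrad n f \<omega> t = 0" if "t \<notin> {0..2 * real n + 2}"
  proof -
    have "n < k" using k that t by auto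
    then show ?thesis by (simp add: pgrad_slot[OF f k] incr_eq_0[OF f])
  qed
  ultimately show ?thesis by (auto simp: indicator_def)
qed

lemma abs_grad_le:
  assumes f: "C1_cyl n f f'" and B: "\<And>k u. \<bar>f' k u\<bar> \<le> B" and t: "0 \<le> t"
    and U: "\<And>k. -1 < U k \<omega> \<and> U k \<omega> \<le> 1"
  shows "\<bar>grad n f' \<omega> t\<bar> \<le> 2 * B * indicator {0..2 * real n + 2} t"
proof (cases "t = 0")
  case True
  have "0 \<le> B" using B[of undefined undefined] by linarith
  then show ?thesis using True by (simp add: grad_eq[OF U])
next
  case False
  then obtain k where k: "t \<in> slot k" using slot_cases[of t] t by auto
  have "\<bar>kern (U k \<omega>) (t - 2 * real k - 1)\<bar> \<le> 2" using U[of k] k by (auto simp: kern_def)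
  then have "\<bar>grad n f' \<omega> t\<bar> \<le> B * 2"
    unfolding grad_slot[OF f k U] abs_mult using B[of k "seq \<omega>"] by (intro mult_mono) auto
  moreover have "grad n f' \<omega> t = 0" if "t \<notin> {0..2 * real n + 2}"
  proof -
    have "n < k" using k that t by auto
    then show ?thesis using f by (simp add: grad_slot[OF f k U] C1_cyl_def)
  qed
  ultimately show ?thesis by (auto simp: indicator_def)
qed

lemma integrable_grad_L2:
  assumes f: "C1_cyl n f f'"
  shows "integrable (M \<Otimes>\<^sub>M time) (\<lambda>(\<omega>, t). (grad n f' \<omega> t)\<^sup>2)"
    and "integrable (M \<Otimes>\<^sub>M time) (\<lambda>(\<omega>, t). (pgrad n f \<omega> t)\<^sup>2)"
    and "t \<ge> 0 \<Longrightarrow> integrable M (\<lambda>\<omega>. grad n f' \<omega> t)"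
proof -
  obtain B where B: "0 \<le> B" "\<And>u. \<bar>f u\<bar> \<le> B" "\<And>k u. \<bar>f' k u\<bar> \<le> B" using bounds_C1_cyl[OF f] by metis
  note [measurable] = measurable_grad[OF f] measurable_pgrad[OF f]
  have sq: "\<bar>a\<^sup>2\<bar> \<le> (2 * B)\<^sup>2 * indicator S t" if "\<bar>a\<bar> \<le> 2 * B * indicator S t" for a t :: real and S
    using that power_mono[of "\<bar>a\<bar>" "2 * B" 2] by (auto simp: indicator_def split: if_splits)
  show "integrable (M \<Otimes>\<^sub>M time) (\<lambda>(\<omega>, t). (grad n f' \<omega> t)\<^sup>2)"
  proof (rule integrable_bounded_support)
    show "AE \<omega> in M. \<forall>t\<ge>0. \<bar>(grad n f' \<omega> t)\<^sup>2\<bar> \<le> (2 * B)\<^sup>2 * indicator {0..2 * real n + 2} t"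
      using AE_U by eventually_elim (intro allI impI sq abs_grad_le[OF f]; simp add: B)
  qed measurable
  show "integrable (M \<Otimes>\<^sub>M time) (\<lambda>(\<omega>, t). (pgrad n f \<omega> t)\<^sup>2)"
  proof (rule integrable_bounded_support)
    show "AE \<omega> in M. \<forall>t\<ge>0. \<bar>(pgrad n f \<omega> t)\<^sup>2\<bar> \<le> (2 * B)\<^sup>2 * indicator {0..2 * real n + 2} t"
      by (intro AE_I2 allI impI sq abs_pgrad_le[OF f]) (simp_all add: B)
  qed measurable
  assume t: "t \<ge> 0"
  then have t': "t \<in> space time" by simp
  show "integrable M (\<lambda>\<omega>. grad n f' \<omega> t)"
  proof (rule integrable_const_bound[of _ "2 * B"])
    show "AE \<omega> in M. norm (grad n f' \<omega> t) \<le> 2 * B"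
      using AE_U
    proof eventually_elim
      case (elim \<omega>)
      have "\<bar>grad n f' \<omega> t\<bar> \<le> 2 * B * indicator {0..2 * real n + 2} t"
        by (rule abs_grad_le[OF f]) (use B t elim in auto)
      also have "\<dots> \<le> 2 * B" using B(1) by (auto simp: indicator_def)
      finally show ?case by simp
    qed
    show "(\<lambda>\<omega>. grad n f' \<omega> t) \<in> borel_measurable M"
      using measurable_compose[OF measurable_Pair2'[OF t'] measurable_grad[OF f]] by simp
  qed
qed

text \<open>The slots (2k, 2k + 2] of the gradient and the intervals [2k, 2k + 2) on which the
  discrete filtration is constant disagree at even times. Those are excluded, which costs a null set
  of times.\<close>

lemma cond_exp_grad:
  assumes f: "C1_cyl n f f'" and t: "0 < t" "t / 2 \<notin> \<int>"
  shows "AE \<omega> in M. real_cond_exp M (discrete_filtration M U t) (\<lambda>\<omega>. grad n f' \<omega> t) \<omega> = pgrad n f \<omega> t"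
proof -
  obtain k where k: "t \<in> slot k" using slot_cases[OF t(1)] .
  have "t / 2 \<noteq> real (Suc k)" using t(2) by (metis Ints_of_nat)
  then have fl: "\<lfloor>t / 2\<rfloor> = int k" using k by (intro floor_unique) (auto simp: field_simps)
  let ?s = "t - 2 * real k - 1"
  have s: "?s \<in> {-1..1}" using k by auto
  let ?W = "\<lambda>\<omega>. f' k (seq \<omega>) * kern (U k \<omega>) ?s"
  have W: "integrable M ?W" by (rule cond_exp_kern(1)[OF f s])
  have g: "integrable M (\<lambda>\<omega>. grad n f' \<omega> t)" using t by (intro integrable_grad_L2[OF f]) simp
  have sub: "subalgebra M (jump_filtration M U (2 * real k))"
    by (rule subalgebra_jump_filtration) simp
  interpret F: finite_measure_subalgebra M "jump_filtration M U (2 * real k)" by unfold_locales (rule sub)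
  have "AE \<omega> in M. grad n f' \<omega> t = ?W \<omega>"
    using AE_U by eventually_elim (intro grad_slot[OF f k]; simp)
  then have "AE \<omega> in M. real_cond_exp M (jump_filtration M U (2 * real k)) (\<lambda>\<omega>. grad n f' \<omega> t) \<omega>
      = real_cond_exp M (jump_filtration M U (2 * real k)) ?W \<omega>"
    by (rule F.real_cond_exp_cong) (use g W in auto)
  with cond_exp_jump_filtration[OF W, of k] cond_exp_kern(2)[OF f s, of k] show ?thesis
    unfolding discrete_filtration_def fl
    by eventually_elim (simp add: pgrad_slot[OF f k])
qed

lemma AE_time: "AE t in time. 0 < t \<and> t / 2 \<notin> \<int>"
proof -
  have "AE t :: real in lborel. t / 2 \<noteq> of_int i" for i :: int
    using AE_lborel_singleton[of "2 * of_int i :: real"] by (auto elim!: eventually_mono)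
  then have "AE t :: real in lborel. \<forall>i::int. t / 2 \<noteq> of_int i" by (simp add: AE_all_countable)
  then have "AE t :: real in lborel. t \<in> {0..} \<longrightarrow> 0 < t \<and> t / 2 \<notin> \<int>"
  proof eventually_elim
    case (elim t)
    then show ?case using elim[rule_format, of 0] by (auto elim!: Ints_cases)
  qed
  then show ?thesis by (subst AE_restrict_space_iff) auto
qed

end

section \<open>From the closed cube to all real sequences\<close>

definition clip :: "nat \<Rightarrow> (nat \<Rightarrow> real) \<Rightarrow> nat \<Rightarrow> real" where
  "clip n u = (\<lambda>k\<in>{..n}. max (-1) (min 1 (u k)))"

lemma clip_in_cube: "clip n u \<in> cube n"
  by (auto simp: clip_def cube_def)

lemma clip_eq:
  assumes "\<And>k. k \<le> n \<Longrightarrow> u k \<in> {-1..1}"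
  shows "clip n u = (\<lambda>k\<in>{..n}. u k)"
  using assms by (auto simp: clip_def fun_eq_iff)

lemma clip_upd:
  assumes "s \<in> {-1..1}" "k \<le> n"
  shows "clip n (u(k := s)) = (clip n u)(k := s)"
  using assms by (auto simp: clip_def fun_eq_iff)

lemma continuous_clip: "continuous_on UNIV (clip n)"
proof (rule continuous_on_coordinatewise_then_product)
  show "continuous_on UNIV (\<lambda>u. clip n u k)" for k
  proof (cases "k \<le> n")
    case True
    then show ?thesis
      by (simp add: clip_def)
        (intro continuous_intros continuous_on_product_coordinates)
  qed (simp add: clip_def)
qed

lemma measurable_comp_clip:
  assumes "continuous_on (cube n) f"
  shows "(\<lambda>u. f (clip n u) :: real) \<in> borel_measurable unif_seq"
proof -
  have "continuous_on UNIV (\<lambda>u. f (clip n u))"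
    by (rule continuous_on_compose2[OF assms continuous_clip]) (auto intro: clip_in_cube)
  then have "(\<lambda>u. f (clip n u)) \<in> borel_measurable borel"
    by (rule borel_measurable_continuous_onI)
  then show ?thesis by (subst measurable_cong_sets[OF sets_unif_seq_borel refl])
qed

lemma C1_cyl_clip:
  assumes "C1b_cube n f f'"
  shows "C1_cyl n (\<lambda>u. f (clip n u)) (\<lambda>k u. if k \<le> n then f' k (clip n u) else 0)"
proof -
  have bd: "\<exists>B. \<forall>u. \<bar>g (clip n u)\<bar> \<le> B" if "bounded (g ` cube n)" for g :: "(nat \<Rightarrow> real) \<Rightarrow> real"
    using that clip_in_cube[of n] unfolding bounded_iff by (metis imageI real_norm_def)
  have deriv: "((\<lambda>s. f (clip n (u(k := s)))) has_real_derivative f' k (clip n (u(k := s))))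
      (at s within {-1..1})" if "k \<le> n" "s \<in> {-1..1}" for k s u
  \<comment> \<open>Clipping commutes with the update for s in [-1, 1] only, which is enough for a
    derivative within that interval; the radius 1 is arbitrary.\<close>
  proof (rule has_field_derivative_transform_within[of _ _ _ _ 1])
    have "((\<lambda>r. f ((clip n (u(k := s)))(k := r))) has_real_derivative f' k (clip n (u(k := s))))
        (at ((clip n (u(k := s))) k) within {-1..1})"
      using assms that(1) clip_in_cube unfolding C1b_cube_def by blast
    then show "((\<lambda>r. f ((clip n u)(k := r))) has_real_derivative f' k (clip n (u(k := s))))
        (at s within {-1..1})"
      by (simp add: clip_upd[OF that(2,1)])
  qed (use that in \<open>auto simp: clip_upd\<close>)
  have const: "((\<lambda>s. f (clip n (u(k := s)))) has_real_derivative 0) (at s within {-1..1})"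
    if "\<not> k \<le> n" for k s u
  proof -
    have "clip n (u(k := s)) = clip n u" for s using that by (auto simp: clip_def fun_eq_iff)
    then show ?thesis by simp
  qed
  have tr: "clip n (trunc (Suc n) u) = clip n u" for u
    by (auto simp: clip_def trunc_def glue_def fun_eq_iff)
  have f': "(\<lambda>u. if k \<le> n then f' k (clip n u) else 0) \<in> borel_measurable unif_seq"
      "\<exists>B. \<forall>u. \<bar>if k \<le> n then f' k (clip n u) else 0\<bar> \<le> B" for k
    using assms by (cases "k \<le> n"; auto simp: C1b_cube_def intro!: measurable_comp_clip bd)+
  show ?thesis
    unfolding C1_cyl_def
    using assms f' by (auto simp: C1b_cube_def tr deriv const intro!: measurable_comp_clip bd)
qed

section \<open>The covariance formula and its extension to the domain of the gradient\<close>

context uniform_sequence begin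

lemma integrable_C1_cyl_L2:
  assumes "C1_cyl n f f'"
  shows "integrable M (\<lambda>\<omega>. (f (seq \<omega>))\<^sup>2)"
proof -
  have [measurable]: "f \<in> borel_measurable unif_seq" using assms by (auto simp: C1_cyl_def)
  obtain B where "\<And>u. \<bar>f u\<bar> \<le> B" using bounds_C1_cyl[OF assms] by metis
  then show ?thesis
    by (intro integrable_const_bound[of _ "B\<^sup>2"])
      (auto simp: abs_le_square_iff[symmetric] intro: order_trans[OF _ abs_ge_self])
qed

lemma simple_gradientE:
  assumes "simple_gradient M U X Z"
  obtains n f f' where "C1_cyl n f f'" "AE \<omega> in M. X \<omega> = f (seq \<omega>)"
    "AE x in M \<Otimes>\<^sub>M time. case_prod Z x = case_prod (grad n f') x"
    "X \<in> borel_measurable M" "case_prod Z \<in> borel_measurable (M \<Otimes>\<^sub>M time)"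
    "integrable M (\<lambda>\<omega>. (X \<omega>)\<^sup>2)" "integrable (M \<Otimes>\<^sub>M time) (\<lambda>x. (case_prod Z x)\<^sup>2)"
proof -
  obtain n f f' where f: "C1b_cube n f f'" and
    X: "AE \<omega> in M. X \<omega> = f (\<lambda>k\<in>{..n}. U k \<omega>)" and
    Z: "AE (\<omega>, t) in M \<Otimes>\<^sub>M time. Z \<omega> t =
         (\<Sum>k\<le>n. f' k (\<lambda>j\<in>{..n}. U j \<omega>) *
           ((1 - U k \<omega>) * indicator {2 * real k <.. 2 * real k + 1 + U k \<omega>} t
          - (1 + U k \<omega>) * indicator {2 * real k + 1 + U k \<omega> <.. 2 * real k + 2} t))"
    and m [measurable]: "X \<in> borel_measurable M" "case_prod Z \<in> borel_measurable (M \<Otimes>\<^sub>M time)"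
    using assms unfolding simple_gradient_def by blast
  let ?f = "\<lambda>u. f (clip n u)" and ?f' = "\<lambda>k u. if k \<le> n then f' k (clip n u) else 0"
  note C = C1_cyl_clip[OF f]
  note [measurable] = measurable_grad[OF C]
  have [measurable]: "?f \<in> borel_measurable unif_seq" using C by (auto simp: C1_cyl_def)
  \<comment> \<open>The variables lie in the cube almost surely, so clipping changes the functional
    and its gradient on a null set only.\<close>
  have cl: "AE \<omega> in M. clip n (seq \<omega>) = (\<lambda>k\<in>{..n}. U k \<omega>)"
    using AE_U by eventually_elim (subst clip_eq; auto simp: seq_def less_imp_le)
  have ZG: "AE x in M \<Otimes>\<^sub>M time. case_prod Z x = case_prod (grad n ?f') x"
  proof (rule MT.AE_pair_measure)
    show "AE \<omega> in M. AE t in time. case_prod Z (\<omega>, t) = case_prod (grad n ?f') (\<omega>, t)"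
      using MT.AE_pair[OF Z] cl
    proof eventually_elim
      case (elim \<omega>)
      from elim(1) show ?case
        by eventually_elim (auto simp: grad_def elim(2) intro!: sum.cong)
    qed
  qed measurable
  have XF: "AE \<omega> in M. X \<omega> = ?f (seq \<omega>)" using X cl by eventually_elim simp
  have "integrable M (\<lambda>\<omega>. (X \<omega>)\<^sup>2)"
    by (rule integrable_cong_AE_imp[OF integrable_C1_cyl_L2[OF C]]) (use XF in auto)
  moreover have "integrable (M \<Otimes>\<^sub>M time) (\<lambda>x. (case_prod Z x)\<^sup>2)"
    by (rule integrable_cong_AE_imp[OF integrable_grad_L2(1)[OF C]])
      (use ZG in \<open>auto simp: case_prod_beta'\<close>)
  ultimately show thesis using C XF ZG m that by blast
qed

lemma integral_pgrad_grad:
  assumes f: "C1_cyl n f f'" and g: "C1_cyl m g g'"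
  shows "(\<integral>x. case_prod (pgrad n f) x * case_prod (grad m g') x \<partial>(M \<Otimes>\<^sub>M time))
    = 2 * ((\<integral>\<omega>. f (seq \<omega>) * g (seq \<omega>) \<partial>M) - (\<integral>\<omega>. f (seq \<omega>) \<partial>M) * (\<integral>\<omega>. g (seq \<omega>) \<partial>M))"
proof -
  note [measurable] = measurable_pgrad[OF f] measurable_grad[OF g]
  have [measurable]: "f \<in> borel_measurable unif_seq" "g \<in> borel_measurable unif_seq"
    "g' k \<in> borel_measurable unif_seq" for k
    using f g by (auto simp: C1_cyl_def)
  obtain B1 where B1: "0 \<le> B1" "\<And>u. \<bar>f u\<bar> \<le> B1" using bounds_C1_cyl[OF f] by metis
  obtain B2 where B2: "0 \<le> B2" "\<And>k u. \<bar>g' k u\<bar> \<le> B2" using bounds_C1_cyl[OF g] by metis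
  \<comment> \<open>Large enough for both functionals: at level \<open>Suc N\<close> conditioning
    leaves \<open>f\<close> and \<open>g\<close> unchanged, which identifies the last term of the
    telescoping sum.\<close>
  define N where "N = max n m"
  define \<psi> where "\<psi> k \<omega> t = indicator (slot k) t *
      (incr k f (seq \<omega>) (t - 2 * real k - 1) * (g' k (seq \<omega>) * kern (U k \<omega>) (t - 2 * real k - 1)))"
    for k \<omega> t
  have m\<psi> [measurable]: "case_prod (\<psi> k) \<in> borel_measurable (M \<Otimes>\<^sub>M time)" for k
    unfolding \<psi>_def case_prod_beta' by measurable
  have i\<psi>: "integrable (M \<Otimes>\<^sub>M time) (case_prod (\<psi> k))" for k
  proof (rule integrable_bounded_support[OF m\<psi>])
    show "AE \<omega> in M. \<forall>t\<ge>0. \<bar>\<psi> k \<omega> t\<bar> \<le> ((2 * B1) * (B2 * 2)) * indicator {0..2 * real k + 2} t"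
      using AE_U
    proof eventually_elim
      case (elim \<omega>)
      have "\<bar>kern (U k \<omega>) (t - 2 * real k - 1)\<bar> \<le> 2" if "t \<in> slot k" for t
        using elim[rule_format, of k] that by (auto simp: kern_def)
      then have "\<bar>incr k f (seq \<omega>) (t - 2 * real k - 1) * (g' k (seq \<omega>) * kern (U k \<omega>) (t - 2 * real k - 1))\<bar>
          \<le> (2 * B1) * (B2 * 2)" if "t \<in> slot k" for t
        unfolding abs_mult using that B2 B1 by (intro mult_mono abs_incr_le) auto
      then show ?case using B1(1) B2(1) by (auto simp: \<psi>_def indicator_def)
    qed
  qed
  have "AE x in M \<Otimes>\<^sub>M time. case_prod (pgrad n f) x * case_prod (grad m g') x = (\<Sum>k\<le>N. case_prod (\<psi> k) x)"
  proof (rule MT.AE_pair_measure)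
    show "AE \<omega> in M. AE t in time. case_prod (pgrad n f) (\<omega>, t) * case_prod (grad m g') (\<omega>, t)
        = (\<Sum>k\<le>N. case_prod (\<psi> k) (\<omega>, t))"
      using AE_U
    proof eventually_elim
      case (elim \<omega>)
      show ?case
        using AE_time
      proof eventually_elim
        case (elim t)
        then obtain k where k: "t \<in> slot k" using slot_cases[of t] by auto
        have "(\<Sum>k\<le>N. \<psi> k \<omega> t) = incr k f (seq \<omega>) (t - 2 * real k - 1) * (g' k (seq \<omega>) * kern (U k \<omega>) (t - 2 * real k - 1))"
          unfolding \<psi>_def by (subst sum_slot[OF k]) (auto simp: N_def incr_eq_0[OF f])
        then show ?case
          using \<open>\<forall>k. -1 < U k \<omega> \<and> U k \<omega> \<le> 1\<close> by (simp add: pgrad_slot[OF f k] grad_slot[OF g k])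
      qed
    qed
  qed measurable
  then have "(\<integral>x. case_prod (pgrad n f) x * case_prod (grad m g') x \<partial>(M \<Otimes>\<^sub>M time))
      = (\<integral>x. (\<Sum>k\<le>N. case_prod (\<psi> k) x) \<partial>(M \<Otimes>\<^sub>M time))"
    by (intro integral_cong_AE) auto
  also have "\<dots> = (\<Sum>k\<le>N. \<integral>x. case_prod (\<psi> k) x \<partial>(M \<Otimes>\<^sub>M time))"
    by (intro Bochner_Integration.integral_sum i\<psi>)
  also have "\<dots> = (\<Sum>k\<le>N. 2 * ((\<integral>u. cexp (Suc k) f u * cexp (Suc k) g u \<partial>unif_seq) - (\<integral>u. cexp k f u * cexp k g u \<partial>unif_seq)))"
  proof (intro sum.cong refl)
    fix k
    let ?H = "\<lambda>s. \<integral>u. incr k f u s * (g' k u * kern (u k) s) \<partial>unif_seq"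
    have "(\<integral>x. case_prod (\<psi> k) x \<partial>(M \<Otimes>\<^sub>M time)) = (\<integral>t. \<integral>\<omega>. \<psi> k \<omega> t \<partial>M \<partial>time)"
      by (rule MT.integral_snd[OF i\<psi>, symmetric])
    also have "\<dots> = (\<integral>t. indicator (slot k) t * ?H (t - 2 * real k - 1) \<partial>time)"
    proof (intro Bochner_Integration.integral_cong refl)
      fix t
      have "(\<integral>\<omega>. (\<lambda>u. incr k f u (t - 2 * real k - 1) * (g' k u * kern (u k) (t - 2 * real k - 1))) (seq \<omega>) \<partial>M)
        = ?H (t - 2 * real k - 1)"
        by (rule integral_seq) measurable
      then show "(\<integral>\<omega>. \<psi> k \<omega> t \<partial>M) = indicator (slot k) t * ?H (t - 2 * real k - 1)"
        by (simp add: \<psi>_def seq_def)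
    qed
    also have "\<dots> = 2 * (\<integral>s. ?H s \<partial>unif)"
      by (rule integral_time_slot) measurable
    finally show "(\<integral>x. case_prod (\<psi> k) x \<partial>(M \<Otimes>\<^sub>M time)) = 2 * ((\<integral>u. cexp (Suc k) f u * cexp (Suc k) g u \<partial>unif_seq) - (\<integral>u. cexp k f u * cexp k g u \<partial>unif_seq))"
      using integral_incr_gradient[OF f g] by simp
  qed
  also have "\<dots> = 2 * (\<Sum>k<Suc N. (\<integral>u. cexp (Suc k) f u * cexp (Suc k) g u \<partial>unif_seq) - (\<integral>u. cexp k f u * cexp k g u \<partial>unif_seq))"
    by (simp only: sum_distrib_left lessThan_Suc_atMost)
  also have "\<dots> = 2 * ((\<integral>u. cexp (Suc N) f u * cexp (Suc N) g u \<partial>unif_seq) - (\<integral>u. cexp 0 f u * cexp 0 g u \<partial>unif_seq))"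
    using sum_lessThan_telescope[of "\<lambda>k. \<integral>u. cexp k f u * cexp k g u \<partial>unif_seq" "Suc N"] by simp
  also have "cexp (Suc N) f = f"
  proof (intro ext cexp_eq_self)
    fix u show "f (trunc (Suc N) u) = f u"
      using f trunc_trunc[of "Suc n" "Suc N" u] unfolding C1_cyl_def N_def by (metis Suc_le_mono max.cobounded1)
  qed
  also have "cexp (Suc N) g = g"
  proof (intro ext cexp_eq_self)
    fix u show "g (trunc (Suc N) u) = g u"
      using g trunc_trunc[of "Suc m" "Suc N" u] unfolding C1_cyl_def N_def by (metis Suc_le_mono max.cobounded2)
  qed
  \<comment> \<open>At level 0 every coordinate is averaged out, which produces the product of the
    means.\<close>
  also have "(\<integral>u. cexp 0 f u * cexp 0 g u \<partial>unif_seq) = (\<integral>u. f u \<partial>unif_seq) * (\<integral>u. g u \<partial>unif_seq)"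
    using unif_prod.P.prob_space by (simp add: cexp_0)
  finally show ?thesis by (simp add: integral_seq integral_seq[of "\<lambda>u. f u * g u"])
qed

text \<open>For fixed cylindrical \<open>f\<close> both sides are continuous in the pair of
  \<open>X\<close> and its gradient with respect to the L2 norms, so the identity passes to the
  closure in that argument. \<open>f\<close> stays cylindrical because \<open>pgrad\<close> is a
  formula for such functions.\<close>

lemma integral_pgrad_gradient:
  assumes f: "C1_cyl n f f'" and X: "is_gradient M U X Z"
  shows "(\<integral>x. case_prod (pgrad n f) x * case_prod Z x \<partial>(M \<Otimes>\<^sub>M time))
    = 2 * ((\<integral>\<omega>. f (seq \<omega>) * X \<omega> \<partial>M) - (\<integral>\<omega>. f (seq \<omega>) \<partial>M) * (\<integral>\<omega>. X \<omega> \<partial>M))"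
proof -
  obtain Xs Zs where s: "\<And>m. simple_gradient M U (Xs m) (Zs m)"
    and limX: "(\<lambda>m::nat. \<integral>\<omega>. (Xs m \<omega> - X \<omega>)\<^sup>2 \<partial>M) \<longlonglongrightarrow> 0"
    and limZ: "(\<lambda>m. \<integral>(\<omega>, t). (Zs m \<omega> t - Z \<omega> t)\<^sup>2 \<partial>(M \<Otimes>\<^sub>M time)) \<longlonglongrightarrow> 0"
    and m [measurable]: "X \<in> borel_measurable M" "case_prod Z \<in> borel_measurable (M \<Otimes>\<^sub>M time)"
    and i: "integrable M (\<lambda>\<omega>. (X \<omega>)\<^sup>2)" "integrable (M \<Otimes>\<^sub>M time) (\<lambda>(\<omega>, t). (Z \<omega> t)\<^sup>2)"
    using X unfolding is_gradient_def by blast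
  have [measurable]: "f \<in> borel_measurable unif_seq" using f by (auto simp: C1_cyl_def)
  note [measurable] = measurable_pgrad[OF f]
  have ms [measurable]: "Xs k \<in> borel_measurable M" "case_prod (Zs k) \<in> borel_measurable (M \<Otimes>\<^sub>M time)" for k
    using s[of k] by (auto simp: simple_gradient_def)
  note if2 = integrable_C1_cyl_L2[OF f]
  have step: "(\<integral>x. case_prod (pgrad n f) x * case_prod (Zs k) x \<partial>(M \<Otimes>\<^sub>M time))
      = 2 * ((\<integral>\<omega>. f (seq \<omega>) * Xs k \<omega> \<partial>M) - (\<integral>\<omega>. f (seq \<omega>) \<partial>M) * (\<integral>\<omega>. Xs k \<omega> \<partial>M))
      \<and> integrable M (\<lambda>\<omega>. (Xs k \<omega>)\<^sup>2) \<and> integrable (M \<Otimes>\<^sub>M time) (\<lambda>x. (case_prod (Zs k) x)\<^sup>2)" for k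
  proof -
    obtain m g g' where g: "C1_cyl m g g'" and X: "AE \<omega> in M. Xs k \<omega> = g (seq \<omega>)"
      and Z: "AE x in M \<Otimes>\<^sub>M time. case_prod (Zs k) x = case_prod (grad m g') x"
      and L2: "integrable M (\<lambda>\<omega>. (Xs k \<omega>)\<^sup>2)" "integrable (M \<Otimes>\<^sub>M time) (\<lambda>x. (case_prod (Zs k) x)\<^sup>2)"
      using simple_gradientE[OF s[of k]] .
    have [measurable]: "g \<in> borel_measurable unif_seq" using g by (auto simp: C1_cyl_def)
    note [measurable] = measurable_grad[OF g]
    have "(\<integral>x. case_prod (pgrad n f) x * case_prod (Zs k) x \<partial>(M \<Otimes>\<^sub>M time))
        = (\<integral>x. case_prod (pgrad n f) x * case_prod (grad m g') x \<partial>(M \<Otimes>\<^sub>M time))"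
      by (intro integral_cong_AE) (use Z in auto)
    moreover have "(\<integral>\<omega>. f (seq \<omega>) * Xs k \<omega> \<partial>M) = (\<integral>\<omega>. f (seq \<omega>) * g (seq \<omega>) \<partial>M)"
      by (intro integral_cong_AE) (use X in auto)
    moreover have "(\<integral>\<omega>. Xs k \<omega> \<partial>M) = (\<integral>\<omega>. g (seq \<omega>) \<partial>M)"
      by (intro integral_cong_AE) (use X in auto)
    ultimately show ?thesis using integral_pgrad_grad[OF f g] L2 by simp
  qed
  note step1 = step[THEN conjunct1] and step2 = step[THEN conjunct2, THEN conjunct1]
    and step3 = step[THEN conjunct2, THEN conjunct2]
  have 1: "(\<lambda>k. \<integral>x. case_prod (pgrad n f) x * case_prod (Zs k) x \<partial>(M \<Otimes>\<^sub>M time))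
      \<longlonglongrightarrow> (\<integral>x. case_prod (pgrad n f) x * case_prod Z x \<partial>(M \<Otimes>\<^sub>M time))"
    by (rule tendsto_integral_mult_L2)
      (use step3 limZ i(2) integrable_grad_L2(2)[OF f] in \<open>simp_all add: case_prod_beta'\<close>)
  have 2: "(\<lambda>k. \<integral>\<omega>. f (seq \<omega>) * Xs k \<omega> \<partial>M) \<longlonglongrightarrow> (\<integral>\<omega>. f (seq \<omega>) * X \<omega> \<partial>M)"
    by (rule tendsto_integral_mult_L2) (use step2 limX i(1) if2 in simp_all)
  \<comment> \<open>The constant 1 is square integrable on a probability space, so it may serve as
    the weight that yields convergence of the means.\<close>
  have 3: "(\<lambda>k. \<integral>\<omega>. 1 * Xs k \<omega> \<partial>M) \<longlonglongrightarrow> (\<integral>\<omega>. 1 * X \<omega> \<partial>M)"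
    by (rule tendsto_integral_mult_L2) (use step2 limX i(1) in simp_all)
  have "(\<lambda>k. 2 * ((\<integral>\<omega>. f (seq \<omega>) * Xs k \<omega> \<partial>M) - (\<integral>\<omega>. f (seq \<omega>) \<partial>M) * (\<integral>\<omega>. Xs k \<omega> \<partial>M)))
      \<longlonglongrightarrow> 2 * ((\<integral>\<omega>. f (seq \<omega>) * X \<omega> \<partial>M) - (\<integral>\<omega>. f (seq \<omega>) \<partial>M) * (\<integral>\<omega>. X \<omega> \<partial>M))"
    using 3 by (intro tendsto_mult tendsto_diff tendsto_const 2) simp
  moreover have "(\<lambda>k. 2 * ((\<integral>\<omega>. f (seq \<omega>) * Xs k \<omega> \<partial>M) - (\<integral>\<omega>. f (seq \<omega>) \<partial>M) * (\<integral>\<omega>. Xs k \<omega> \<partial>M)))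
      \<longlonglongrightarrow> (\<integral>x. case_prod (pgrad n f) x * case_prod Z x \<partial>(M \<Otimes>\<^sub>M time))"
    using 1 by (simp only: step1)
  ultimately show ?thesis using LIMSEQ_unique by blast
qed

text \<open>At almost every time, conditional expectation is a contraction of L2, by Jensen, and
  self-adjoint. Integrated over time, the first fact makes \<open>P\<close> square integrable; the
  second moves the projection from \<open>Z\<close> to the gradient of a cylinder function, where it
  is the explicit \<open>pgrad\<close>.\<close>

lemma predictable_L2:
  assumes P: "is_predictable_gradient M U Z P"
    and [measurable]: "case_prod Z \<in> borel_measurable (M \<Otimes>\<^sub>M time)"
    and Z: "integrable (M \<Otimes>\<^sub>M time) (\<lambda>(\<omega>, t). (Z \<omega> t)\<^sup>2)"
  shows "integrable (M \<Otimes>\<^sub>M time) (\<lambda>(\<omega>, t). (P \<omega> t)\<^sup>2)"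
    and "AE t in time. integrable M (\<lambda>\<omega>. (Z \<omega> t)\<^sup>2)"
    and "C1_cyl n f f' \<Longrightarrow> (\<integral>x. case_prod (grad n f') x * case_prod P x \<partial>(M \<Otimes>\<^sub>M time))
      = (\<integral>x. case_prod (pgrad n f) x * case_prod Z x \<partial>(M \<Otimes>\<^sub>M time))"
proof -
  have [measurable]: "case_prod P \<in> borel_measurable (M \<Otimes>\<^sub>M time)"
    and Peq: "AE t in time. AE \<omega> in M. P \<omega> t = real_cond_exp M (discrete_filtration M U t) (\<lambda>\<omega>. Z \<omega> t) \<omega>"
    using P by (auto simp: is_predictable_gradient_def)
  have sec: "(\<lambda>\<omega>. h \<omega> t) \<in> borel_measurable M"
    if "t \<in> space time" "case_prod h \<in> borel_measurable (M \<Otimes>\<^sub>M time)" for h :: "'a \<Rightarrow> real \<Rightarrow> real" and t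
    using measurable_compose[OF measurable_Pair2'[OF that(1)] that(2)] by simp
  have sub: "subalgebra M (discrete_filtration M U t)" for t
    unfolding discrete_filtration_def by (rule subalgebra_jump_filtration) simp
  show Zt: "AE t in time. integrable M (\<lambda>\<omega>. (Z \<omega> t)\<^sup>2)"
    using MT.AE_integrable_snd[of "\<lambda>\<omega> t. (Z \<omega> t)\<^sup>2"] Z by simp
  have le: "AE t in time. (\<integral>\<^sup>+\<omega>. ennreal ((P \<omega> t)\<^sup>2) \<partial>M) \<le> (\<integral>\<^sup>+\<omega>. ennreal ((Z \<omega> t)\<^sup>2) \<partial>M)"
    using Zt Peq AE_space
  proof eventually_elim
    case (elim t)
    interpret F: finite_measure_subalgebra M "discrete_filtration M U t" by unfold_locales (rule sub)
    note [measurable] = sec[OF elim(3), of Z] sec[OF elim(3), of P]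
    let ?C = "real_cond_exp M (discrete_filtration M U t) (\<lambda>\<omega>. Z \<omega> t)"
    have Zi: "integrable M (\<lambda>\<omega>. Z \<omega> t)"
      using integrable_mult_L2[of "\<lambda>_. 1" M "\<lambda>\<omega>. Z \<omega> t"] elim(1) by simp
    have "AE \<omega> in M. (?C \<omega>)\<^sup>2 \<le> real_cond_exp M (discrete_filtration M U t) (\<lambda>\<omega>. (Z \<omega> t)\<^sup>2) \<omega>"
      by (rule F.real_cond_exp_jensens_inequality(2)[OF Zi, of UNIV])
        (use elim(1) convex_power2 in auto)
    with elim(2) have "AE \<omega> in M. ennreal ((P \<omega> t)\<^sup>2)
        \<le> ennreal (real_cond_exp M (discrete_filtration M U t) (\<lambda>\<omega>. (Z \<omega> t)\<^sup>2) \<omega>)"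
      by eventually_elim (simp add: ennreal_leI)
    then have "(\<integral>\<^sup>+\<omega>. ennreal ((P \<omega> t)\<^sup>2) \<partial>M)
        \<le> (\<integral>\<^sup>+\<omega>. ennreal (real_cond_exp M (discrete_filtration M U t) (\<lambda>\<omega>. (Z \<omega> t)\<^sup>2) \<omega>) \<partial>M)"
      by (rule nn_integral_mono_AE)
    also have "\<dots> = ennreal (\<integral>\<omega>. real_cond_exp M (discrete_filtration M U t) (\<lambda>\<omega>. (Z \<omega> t)\<^sup>2) \<omega> \<partial>M)"
      by (intro nn_integral_eq_integral F.real_cond_exp_int(1) F.real_cond_exp_pos elim(1)) auto
    also have "\<dots> = ennreal (\<integral>\<omega>. (Z \<omega> t)\<^sup>2 \<partial>M)" by (simp add: F.real_cond_exp_int(2)[OF elim(1)])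
    also have "\<dots> = (\<integral>\<^sup>+\<omega>. ennreal ((Z \<omega> t)\<^sup>2) \<partial>M)"
      by (intro nn_integral_eq_integral[symmetric] elim(1)) auto
    finally show ?case .
  qed
  have "(\<integral>\<^sup>+x. ennreal ((case_prod P x)\<^sup>2) \<partial>(M \<Otimes>\<^sub>M time)) = (\<integral>\<^sup>+t. \<integral>\<^sup>+\<omega>. ennreal ((P \<omega> t)\<^sup>2) \<partial>M \<partial>time)"
    by (subst MT.nn_integral_snd[symmetric]) (auto simp: case_prod_beta')
  also have "\<dots> \<le> (\<integral>\<^sup>+t. \<integral>\<^sup>+\<omega>. ennreal ((Z \<omega> t)\<^sup>2) \<partial>M \<partial>time)"
    by (rule nn_integral_mono_AE[OF le])
  also have "\<dots> = (\<integral>\<^sup>+x. ennreal ((case_prod Z x)\<^sup>2) \<partial>(M \<Otimes>\<^sub>M time))"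
    by (subst MT.nn_integral_snd[symmetric]) (auto simp: case_prod_beta')
  also have "\<dots> < \<infinity>" using Z by (simp add: integrable_iff_bounded case_prod_beta')
  finally show P2: "integrable (M \<Otimes>\<^sub>M time) (\<lambda>(\<omega>, t). (P \<omega> t)\<^sup>2)"
    by (simp add: integrable_iff_bounded case_prod_beta')
  assume f: "C1_cyl n f f'"
  note [measurable] = measurable_grad[OF f] measurable_pgrad[OF f]
  have i1: "integrable (M \<Otimes>\<^sub>M time) (\<lambda>x. case_prod (grad n f') x * case_prod P x)"
    by (rule integrable_mult_L2) (use integrable_grad_L2(1)[OF f] P2 in \<open>auto simp: case_prod_beta'\<close>)
  have i2: "integrable (M \<Otimes>\<^sub>M time) (\<lambda>x. case_prod (pgrad n f) x * case_prod Z x)"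
    by (rule integrable_mult_L2) (use integrable_grad_L2(2)[OF f] Z in \<open>auto simp: case_prod_beta'\<close>)
  have i1': "integrable (M \<Otimes>\<^sub>M time) (\<lambda>(\<omega>, t). grad n f' \<omega> t * P \<omega> t)"
    using i1 by (simp add: case_prod_beta')
  have i2': "integrable (M \<Otimes>\<^sub>M time) (\<lambda>(\<omega>, t). pgrad n f \<omega> t * Z \<omega> t)"
    using i2 by (simp add: case_prod_beta')
  have g2: "AE t in time. integrable M (\<lambda>\<omega>. (grad n f' \<omega> t)\<^sup>2)"
    using MT.AE_integrable_snd[of "\<lambda>\<omega> t. (grad n f' \<omega> t)\<^sup>2"] integrable_grad_L2(1)[OF f] by simp
  have "(\<integral>x. case_prod (grad n f') x * case_prod P x \<partial>(M \<Otimes>\<^sub>M time)) = (\<integral>t. \<integral>\<omega>. grad n f' \<omega> t * P \<omega> t \<partial>M \<partial>time)"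
    using MT.integral_snd[OF i1'] by (simp add: case_prod_beta')
  also have "\<dots> = (\<integral>t. \<integral>\<omega>. pgrad n f \<omega> t * Z \<omega> t \<partial>M \<partial>time)"
  proof (rule integral_cong_AE)
    show "(\<lambda>t. \<integral>\<omega>. grad n f' \<omega> t * P \<omega> t \<partial>M) \<in> borel_measurable time"
      using MT.integrable_snd[OF i1'] by auto
    show "(\<lambda>t. \<integral>\<omega>. pgrad n f \<omega> t * Z \<omega> t \<partial>M) \<in> borel_measurable time"
      using MT.integrable_snd[OF i2'] by auto
    show "AE t in time. (\<integral>\<omega>. grad n f' \<omega> t * P \<omega> t \<partial>M) = (\<integral>\<omega>. pgrad n f \<omega> t * Z \<omega> t \<partial>M)"
      using Zt Peq AE_space g2 AE_time MT.AE_integrable_snd[OF i2']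
    proof eventually_elim
      case (elim t)
      let ?F = "discrete_filtration M U t"
      interpret F: finite_measure_subalgebra M ?F by unfold_locales (rule sub)
      note [measurable] = sec[OF elim(3), of Z] sec[OF elim(3), of P] sec[OF elim(3), of "grad n f'"]
        sec[OF elim(3), of "pgrad n f"]
      let ?CZ = "real_cond_exp M ?F (\<lambda>\<omega>. Z \<omega> t)" and ?CW = "real_cond_exp M ?F (\<lambda>\<omega>. grad n f' \<omega> t)"
      have CW: "AE \<omega> in M. ?CW \<omega> = pgrad n f \<omega> t" using cond_exp_grad[OF f] elim(5) by blast
      have [measurable]: "?CZ \<in> borel_measurable M" "?CW \<in> borel_measurable M"
        by auto
      have iCZ: "integrable M (\<lambda>\<omega>. (?CZ \<omega>)\<^sup>2)"
      proof (rule Bochner_Integration.integrable_bound[OF F.real_cond_exp_int(1)[OF elim(1)]])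
        have "integrable M (\<lambda>\<omega>. Z \<omega> t)"
          using integrable_mult_L2[of "\<lambda>_. 1" M "\<lambda>\<omega>. Z \<omega> t"] elim(1) by simp
        then have "AE \<omega> in M. (?CZ \<omega>)\<^sup>2 \<le> real_cond_exp M ?F (\<lambda>\<omega>. (Z \<omega> t)\<^sup>2) \<omega>"
          by (rule F.real_cond_exp_jensens_inequality(2)[of _ UNIV]) (use elim(1) convex_power2 in auto)
        then show "AE \<omega> in M. norm ((?CZ \<omega>)\<^sup>2) \<le> norm (real_cond_exp M ?F (\<lambda>\<omega>. (Z \<omega> t)\<^sup>2) \<omega>)"
          by eventually_elim auto
      qed measurable
      \<comment> \<open>Self-adjointness in two moves: condition the gradient against the measurable
        factor \<open>?CZ\<close>, then remove the conditioning of \<open>Z\<close> against the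
        measurable factor \<open>?CW\<close>.\<close>
      have "(\<integral>\<omega>. grad n f' \<omega> t * P \<omega> t \<partial>M) = (\<integral>\<omega>. ?CZ \<omega> * grad n f' \<omega> t \<partial>M)"
        by (intro integral_cong_AE) (use elim(2) in auto)
      also have "\<dots> = (\<integral>\<omega>. ?CZ \<omega> * ?CW \<omega> \<partial>M)"
        by (rule F.real_cond_exp_intg(2)[symmetric]) (auto intro!: integrable_mult_L2 iCZ elim(4))
      also have "\<dots> = (\<integral>\<omega>. ?CW \<omega> * ?CZ \<omega> \<partial>M)" by (simp add: mult.commute)
      also have "\<dots> = (\<integral>\<omega>. ?CW \<omega> * Z \<omega> t \<partial>M)"
      proof (rule F.real_cond_exp_intg(2))
        show "integrable M (\<lambda>\<omega>. ?CW \<omega> * Z \<omega> t)"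
          by (rule integrable_cong_AE_imp[OF elim(6)]) (use CW in auto)
      qed auto
      also have "\<dots> = (\<integral>\<omega>. pgrad n f \<omega> t * Z \<omega> t \<partial>M)"
        by (intro integral_cong_AE) (use CW in auto)
      finally show ?case .
    qed
  qed
  also have "\<dots> = (\<integral>x. case_prod (pgrad n f) x * case_prod Z x \<partial>(M \<Otimes>\<^sub>M time))"
    using MT.integral_snd[OF i2'] by (simp add: case_prod_beta')
  finally show "(\<integral>x. case_prod (grad n f') x * case_prod P x \<partial>(M \<Otimes>\<^sub>M time))
      = (\<integral>x. case_prod (pgrad n f) x * case_prod Z x \<partial>(M \<Otimes>\<^sub>M time))" .
qed

end

section \<open>The chain rule and Stein's identity\<close>

lemma C1_cyl_compose:
  assumes f: "C1_cyl n f f'"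
    and h: "\<And>x. (h has_real_derivative h' x) (at x)" and h': "continuous_on UNIV h'"
    and L: "\<And>x. \<bar>h' x\<bar> \<le> L"
  shows "C1_cyl n (\<lambda>u. h (f u)) (\<lambda>k u. h' (f u) * f' k u)"
proof -
  have [measurable]: "f \<in> borel_measurable unif_seq" "f' k \<in> borel_measurable unif_seq" for k
    using f by (auto simp: C1_cyl_def)
  note [measurable] = borel_measurable_DERIV[OF h] borel_measurable_continuous_onI[OF h']
  obtain B where B: "\<And>u. \<bar>f u\<bar> \<le> B" using f unfolding C1_cyl_def by blast
  have L0: "0 \<le> L" using L[of 0] by linarith
  have "\<bar>h (f u)\<bar> \<le> \<bar>h 0\<bar> + L * B" for u
  proof -
    have "L * \<bar>f u - 0\<bar> \<le> L * B" using B[of u] L0 by (intro mult_left_mono) auto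
    then show ?thesis using bounded_deriv_lipschitz[OF h L, of "f u" 0] by linarith
  qed
  moreover have "\<exists>C. \<forall>u. \<bar>h' (f u) * f' k u\<bar> \<le> C" for k
  proof -
    obtain C where "\<And>u. \<bar>f' k u\<bar> \<le> C" using f unfolding C1_cyl_def by blast
    then show ?thesis
      using L L0 by (intro exI[of _ "L * C"]) (auto simp: abs_mult intro!: mult_mono)
  qed
  moreover have "((\<lambda>s. h (f (u(k := s)))) has_real_derivative h' (f (u(k := s))) * f' k (u(k := s)))
      (at s within {-1..1})" if "s \<in> {-1..1}" for u k s
    using DERIV_chain2[OF h, of "\<lambda>s. f (u(k := s))"] f that unfolding C1_cyl_def by blast
  ultimately show ?thesis
    using f unfolding C1_cyl_def by auto
qed

context uniform_sequence begin

text \<open>The chain rule is applied to the cylindrical approximants of \<open>X\<close>, with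
  \<open>P\<close> kept fixed. The error of their gradients disappears because h' is bounded and
  \<open>P\<close> is in L2; the factor h' itself is handled by dominated convergence.\<close>

lemma integral_gradient_predictable:
  assumes X: "is_gradient M U X Z" and P: "is_predictable_gradient M U Z P"
    and h: "\<And>x. (h has_real_derivative h' x) (at x)" and h': "continuous_on UNIV h'"
    and L: "\<And>x. \<bar>h' x\<bar> \<le> L"
  shows "(\<integral>x. h' (X (fst x)) * (case_prod Z x * case_prod P x) \<partial>(M \<Otimes>\<^sub>M time))
    = 2 * ((\<integral>\<omega>. h (X \<omega>) * X \<omega> \<partial>M) - (\<integral>\<omega>. h (X \<omega>) \<partial>M) * (\<integral>\<omega>. X \<omega> \<partial>M))"
    and "integrable (M \<Otimes>\<^sub>M time) (\<lambda>x. case_prod Z x * case_prod P x)"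
proof -
  let ?MT = "M \<Otimes>\<^sub>M time"
  have m [measurable]: "X \<in> borel_measurable M" "case_prod Z \<in> borel_measurable ?MT"
    and i: "integrable M (\<lambda>\<omega>. (X \<omega>)\<^sup>2)" "integrable ?MT (\<lambda>(\<omega>, t). (Z \<omega> t)\<^sup>2)"
    using X unfolding is_gradient_def by auto
  have [measurable]: "case_prod P \<in> borel_measurable ?MT"
    using P by (auto simp: is_predictable_gradient_def)
  have P2: "integrable ?MT (\<lambda>x. (case_prod P x)\<^sup>2)" and Z2: "integrable ?MT (\<lambda>x. (case_prod Z x)\<^sup>2)"
    using predictable_L2(1)[OF P m(2) i(2)] i(2) by (simp_all add: case_prod_beta')
  show ZP: "integrable ?MT (\<lambda>x. case_prod Z x * case_prod P x)"
    by (rule integrable_mult_L2) (use P2 Z2 in auto)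
  note [measurable] = borel_measurable_DERIV[OF h] borel_measurable_continuous_onI[OF h']
  have L0: "0 \<le> L" using L[of 0] by linarith
  obtain Xs0 Zs0 where s0: "\<And>m. simple_gradient M U (Xs0 m) (Zs0 m)"
    and limX0: "(\<lambda>m::nat. \<integral>\<omega>. (Xs0 m \<omega> - X \<omega>)\<^sup>2 \<partial>M) \<longlonglongrightarrow> 0"
    and limZ0: "(\<lambda>m. \<integral>(\<omega>, t). (Zs0 m \<omega> t - Z \<omega> t)\<^sup>2 \<partial>?MT) \<longlonglongrightarrow> 0"
    using X unfolding is_gradient_def by blast
  have rep0: "\<exists>n f f'. C1_cyl n f f' \<and> (AE \<omega> in M. Xs0 k \<omega> = f (seq \<omega>)) \<and>
      (AE x in ?MT. case_prod (Zs0 k) x = case_prod (grad n f') x) \<and>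
      Xs0 k \<in> borel_measurable M \<and> case_prod (Zs0 k) \<in> borel_measurable ?MT \<and>
      integrable M (\<lambda>\<omega>. (Xs0 k \<omega>)\<^sup>2) \<and> integrable ?MT (\<lambda>x. (case_prod (Zs0 k) x)\<^sup>2)" for k
    by (rule simple_gradientE[OF s0[of k]]) blast
  have ms0 [measurable]: "Xs0 k \<in> borel_measurable M" and is0: "integrable M (\<lambda>\<omega>. (Xs0 k \<omega>)\<^sup>2)" for k
    using rep0[of k] by blast+
  \<comment> \<open>h' is merely continuous, so h'(X_m) converges to h'(X) only where X_m converges
    to \<open>X\<close>. L2 convergence gives L1 convergence and hence a subsequence that converges
    almost everywhere.\<close>
  have "(\<lambda>k. \<integral>\<omega>. norm (Xs0 k \<omega> - X \<omega>) \<partial>M) \<longlonglongrightarrow> 0"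
    using tendsto_integral_mult_L2(2)[of "\<lambda>_. 1" M X Xs0] i(1) is0 limX0 by simp
  moreover have "integrable M (\<lambda>\<omega>. Xs0 k \<omega> - X \<omega>)" for k
    using integrable_mult_L2[of "\<lambda>_. 1" M "Xs0 k"] integrable_mult_L2[of "\<lambda>_. 1" M X] i(1) is0 by simp
  ultimately obtain r :: "nat \<Rightarrow> nat" where r: "strict_mono r"
    and ae: "AE \<omega> in M. (\<lambda>k. Xs0 (r k) \<omega> - X \<omega>) \<longlonglongrightarrow> 0"
    using tendsto_L1_AE_subseq[of M "\<lambda>k \<omega>. Xs0 k \<omega> - X \<omega>"] by blast
  define Xs Zs where "Xs k = Xs0 (r k)" and "Zs k = Zs0 (r k)" for k
  have limX: "(\<lambda>k. \<integral>\<omega>. (Xs k \<omega> - X \<omega>)\<^sup>2 \<partial>M) \<longlonglongrightarrow> 0"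
    using LIMSEQ_subseq_LIMSEQ[OF limX0 r] by (simp add: o_def Xs_def)
  have limZ: "(\<lambda>k. \<integral>x. (case_prod (Zs k) x - case_prod Z x)\<^sup>2 \<partial>?MT) \<longlonglongrightarrow> 0"
    using LIMSEQ_subseq_LIMSEQ[OF limZ0 r] by (simp add: o_def Zs_def case_prod_beta')
  have repr: "\<exists>n f f'. C1_cyl n f f' \<and> (AE \<omega> in M. Xs k \<omega> = f (seq \<omega>)) \<and>
      (AE x in ?MT. case_prod (Zs k) x = case_prod (grad n f') x)" for k
    using rep0[of "r k"] unfolding Xs_def Zs_def by blast
  have ms [measurable]: "Xs k \<in> borel_measurable M" "case_prod (Zs k) \<in> borel_measurable ?MT"
    and is2: "integrable M (\<lambda>\<omega>. (Xs k \<omega>)\<^sup>2)" "integrable ?MT (\<lambda>x. (case_prod (Zs k) x)\<^sup>2)" for k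
    using rep0[of "r k"] unfolding Xs_def Zs_def by blast+
  have mono: "(h a - h b)\<^sup>2 \<le> L\<^sup>2 * (a - b)\<^sup>2" for a b
    using power_mono[OF bounded_deriv_lipschitz[OF h L, of a b], of 2] by (simp add: power_mult_distrib)
  note h_L2 = integrable_lipschitz_L2[OF _ _ h L]
  have sq: "integrable M (\<lambda>\<omega>. (Xs k \<omega> - X \<omega>)\<^sup>2)" for k
    by (intro integrable_diff_L2 is2 i) auto
  have limh: "(\<lambda>k. \<integral>\<omega>. (h (Xs k \<omega>) - h (X \<omega>))\<^sup>2 \<partial>M) \<longlonglongrightarrow> 0"
  proof (rule Lim_null_comparison)
    show "(\<lambda>k. L\<^sup>2 * (\<integral>\<omega>. (Xs k \<omega> - X \<omega>)\<^sup>2 \<partial>M)) \<longlonglongrightarrow> 0"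
      using tendsto_mult_right_zero[OF limX] .
    have "(\<integral>\<omega>. (h (Xs k \<omega>) - h (X \<omega>))\<^sup>2 \<partial>M) \<le> (\<integral>\<omega>. L\<^sup>2 * (Xs k \<omega> - X \<omega>)\<^sup>2 \<partial>M)" for k
      by (rule integral_mono') (use sq mono in auto)
    then show "\<forall>\<^sub>F k in sequentially. norm (\<integral>\<omega>. (h (Xs k \<omega>) - h (X \<omega>))\<^sup>2 \<partial>M) \<le> L\<^sup>2 * (\<integral>\<omega>. (Xs k \<omega> - X \<omega>)\<^sup>2 \<partial>M)"
      by simp
  qed
  have step: "(\<integral>x. h' (Xs k (fst x)) * (case_prod (Zs k) x * case_prod P x) \<partial>?MT)
      = 2 * ((\<integral>\<omega>. h (Xs k \<omega>) * X \<omega> \<partial>M) - (\<integral>\<omega>. h (Xs k \<omega>) \<partial>M) * (\<integral>\<omega>. X \<omega> \<partial>M))" for k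
  proof -
    obtain n f f' where f: "C1_cyl n f f'" and Y: "AE \<omega> in M. Xs k \<omega> = f (seq \<omega>)"
      and W: "AE x in ?MT. case_prod (Zs k) x = case_prod (grad n f') x"
      using repr[of k] by blast
    have [measurable]: "f \<in> borel_measurable unif_seq" using f by (auto simp: C1_cyl_def)
    note C = C1_cyl_compose[OF f h h' L]
    note [measurable] = measurable_grad[OF f] measurable_grad[OF C]
    have gr: "grad n (\<lambda>k u. h' (f u) * f' k u) \<omega> t = h' (f (seq \<omega>)) * grad n f' \<omega> t" for \<omega> t
      by (simp add: grad_def sum_distrib_left mult.assoc)
    have Y': "AE x in ?MT. Xs k (fst x) = f (seq (fst x))"
    proof (rule MT.AE_pair_measure)
      show "AE \<omega> in M. AE t in time. Xs k (fst (\<omega>, t)) = f (seq (fst (\<omega>, t)))"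
        using Y by eventually_elim simp
    qed measurable
    have "(\<integral>x. h' (Xs k (fst x)) * (case_prod (Zs k) x * case_prod P x) \<partial>?MT)
        = (\<integral>x. case_prod (grad n (\<lambda>k u. h' (f u) * f' k u)) x * case_prod P x \<partial>?MT)"
    proof (rule integral_cong_AE)
      show "AE x in ?MT. h' (Xs k (fst x)) * (case_prod (Zs k) x * case_prod P x)
          = case_prod (grad n (\<lambda>k u. h' (f u) * f' k u)) x * case_prod P x"
        using W Y'
      proof eventually_elim
        case (elim x)
        then show ?case by (cases x) (simp add: gr)
      qed
    qed measurable
    also have "\<dots> = (\<integral>x. case_prod (pgrad n (\<lambda>u. h (f u))) x * case_prod Z x \<partial>?MT)"
      by (rule predictable_L2(3)[OF P m(2) i(2) C])
    also have "\<dots> = 2 * ((\<integral>\<omega>. h (f (seq \<omega>)) * X \<omega> \<partial>M) - (\<integral>\<omega>. h (f (seq \<omega>)) \<partial>M) * (\<integral>\<omega>. X \<omega> \<partial>M))"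
      by (rule integral_pgrad_gradient[OF C X])
    also have "(\<integral>\<omega>. h (f (seq \<omega>)) * X \<omega> \<partial>M) = (\<integral>\<omega>. h (Xs k \<omega>) * X \<omega> \<partial>M)"
    proof (rule integral_cong_AE)
      show "AE \<omega> in M. h (f (seq \<omega>)) * X \<omega> = h (Xs k \<omega>) * X \<omega>" using Y by eventually_elim simp
    qed measurable
    also have "(\<integral>\<omega>. h (f (seq \<omega>)) \<partial>M) = (\<integral>\<omega>. h (Xs k \<omega>) \<partial>M)"
    proof (rule integral_cong_AE)
      show "AE \<omega> in M. h (f (seq \<omega>)) = h (Xs k \<omega>)" using Y by eventually_elim simp
    qed measurable
    finally show ?thesis .
  qed
  have R1: "(\<lambda>k. \<integral>\<omega>. X \<omega> * h (Xs k \<omega>) \<partial>M) \<longlonglongrightarrow> (\<integral>\<omega>. X \<omega> * h (X \<omega>) \<partial>M)"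
    by (rule tendsto_integral_mult_L2) (use limh i(1) h_L2 is2(1) in simp_all)
  have R2: "(\<lambda>k. \<integral>\<omega>. 1 * h (Xs k \<omega>) \<partial>M) \<longlonglongrightarrow> (\<integral>\<omega>. 1 * h (X \<omega>) \<partial>M)"
    by (rule tendsto_integral_mult_L2) (use limh i(1) h_L2 is2(1) in simp_all)
  have R: "(\<lambda>k. 2 * ((\<integral>\<omega>. h (Xs k \<omega>) * X \<omega> \<partial>M) - (\<integral>\<omega>. h (Xs k \<omega>) \<partial>M) * (\<integral>\<omega>. X \<omega> \<partial>M)))
      \<longlonglongrightarrow> 2 * ((\<integral>\<omega>. h (X \<omega>) * X \<omega> \<partial>M) - (\<integral>\<omega>. h (X \<omega>) \<partial>M) * (\<integral>\<omega>. X \<omega> \<partial>M))"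
    using R2 by (intro tendsto_mult tendsto_diff tendsto_const) (use R1 in \<open>simp_all add: mult.commute\<close>)
  \<comment> \<open>The integrand is split as h'(X_m) P (Z_m - Z) plus h'(X_m) Z P. The first part
    is small in L1, and the second is dominated by \<open>L\<close> times the modulus of Z
    P.\<close>
  have E1: "(\<lambda>k. \<integral>x. h' (Xs k (fst x)) * (case_prod P x * (case_prod (Zs k) x - case_prod Z x)) \<partial>?MT) \<longlonglongrightarrow> 0"
  proof (rule Lim_null_comparison)
    let ?J = "\<lambda>k x. \<bar>case_prod P x\<bar> * \<bar>case_prod (Zs k) x - case_prod Z x\<bar>"
    have J: "(\<lambda>k. \<integral>x. ?J k x \<partial>?MT) \<longlonglongrightarrow> 0" and Ji: "\<And>k. integrable ?MT (?J k)"
      by (rule tendsto_integral_mult_L2; use P2 Z2 is2(2) limZ in simp)+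
    show "(\<lambda>k. L * (\<integral>x. ?J k x \<partial>?MT)) \<longlonglongrightarrow> 0" using tendsto_mult_right_zero[OF J] .
    have "norm (\<integral>x. h' (Xs k (fst x)) * (case_prod P x * (case_prod (Zs k) x - case_prod Z x)) \<partial>?MT)
        \<le> L * (\<integral>x. ?J k x \<partial>?MT)" for k
    proof -
      have "norm (\<integral>x. h' (Xs k (fst x)) * (case_prod P x * (case_prod (Zs k) x - case_prod Z x)) \<partial>?MT)
        \<le> (\<integral>x. norm (h' (Xs k (fst x)) * (case_prod P x * (case_prod (Zs k) x - case_prod Z x))) \<partial>?MT)"
        by (rule integral_norm_bound)
      also have "\<dots> \<le> (\<integral>x. L * ?J k x \<partial>?MT)"
        by (rule integral_mono') (use Ji L L0 in \<open>auto simp: abs_mult intro!: mult_right_mono\<close>)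
      finally show ?thesis by simp
    qed
    then show "\<forall>\<^sub>F k in sequentially. norm (\<integral>x. h' (Xs k (fst x)) * (case_prod P x * (case_prod (Zs k) x - case_prod Z x)) \<partial>?MT)
        \<le> L * (\<integral>x. ?J k x \<partial>?MT)" by simp
  qed
  have E2: "(\<lambda>k. \<integral>x. h' (Xs k (fst x)) * (case_prod Z x * case_prod P x) \<partial>?MT)
      \<longlonglongrightarrow> (\<integral>x. h' (X (fst x)) * (case_prod Z x * case_prod P x) \<partial>?MT)"
  proof (rule integral_dominated_convergence)
    show "integrable ?MT (\<lambda>x. L * norm (case_prod Z x * case_prod P x))"
      using ZP by (intro integrable_mult_right integrable_norm)
    show "AE x in ?MT. (\<lambda>k. h' (Xs k (fst x)) * (case_prod Z x * case_prod P x))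
        \<longlonglongrightarrow> h' (X (fst x)) * (case_prod Z x * case_prod P x)"
    proof (rule MT.AE_pair_measure)
      show "AE \<omega> in M. AE t in time. (\<lambda>k. h' (Xs k (fst (\<omega>, t))) * (case_prod Z (\<omega>, t) * case_prod P (\<omega>, t)))
        \<longlonglongrightarrow> h' (X (fst (\<omega>, t))) * (case_prod Z (\<omega>, t) * case_prod P (\<omega>, t))"
        using ae
      proof eventually_elim
        case (elim \<omega>)
        have "(\<lambda>k. Xs k \<omega>) \<longlonglongrightarrow> X \<omega>"
          using LIM_zero_cancel[OF elim] by (simp add: Xs_def)
        moreover have "isCont h' (X \<omega>)" using h' by (simp add: continuous_on_eq_continuous_at)
        ultimately have "(\<lambda>k. h' (Xs k \<omega>)) \<longlonglongrightarrow> h' (X \<omega>)" by (rule isCont_tendsto_compose[rotated])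
        then show ?case by (intro AE_I2) (auto intro!: tendsto_mult_right)
      qed
    qed measurable
    show "AE x in ?MT. norm (h' (Xs k (fst x)) * (case_prod Z x * case_prod P x)) \<le> L * norm (case_prod Z x * case_prod P x)" for k
      by (intro AE_I2, subst norm_mult, intro mult_right_mono) (use L in auto)
  qed measurable
  have "(\<integral>x. h' (Xs k (fst x)) * (case_prod (Zs k) x * case_prod P x) \<partial>?MT)
      = (\<integral>x. h' (Xs k (fst x)) * (case_prod P x * (case_prod (Zs k) x - case_prod Z x)) \<partial>?MT)
      + (\<integral>x. h' (Xs k (fst x)) * (case_prod Z x * case_prod P x) \<partial>?MT)" for k
  proof -
    have bd: "integrable ?MT (\<lambda>x. h' (Xs k (fst x)) * G x)" if G: "integrable ?MT G" for G
      by (rule integrable_bounded_mult[OF G _ L]) measurable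
    have DP: "integrable ?MT (\<lambda>x. case_prod P x * (case_prod (Zs k) x - case_prod Z x))"
      by (intro integrable_mult_L2 integrable_diff_L2 P2 Z2 is2(2)) measurable
    show ?thesis
      by (subst Bochner_Integration.integral_add[OF bd[OF DP] bd[OF ZP], symmetric])
        (intro Bochner_Integration.integral_cong refl; simp add: case_prod_beta' algebra_simps)
  qed
  then have "(\<lambda>k. \<integral>x. h' (Xs k (fst x)) * (case_prod (Zs k) x * case_prod P x) \<partial>?MT)
      \<longlonglongrightarrow> 0 + (\<integral>x. h' (X (fst x)) * (case_prod Z x * case_prod P x) \<partial>?MT)"
    using tendsto_add[OF E1 E2] by simp
  with R show "(\<integral>x. h' (X (fst x)) * (case_prod Z x * case_prod P x) \<partial>?MT)
    = 2 * ((\<integral>\<omega>. h (X \<omega>) * X \<omega> \<partial>M) - (\<integral>\<omega>. h (X \<omega>) \<partial>M) * (\<integral>\<omega>. X \<omega> \<partial>M))"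
    unfolding step by (simp add: LIMSEQ_unique)
qed

text \<open>h'(X) is measurable with respect to the \<sigma>-algebra of \<open>X\<close>, so the
  time integral may be replaced by its conditional expectation given \<open>X\<close>. That is twice
  \<open>\<phi> (X \<omega>)\<close>, and the 2 matches the one in the covariance formula.\<close>

lemma stein_identity:
  assumes \<phi>: "is_phi M U X \<phi>" and X0: "(\<integral>\<omega>. X \<omega> \<partial>M) = 0"
  shows "X \<in> borel_measurable M" "integrable M (\<lambda>\<omega>. (X \<omega>)\<^sup>2)"
    and "\<phi> \<in> borel_measurable borel" "integrable M (\<lambda>\<omega>. \<phi> (X \<omega>))"
    and "\<lbrakk>\<And>x. (h has_real_derivative h' x) (at x); continuous_on UNIV h'; \<And>x. \<bar>h' x\<bar> \<le> L\<rbrakk>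
      \<Longrightarrow> (\<integral>\<omega>. X \<omega> * h (X \<omega>) \<partial>M) = (\<integral>\<omega>. h' (X \<omega>) * \<phi> (X \<omega>) \<partial>M)"
proof -
  let ?MT = "M \<Otimes>\<^sub>M time"
  obtain Z P g where Z: "is_gradient M U X Z" and P: "is_predictable_gradient M U Z P"
    and g: "is_cond_exp_given_value M X (\<lambda>\<omega>. \<integral>t. Z \<omega> t * P \<omega> t \<partial>time) g"
    and \<phi>_eq: "\<And>z. \<phi> z = 1 / 2 * g z"
    using \<phi> unfolding is_phi_def by blast
  show mX [measurable]: "X \<in> borel_measurable M" and "integrable M (\<lambda>\<omega>. (X \<omega>)\<^sup>2)"
    using Z unfolding is_gradient_def by auto
  have mg [measurable]: "g \<in> borel_measurable borel"
    and g_eq: "AE \<omega> in M. g (X \<omega>) = real_cond_exp M (vimage_algebra (space M) X borel) (\<lambda>\<omega>. \<integral>t. Z \<omega> t * P \<omega> t \<partial>time) \<omega>"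
    using g unfolding is_cond_exp_given_value_def by auto
  have \<phi>_fun: "\<phi> = (\<lambda>z. 1 / 2 * g z)" using \<phi>_eq by auto
  show m\<phi> [measurable]: "\<phi> \<in> borel_measurable borel" unfolding \<phi>_fun by measurable
  let ?G = "vimage_algebra (space M) X borel"
  let ?V = "\<lambda>\<omega>. \<integral>t. Z \<omega> t * P \<omega> t \<partial>time"
  have ZP': "integrable ?MT (\<lambda>x. case_prod Z x * case_prod P x)"
    \<comment> \<open>Only the integrability is wanted at this point, so the instance h = 0 with
      bound 0 will do.\<close>
    by (rule integral_gradient_predictable(2)[OF Z P, of "\<lambda>_. 0" "\<lambda>_. 0" 0]) auto
  from ZP' have ZP: "integrable ?MT (\<lambda>(\<omega>, t). Z \<omega> t * P \<omega> t)" by (simp add: case_prod_beta')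
  have V: "integrable M ?V" by (rule MT.integrable_fst[OF ZP])
  have "subalgebra M ?G"
    by (auto simp: subalgebra_def sets_vimage_algebra2)
  then interpret G: finite_measure_subalgebra M ?G by unfold_locales
  note [measurable] = borel_measurable_integrable[OF V]
  have "integrable M (\<lambda>\<omega>. g (X \<omega>))"
    by (rule integrable_cong_AE_imp[OF G.real_cond_exp_int(1)[OF V]]) (use g_eq in auto)
  then show "integrable M (\<lambda>\<omega>. \<phi> (X \<omega>))" by (simp add: \<phi>_eq)
  assume h: "\<And>x. (h has_real_derivative h' x) (at x)" and h': "continuous_on UNIV h'" and L: "\<And>x. \<bar>h' x\<bar> \<le> L"
  have [measurable]: "h' \<in> borel_measurable borel" using h' by (rule borel_measurable_continuous_onI)
  have X_G: "X \<in> measurable ?G borel" by (rule measurable_vimage_algebra1) auto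
  have h'V: "integrable M (\<lambda>\<omega>. h' (X \<omega>) * ?V \<omega>)"
    by (rule integrable_bounded_mult[OF V _ L]) measurable
  have "integrable ?MT (\<lambda>x. h' (X (fst x)) * (case_prod Z x * case_prod P x))"
    by (rule integrable_bounded_mult[OF ZP' _ L]) measurable
  then have ih: "integrable ?MT (\<lambda>(\<omega>, t). h' (X \<omega>) * (Z \<omega> t * P \<omega> t))" by (simp add: case_prod_beta')
  have "2 * (\<integral>\<omega>. X \<omega> * h (X \<omega>) \<partial>M) = (\<integral>x. h' (X (fst x)) * (case_prod Z x * case_prod P x) \<partial>?MT)"
    using integral_gradient_predictable(1)[OF Z P h h' L] by (simp add: X0 mult.commute)
  also have "\<dots> = (\<integral>\<omega>. \<integral>t. h' (X \<omega>) * (Z \<omega> t * P \<omega> t) \<partial>time \<partial>M)"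
    using MT.integral_fst[OF ih] by (simp add: case_prod_beta')
  also have "\<dots> = (\<integral>\<omega>. h' (X \<omega>) * ?V \<omega> \<partial>M)" by simp
  also have "\<dots> = (\<integral>\<omega>. h' (X \<omega>) * real_cond_exp M ?G ?V \<omega> \<partial>M)"
    by (rule G.real_cond_exp_intg(2)[OF h'V, symmetric]) (auto intro: measurable_compose[OF X_G])
  also have "\<dots> = (\<integral>\<omega>. h' (X \<omega>) * g (X \<omega>) \<partial>M)"
  proof (rule integral_cong_AE)
    show "AE \<omega> in M. h' (X \<omega>) * real_cond_exp M ?G ?V \<omega> = h' (X \<omega>) * g (X \<omega>)"
      using g_eq by eventually_elim simp
  qed measurable
  also have "\<dots> = 2 * (\<integral>\<omega>. h' (X \<omega>) * \<phi> (X \<omega>) \<partial>M)"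
    by (subst integral_mult_right_zero[symmetric]) (simp add: \<phi>_eq algebra_simps)
  finally show "(\<integral>\<omega>. X \<omega> * h (X \<omega>) \<partial>M) = (\<integral>\<omega>. h' (X \<omega>) * \<phi> (X \<omega>) \<partial>M)" by simp
qed

end

section \<open>Normal approximation\<close>

lemma has_real_derivative_integral:
  fixes g g' :: "real \<Rightarrow> 'b \<Rightarrow> real"
  assumes "finite_measure N"
    and int: "\<And>x. integrable N (g x)" and [measurable]: "\<And>x. g' x \<in> borel_measurable N"
    and deriv: "\<And>x \<omega>. ((\<lambda>x. g x \<omega>) has_real_derivative g' x \<omega>) (at x)"
    and K: "\<And>x \<omega>. \<bar>g' x \<omega>\<bar> \<le> K"
  shows "((\<lambda>x. \<integral>\<omega>. g x \<omega> \<partial>N) has_real_derivative (\<integral>\<omega>. g' x \<omega> \<partial>N)) (at x)"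
  unfolding DERIV_def tendsto_at_iff_sequentially
proof (intro allI impI)
  interpret finite_measure N by fact
  fix d :: "nat \<Rightarrow> real" assume d: "\<forall>i. d i \<in> UNIV - {0}" "d \<longlonglongrightarrow> 0"
  note [measurable] = borel_measurable_integrable[OF int]
  have lim: "(\<lambda>i. \<integral>\<omega>. (g (x + d i) \<omega> - g x \<omega>) / d i \<partial>N) \<longlonglongrightarrow> (\<integral>\<omega>. g' x \<omega> \<partial>N)"
  proof (rule integral_dominated_convergence[where w="\<lambda>_. K"])
    show "AE \<omega> in N. (\<lambda>i. (g (x + d i) \<omega> - g x \<omega>) / d i) \<longlonglongrightarrow> g' x \<omega>"
      using deriv[of _ x] d unfolding DERIV_def tendsto_at_iff_sequentially by (auto simp: o_def)
    show "AE \<omega> in N. norm ((g (x + d i) \<omega> - g x \<omega>) / d i) \<le> K" for i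
    proof (rule AE_I2)
      fix \<omega>
      have "\<bar>g (x + d i) \<omega> - g x \<omega>\<bar> \<le> K * \<bar>x + d i - x\<bar>"
        by (rule bounded_deriv_lipschitz[OF deriv K])
      then show "norm ((g (x + d i) \<omega> - g x \<omega>) / d i) \<le> K"
        using d(1) by (simp add: abs_divide divide_le_eq)
    qed
  qed auto
  then show "((\<lambda>h. ((\<integral>\<omega>. g (x + h) \<omega> \<partial>N) - (\<integral>\<omega>. g x \<omega> \<partial>N)) / h) \<circ> d) \<longlonglongrightarrow> (\<integral>\<omega>. g' x \<omega> \<partial>N)"
    using int by (simp add: o_def)
qed

lemma set_integrable_lborel:
  fixes K :: "real \<Rightarrow> real"
  assumes "integrable lborel K" "A \<in> sets borel"
  shows "set_integrable lborel A K"
  unfolding set_integrable_def by (rule integrable_mult_indicator) (use assms in auto)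

lemma abs_set_integral_le:
  fixes K w :: "real \<Rightarrow> real"
  assumes K: "integrable lborel K" and w: "integrable lborel w" and le: "\<And>x. \<bar>K x\<bar> \<le> w x" and A: "A \<in> sets borel"
  shows "\<bar>LINT y:A|lborel. K y\<bar> \<le> (LINT y:A|lborel. w y)"
proof -
  have "\<bar>LINT y:A|lborel. K y\<bar> \<le> (\<integral>y. \<bar>indicator A y *\<^sub>R K y\<bar> \<partial>lborel)"
    unfolding set_lebesgue_integral_def by (rule integral_abs_bound)
  also have "\<dots> \<le> (LINT y:A|lborel. w y)"
    unfolding set_lebesgue_integral_def
    using set_integrable_lborel[OF K A] set_integrable_lborel[OF w A] le
    by (intro integral_mono) (auto simp: set_integrable_def indicator_def)
  finally show ?thesis .
qed

text \<open>Close to \<open>x\<close> the lower end -\<infinity> can be traded for the fixed point x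
  - e at the cost of a constant. Continuity is asked on an open set only, since the gamma weight can
  be discontinuous at 0.\<close>

lemma has_real_derivative_cumulative:
  fixes K :: "real \<Rightarrow> real"
  assumes K: "integrable lborel K" and S: "open S" "x \<in> S" "continuous_on S K"
  shows "((\<lambda>x. LINT y:{..x}|lborel. K y) has_real_derivative K x) (at x)"
proof -
  obtain e where e: "e > 0" "cball x e \<subseteq> S" using S open_contains_cball by blast
  let ?a = "x - e" and ?b = "x + e"
  have ab: "{?a..?b} \<subseteq> S" using e(2) by (simp add: cball_eq_atLeastAtMost)
  note si = set_integrable_lborel[OF K]
  have eq: "(LINT y:{..z}|lborel. K y) = (LINT y:{..?a}|lborel. K y) + integral {?a..z} K" if "z \<in> {?a<..<?b}" for z
  proof -
    have u: "{..z} = {..?a} \<union> {?a<..z}" using that by auto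
    have "(LINT y:{..z}|lborel. K y) = (LINT y:{..?a}|lborel. K y) + (LINT y:{?a<..z}|lborel. K y)"
      unfolding u by (rule set_integral_Un) (auto intro: si)
    also have "(LINT y:{?a<..z}|lborel. K y) = (LINT y:{?a..z}|lborel. K y)"
      unfolding set_lebesgue_integral_def
      by (intro integral_cong_AE)
        (use K AE_lborel_singleton[of ?a] in \<open>auto simp: indicator_def elim!: eventually_mono\<close>)
    also have "\<dots> = integral {?a..z} K"
      by (rule set_borel_integral_eq_integral) (auto intro: si)
    finally show ?thesis .
  qed
  have "((\<lambda>z. integral {?a..z} K) has_real_derivative K x) (at x within {?a..?b})"
    using e continuous_on_subset[OF S(3) ab] by (intro integral_has_real_derivative) auto
  then have "((\<lambda>z. integral {?a..z} K) has_real_derivative K x) (at x)"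
    using e by (simp add: at_within_Icc_at)
  then have "((\<lambda>z. (LINT y:{..?a}|lborel. K y) + integral {?a..z} K) has_real_derivative K x) (at x)"
    by (auto intro!: derivative_eq_intros)
  then show ?thesis
    by (rule has_field_derivative_transform_within_open[of _ _ _ "{?a<..<?b}"]) (use e eq in auto)
qed

lemma set_integral_atMost_greaterThan:
  fixes K :: "real \<Rightarrow> real"
  assumes "integrable lborel K"
  shows "(LINT y:{..x}|lborel. K y) + (LINT y:{x<..}|lborel. K y) = (\<integral>y. K y \<partial>lborel)"
proof -
  have "(LINT y:{..x} \<union> {x<..}|lborel. K y) = (LINT y:{..x}|lborel. K y) + (LINT y:{x<..}|lborel. K y)"
    by (intro set_integral_Un set_integrable_lborel assms) auto
  moreover have "{..x} \<union> {x<..} = UNIV" by auto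
  ultimately show ?thesis by (simp add: set_lebesgue_integral_def)
qed

section \<open>Gaussian integration by parts and Stein solutions for smooth functions\<close>

lemma sets_std_normal_law [measurable_cong, simp]: "sets std_normal_law = sets borel"
  by (simp add: std_normal_law_def)

lemma space_std_normal_law [simp]: "space std_normal_law = UNIV"
  by (simp add: std_normal_law_def)

lemma prob_space_std_normal_law: "prob_space std_normal_law"
  unfolding std_normal_law_def by (rule prob_space_normal_density) simp

interpretation std_normal: prob_space std_normal_law by (rule prob_space_std_normal_law)

lemma integral_std_normal_law:
  fixes f :: "real \<Rightarrow> real"
  assumes [measurable]: "f \<in> borel_measurable borel"
  shows "(\<integral>x. f x \<partial>std_normal_law) = (\<integral>x. std_normal_density x * f x \<partial>lborel)"
    and "integrable std_normal_law f \<longleftrightarrow> integrable lborel (\<lambda>x. std_normal_density x * f x)"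
  unfolding std_normal_law_def
  by (subst integral_density integrable_density; simp)+

lemma std_normal_abs_moment:
  "integrable std_normal_law (\<lambda>z. z)" "(\<integral>z. \<bar>z\<bar> \<partial>std_normal_law) \<le> 1"
proof -
  show "integrable std_normal_law (\<lambda>z. z)"
    using integrable_std_normal_moment[of 1] by (simp add: integral_std_normal_law)
  \<comment> \<open>The exact value of the first absolute moment is sqrt (2 / pi).\<close>
  have "sqrt (2 / pi) \<le> 1" using pi_gt3 by simp
  then show "(\<integral>z. \<bar>z\<bar> \<partial>std_normal_law) \<le> 1"
    using integral_std_normal_moment_abs_odd[of 0] by (simp add: integral_std_normal_law)
qed

lemma DERIV_std_normal_density:
  "(std_normal_density has_real_derivative - x * std_normal_density x) (at x)"
proof -
  have "((\<lambda>x. c * exp (- x\<^sup>2 / 2)) has_real_derivative - x * (c * exp (- x\<^sup>2 / 2))) (at x)" for c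
    by (auto intro!: derivative_eq_intros)
  from this[of "1 / sqrt (2 * pi)"] show ?thesis
    unfolding std_normal_density_def[abs_def] .
qed

lemma std_normal_density_tendsto:
  "(std_normal_density \<longlongrightarrow> 0) at_top" "(std_normal_density \<longlongrightarrow> 0) at_bot"
  unfolding std_normal_density_def by real_asymp+

text \<open>With p the normal density, p (k' - z k) is the derivative of p k, which vanishes at both
  ends because k is bounded.\<close>

lemma std_normal_by_parts:
  fixes k k' :: "real \<Rightarrow> real"
  assumes k: "\<And>z. (k has_real_derivative k' z) (at z)" and k': "continuous_on UNIV k'"
    and b: "\<And>z. \<bar>k z\<bar> \<le> B" "\<And>z. \<bar>k' z\<bar> \<le> C"
  shows "(\<integral>z. z * k z \<partial>std_normal_law) = (\<integral>z. k' z \<partial>std_normal_law)"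
proof -
  have ck: "continuous_on UNIV k" by (rule DERIV_continuous_on[OF k])
  have [measurable]: "k \<in> borel_measurable borel" "k' \<in> borel_measurable borel"
    using ck k' by (auto intro: borel_measurable_continuous_onI)
  let ?p = std_normal_density
  have B0: "0 \<le> B" using b(1)[of 0] by linarith
  have "integrable std_normal_law (\<lambda>z. k z * z)"
    by (rule integrable_bounded_mult[OF std_normal_abs_moment(1) _ b(1)]) measurable
  then have i1: "integrable std_normal_law (\<lambda>z. z * k z)" by (simp add: mult.commute)
  have i2: "integrable std_normal_law k'"
    by (rule std_normal.integrable_const_bound[of _ C]) (use b in auto)
  have i: "integrable lborel (\<lambda>z. ?p z * (k' z - z * k z))"
    using i1 i2 by (subst integral_std_normal_law(2)[symmetric]) auto
  have "(LBINT z=-\<infinity>..\<infinity>. ?p z * (k' z - z * k z)) = 0 - 0"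
  proof (rule interval_integral_FTC_integrable)
    show "((\<lambda>z. ?p z * k z) has_vector_derivative ?p z * (k' z - z * k z)) (at z)" for z
      unfolding has_real_derivative_iff_has_vector_derivative[symmetric]
      using DERIV_mult[OF DERIV_std_normal_density k] by (simp add: algebra_simps)
    show "isCont (\<lambda>z. ?p z * (k' z - z * k z)) z" for z
      using k' ck DERIV_isCont[OF DERIV_std_normal_density]
      by (intro continuous_intros) (auto simp: continuous_on_eq_continuous_at)
    show "set_integrable lborel (einterval (-\<infinity>) \<infinity>) (\<lambda>z. ?p z * (k' z - z * k z))"
      using i by (simp add: set_integrable_def)
    have *: "((\<lambda>z. ?p z * k z) \<longlongrightarrow> 0) F" if "(?p \<longlongrightarrow> 0) F" for F
    proof (rule Lim_null_comparison)
      show "((\<lambda>z. ?p z * B) \<longlongrightarrow> 0) F" using tendsto_mult_left_zero[OF that] .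
      show "\<forall>\<^sub>F z in F. norm (?p z * k z) \<le> ?p z * B"
        using b by (auto simp: abs_mult intro!: always_eventually mult_left_mono)
    qed
    show "(((\<lambda>z. ?p z * k z) \<circ> real_of_ereal) \<longlongrightarrow> 0) (at_right (- \<infinity>))"
      using *[OF std_normal_density_tendsto(2)] by (simp add: ereal_tendsto_simps)
    show "(((\<lambda>z. ?p z * k z) \<circ> real_of_ereal) \<longlongrightarrow> 0) (at_left \<infinity>)"
      using *[OF std_normal_density_tendsto(1)] by (simp add: ereal_tendsto_simps)
  qed simp
  then have "(\<integral>z. ?p z * (k' z - z * k z) \<partial>lborel) = 0"
    by (simp add: interval_lebesgue_integral_def set_lebesgue_integral_def)
  then have "(\<integral>z. k' z - z * k z \<partial>std_normal_law) = 0"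
    by (simp add: integral_std_normal_law)
  then show ?thesis using i1 i2 by simp
qed

text \<open>
  Interpolation along the circle between \<open>z\<close> and \<open>x\<close>. The angular parametrisation of the
  Ornstein-Uhlenbeck flow avoids the singularity of Bismut's formula at time \<open>0\<close>.
\<close>

lemma stein_solution_lipschitz:
  fixes h h' h'' :: "real \<Rightarrow> real"
  assumes h: "\<And>x. (h has_real_derivative h' x) (at x)" "\<And>x. (h' has_real_derivative h'' x) (at x)"
    and h'': "continuous_on UNIV h''" and b: "\<And>x. \<bar>h' x\<bar> \<le> 1" "\<And>x. \<bar>h'' x\<bar> \<le> C"
  obtains f f' where "\<And>x. (f has_real_derivative f' x) (at x)" "continuous_on UNIV f'"
    "\<And>x. \<bar>f' x\<bar> \<le> 1" "\<And>x. f' x - x * f x = h x - (\<integral>z. h z \<partial>std_normal_law)"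
proof -
  \<comment> \<open>At angle 0 the interpolation sits at \<open>z\<close>, at angle pi / 2 it sits
    at \<open>x\<close>.\<close>
  define T where "T = restrict_space lborel {0..pi / 2}"
  define Q where "Q = std_normal_law \<Otimes>\<^sub>M T"
  have T_int: "(\<integral>\<theta>. g \<theta> \<partial>T) = G (pi / 2) - G 0"
    if "\<And>\<theta>. (G has_real_derivative g \<theta>) (at \<theta>)" "continuous_on UNIV g" for g G :: "real \<Rightarrow> real"
  proof -
    have "(\<integral>\<theta>. g \<theta> \<partial>T) = (\<integral>\<theta>. indicator {0..pi / 2} \<theta> *\<^sub>R g \<theta> \<partial>lborel)"
      unfolding T_def by (subst integral_restrict_space) auto
    also have "\<dots> = G (pi / 2) - G 0"
      using that
      by (intro integral_FTC_Icc)
        (auto simp: has_real_derivative_iff_has_vector_derivative[symmetric]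
          intro: has_field_derivative_at_within continuous_on_subset)
    finally show ?thesis .
  qed
  note ch = DERIV_continuous_on[OF h(1)] DERIV_continuous_on[OF h(2)]
  have [measurable]: "h \<in> borel_measurable borel" "h' \<in> borel_measurable borel" "h'' \<in> borel_measurable borel"
    using ch h'' by (auto intro: borel_measurable_continuous_onI)
  have fT: "finite_measure T"
    unfolding T_def by (intro finite_measureI) (auto simp: emeasure_restrict_space space_restrict_space)
  interpret T: finite_measure T by (rule fT)
  interpret Q: pair_sigma_finite std_normal_law T ..
  have [measurable]: "snd \<in> borel_measurable (std_normal_law \<Otimes>\<^sub>M T)"
    by (rule measurable_compose[OF measurable_snd]) (simp add: T_def measurable_restrict_space1)
  have fQ: "finite_measure Q"
    unfolding Q_def by (rule finite_measure_pair_measure) (auto intro: fT std_normal.finite_measure_axioms)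
  interpret Qf: finite_measure Q by (rule fQ)
  let ?y = "\<lambda>x p. sin (snd p) * x + cos (snd p) * fst p"
  have C0: "0 \<le> C" using b(2)[of 0] by linarith
  have sc: "\<bar>sin t * cos t * r\<bar> \<le> c" if "\<bar>r\<bar> \<le> c" for t r c :: real
  proof -
    have "\<bar>sin t * cos t\<bar> \<le> 1 * 1" unfolding abs_mult by (intro mult_mono) auto
    then have "\<bar>sin t * cos t * r\<bar> \<le> 1 * \<bar>r\<bar>" unfolding abs_mult[of _ r] by (intro mult_right_mono) auto
    then show ?thesis using that by simp
  qed
  have meas [measurable]: "(\<lambda>p. h' (?y x p)) \<in> borel_measurable Q" "(\<lambda>p. h'' (?y x p)) \<in> borel_measurable Q"
     "(\<lambda>p. cos (snd p)) \<in> borel_measurable Q" "(\<lambda>p. sin (snd p)) \<in> borel_measurable Q" "(\<lambda>p. fst p) \<in> borel_measurable Q" for x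
    unfolding Q_def by measurable
  have z_int: "integrable Q (\<lambda>p. fst p)"
  proof -
    have "integrable (std_normal_law \<Otimes>\<^sub>M T) (\<lambda>(z, \<theta>). z)"
      by (rule Q.Fubini_integrable) (use std_normal_abs_moment(1) in auto)
    then show ?thesis by (simp add: Q_def case_prod_beta')
  qed
  \<comment> \<open>The solution will be -a, with derivative -B. The angular derivative of h(sin
    \<theta> x + cos \<theta> z) is x cos \<theta> h' - z sin \<theta> h'; integrating it over the
    angle and over \<open>z\<close> gives x a(x) - B(x) = h(x) - E h(N), with N standard
    normal.\<close>
  define a where "a x = (\<integral>p. cos (snd p) * h' (?y x p) \<partial>Q)" for x
  define B where "B x = (\<integral>p. sin (snd p) * (fst p * h' (?y x p)) \<partial>Q)" for x
  have a_int: "integrable Q (\<lambda>p. cos (snd p) * h' (?y x p))" for x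
  proof (rule Qf.integrable_const_bound[of _ 1])
    have "\<bar>cos t\<bar> * \<bar>h' y\<bar> \<le> 1 * 1" for t y
      using b(1) by (intro mult_mono) auto
    then show "AE p in Q. norm (cos (snd p) * h' (?y x p)) \<le> 1"
      by (simp add: abs_mult)
  qed measurable
  have B_int: "integrable Q (\<lambda>p. sin (snd p) * (fst p * h' (?y x p)))" for x
  proof (rule Bochner_Integration.integrable_bound[OF z_int])
    have "\<bar>sin t\<bar> * (\<bar>z\<bar> * \<bar>r\<bar>) \<le> 1 * (\<bar>z\<bar> * 1)" if "\<bar>r\<bar> \<le> 1" for t z r :: real
      using that by (intro mult_mono) auto
    then show "AE p in Q. norm (sin (snd p) * (fst p * h' (?y x p))) \<le> norm (fst p)"
      by (intro AE_I2) (simp add: abs_mult b)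
  qed measurable
  have a': "(a has_real_derivative (\<integral>p. sin (snd p) * cos (snd p) * h'' (?y x p) \<partial>Q)) (at x)" for x
    unfolding a_def
  proof (rule has_real_derivative_integral[OF fQ a_int])
    show "((\<lambda>x. cos (snd p) * h' (?y x p)) has_real_derivative sin (snd p) * cos (snd p) * h'' (?y x p)) (at x)" for x p
      by (auto intro!: derivative_eq_intros DERIV_chain2[OF h(2)])
    show "\<bar>sin (snd p) * cos (snd p) * h'' (?y x p)\<bar> \<le> C" for x p
      by (rule sc) (rule b)
  qed measurable
  \<comment> \<open>The derivative of \<open>a\<close> contains h''. Integration by parts in the
    Gaussian variable trades it for z h', so that the bound on \<open>B\<close> depends on the slope
    of \<open>h\<close> alone.\<close>
  have parts: "(\<integral>p. sin (snd p) * cos (snd p) * h'' (?y x p) \<partial>Q) = B x" for x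
  proof -
    have i: "integrable (std_normal_law \<Otimes>\<^sub>M T) (\<lambda>(z, \<theta>). sin \<theta> * cos \<theta> * h'' (sin \<theta> * x + cos \<theta> * z))"
    proof -
      have "integrable Q (\<lambda>p. sin (snd p) * cos (snd p) * h'' (?y x p))"
        by (rule Qf.integrable_const_bound[of _ C]) (auto simp: sc b)
      then show ?thesis by (simp add: Q_def case_prod_beta')
    qed
    have j: "integrable (std_normal_law \<Otimes>\<^sub>M T) (\<lambda>(z, \<theta>). sin \<theta> * (z * h' (sin \<theta> * x + cos \<theta> * z)))"
      using B_int[of x] by (simp add: Q_def case_prod_beta')
    have "(\<integral>p. sin (snd p) * cos (snd p) * h'' (?y x p) \<partial>Q)
        = (\<integral>\<theta>. \<integral>z. sin \<theta> * cos \<theta> * h'' (sin \<theta> * x + cos \<theta> * z) \<partial>std_normal_law \<partial>T)"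
      using Q.integral_snd[OF i] by (simp add: Q_def case_prod_beta')
    also have "\<dots> = (\<integral>\<theta>. \<integral>z. sin \<theta> * (z * h' (sin \<theta> * x + cos \<theta> * z)) \<partial>std_normal_law \<partial>T)"
    proof (rule Bochner_Integration.integral_cong[OF refl])
      fix \<theta>
      have "(\<integral>z. z * h' (sin \<theta> * x + cos \<theta> * z) \<partial>std_normal_law)
          = (\<integral>z. cos \<theta> * h'' (sin \<theta> * x + cos \<theta> * z) \<partial>std_normal_law)"
      proof (rule std_normal_by_parts)
        show "((\<lambda>z. h' (sin \<theta> * x + cos \<theta> * z)) has_real_derivative cos \<theta> * h'' (sin \<theta> * x + cos \<theta> * z)) (at z)" for z
          by (rule DERIV_cong[OF DERIV_chain2[OF h(2)]]) (auto intro!: derivative_eq_intros)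
        show "continuous_on UNIV (\<lambda>z. cos \<theta> * h'' (sin \<theta> * x + cos \<theta> * z))"
          by (intro continuous_intros continuous_on_compose2[OF h'']) auto
        show "\<bar>h' (sin \<theta> * x + cos \<theta> * z)\<bar> \<le> 1" for z by (rule b)
        show "\<bar>cos \<theta> * h'' (sin \<theta> * x + cos \<theta> * z)\<bar> \<le> 1 * C" for z
          unfolding abs_mult using C0 b by (intro mult_mono) auto
      qed
      then show "(\<integral>z. sin \<theta> * cos \<theta> * h'' (sin \<theta> * x + cos \<theta> * z) \<partial>std_normal_law)
          = (\<integral>z. sin \<theta> * (z * h' (sin \<theta> * x + cos \<theta> * z)) \<partial>std_normal_law)"
        by (simp add: mult.assoc)
    qed
    also have "\<dots> = B x"
      using Q.integral_snd[OF j] by (simp add: B_def Q_def case_prod_beta')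
    finally show ?thesis .
  qed
  have B_le: "\<bar>B x\<bar> \<le> 1" for x
  proof -
    have s_int: "integrable Q (\<lambda>p. sin (snd p) * \<bar>fst p\<bar>)"
      by (rule Bochner_Integration.integrable_bound[OF z_int])
        (auto simp: abs_mult intro!: mult_left_le_one_le)
    have pos: "0 \<le> sin (snd p)" if "p \<in> space Q" for p
      using that by (intro sin_ge_zero) (auto simp: Q_def T_def space_pair_measure space_restrict_space intro: order_trans[OF _ pi_half_le_two])
    have "\<bar>B x\<bar> \<le> (\<integral>p. \<bar>sin (snd p) * (fst p * h' (?y x p))\<bar> \<partial>Q)"
      unfolding B_def by (rule integral_abs_bound)
    also have "\<dots> \<le> (\<integral>p. sin (snd p) * \<bar>fst p\<bar> \<partial>Q)"
    proof (rule integral_mono)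
      show "integrable Q (\<lambda>p. \<bar>sin (snd p) * (fst p * h' (?y x p))\<bar>)" using B_int by simp
      fix p assume "p \<in> space Q"
      from pos[OF this] have "\<bar>sin (snd p)\<bar> * (\<bar>fst p\<bar> * \<bar>h' (?y x p)\<bar>) \<le> sin (snd p) * (\<bar>fst p\<bar> * 1)"
        using b(1) by (intro mult_mono mult_left_mono) auto
      then show "\<bar>sin (snd p) * (fst p * h' (?y x p))\<bar> \<le> sin (snd p) * \<bar>fst p\<bar>"
        by (simp add: abs_mult)
    qed (rule s_int)
    also have "\<dots> = (\<integral>z. \<integral>\<theta>. sin \<theta> * \<bar>z\<bar> \<partial>T \<partial>std_normal_law)"
      using Q.integral_fst[of "\<lambda>z \<theta>. sin \<theta> * \<bar>z\<bar>"] s_int by (simp add: Q_def case_prod_beta')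
    also have "\<dots> = (\<integral>z. \<bar>z\<bar> \<partial>std_normal_law)"
    proof -
      \<comment> \<open>The quarter circle contributes exactly 1, which leaves E|N| as the
        bound.\<close>
      have "(\<integral>\<theta>. sin \<theta> \<partial>T) = 1"
        by (subst T_int[of "\<lambda>\<theta>. - cos \<theta>"]) (auto intro!: derivative_eq_intros continuous_intros)
      then show ?thesis by simp
    qed
    also have "\<dots> \<le> 1" by (rule std_normal_abs_moment)
    finally show ?thesis .
  qed
  have eq: "x * a x - B x = h x - (\<integral>z. h z \<partial>std_normal_law)" for x
  proof -
    have i: "integrable Q (\<lambda>p. x * (cos (snd p) * h' (?y x p)) - sin (snd p) * (fst p * h' (?y x p)))"
      using a_int B_int by simp
    have h_int: "integrable std_normal_law h"
    proof (rule Bochner_Integration.integrable_bound)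
      show "integrable std_normal_law (\<lambda>z. \<bar>h 0\<bar> + \<bar>z\<bar>)" using std_normal_abs_moment(1) by simp
      show "AE z in std_normal_law. norm (h z) \<le> norm (\<bar>h 0\<bar> + \<bar>z\<bar>)"
        using bounded_deriv_lipschitz[OF h(1) b(1), of _ 0] by (intro AE_I2) (smt (verit) real_norm_def)
    qed measurable
    have "x * a x - B x = (\<integral>p. x * (cos (snd p) * h' (?y x p)) - sin (snd p) * (fst p * h' (?y x p)) \<partial>Q)"
      unfolding a_def B_def using a_int B_int by simp
    also have "\<dots> = (\<integral>z. \<integral>\<theta>. x * (cos \<theta> * h' (sin \<theta> * x + cos \<theta> * z)) - sin \<theta> * (z * h' (sin \<theta> * x + cos \<theta> * z)) \<partial>T \<partial>std_normal_law)"
      using Q.integral_fst[of "\<lambda>z \<theta>. x * (cos \<theta> * h' (sin \<theta> * x + cos \<theta> * z)) - sin \<theta> * (z * h' (sin \<theta> * x + cos \<theta> * z))"] i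
      by (simp add: Q_def case_prod_beta')
    also have "\<dots> = (\<integral>z. h x - h z \<partial>std_normal_law)"
    proof (rule Bochner_Integration.integral_cong[OF refl])
      fix z
      have "(\<integral>\<theta>. x * (cos \<theta> * h' (sin \<theta> * x + cos \<theta> * z)) - sin \<theta> * (z * h' (sin \<theta> * x + cos \<theta> * z)) \<partial>T)
          = h (sin (pi / 2) * x + cos (pi / 2) * z) - h (sin 0 * x + cos 0 * z)"
      proof (rule T_int)
        show "((\<lambda>\<theta>. h (sin \<theta> * x + cos \<theta> * z)) has_real_derivative
            x * (cos \<theta> * h' (sin \<theta> * x + cos \<theta> * z)) - sin \<theta> * (z * h' (sin \<theta> * x + cos \<theta> * z))) (at \<theta>)" for \<theta>
          by (rule DERIV_cong[OF DERIV_chain2[OF h(1)]]) (auto intro!: derivative_eq_intros simp: algebra_simps)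
        show "continuous_on UNIV (\<lambda>\<theta>. x * (cos \<theta> * h' (sin \<theta> * x + cos \<theta> * z)) - sin \<theta> * (z * h' (sin \<theta> * x + cos \<theta> * z)))"
          by (intro continuous_intros continuous_on_compose2[OF ch(2)]) auto
      qed
      then show "(\<integral>\<theta>. x * (cos \<theta> * h' (sin \<theta> * x + cos \<theta> * z)) - sin \<theta> * (z * h' (sin \<theta> * x + cos \<theta> * z)) \<partial>T) = h x - h z"
        by simp
    qed
    also have "\<dots> = h x - (\<integral>z. h z \<partial>std_normal_law)"
      using h_int std_normal.prob_space by simp
    finally show ?thesis .
  qed
  show thesis
  proof
    show d: "((\<lambda>x. - a x) has_real_derivative - B x) (at x)" for x
      using DERIV_minus[OF a'[of x]] by (simp add: parts)
    \<comment> \<open>Continuity of the derivative is read off Stein's equation, whose other terms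
      are continuous.\<close>
    have "continuous_on UNIV a" by (rule DERIV_continuous_on[OF a'])
    then have "continuous_on UNIV (\<lambda>x. h x - (\<integral>z. h z \<partial>std_normal_law) - x * a x)"
      using ch by (intro continuous_intros)
    moreover have "(\<lambda>x. - B x) = (\<lambda>x. h x - (\<integral>z. h z \<partial>std_normal_law) - x * a x)"
      using eq by (auto simp: algebra_simps)
    ultimately show "continuous_on UNIV (\<lambda>x. - B x)" by (simp only:)
    show "\<bar>- B x\<bar> \<le> 1" for x using B_le by simp
    show "- B x - x * - a x = h x - (\<integral>z. h z \<partial>std_normal_law)" for x using eq[of x] by simp
  qed
qed

text \<open>What the approximation bounds need from the process: \<open>\<phi>\<close> is a Stein
  kernel of \<open>X\<close>. The assumption \<open>by_parts\<close> covers functions with bounded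
  continuous derivative, and this dictates the regularity asked of all Stein solutions.\<close>

locale stein_kernel = prob_space M for M :: "'a measure" +
  fixes X :: "'a \<Rightarrow> real" and \<phi> :: "real \<Rightarrow> real"
  assumes X_meas [measurable]: "X \<in> borel_measurable M"
    and X_L2: "integrable M (\<lambda>\<omega>. (X \<omega>)\<^sup>2)"
    and phi_meas [measurable]: "\<phi> \<in> borel_measurable borel"
    and phi_int: "integrable M (\<lambda>\<omega>. \<phi> (X \<omega>))"
    and by_parts: "\<And>h h' L. \<lbrakk>\<And>x. (h has_real_derivative h' x) (at x); continuous_on UNIV h'; \<And>x. \<bar>h' x\<bar> \<le> L\<rbrakk>
      \<Longrightarrow> (\<integral>\<omega>. X \<omega> * h (X \<omega>) \<partial>M) = (\<integral>\<omega>. h' (X \<omega>) * \<phi> (X \<omega>) \<partial>M)"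
begin

lemma X_int: "integrable M X"
  using integrable_mult_L2[of "\<lambda>_. 1" M X] X_L2 by simp

text \<open>In expectation, X f(X) may be traded for f'(X) times the kernel, so Stein's equation
  leaves E[f'(X) (1 - \<phi>(X))], and \<open>f\<close> enters through the supremum of |f'|
  only.\<close>

lemma stein_bound:
  assumes f: "\<And>x. (f has_real_derivative f' x) (at x)" "continuous_on UNIV f'" "\<And>x. \<bar>f' x\<bar> \<le> L"
    and eq: "\<And>x. f' x - x * f x = h x - c" and h: "integrable M (\<lambda>\<omega>. h (X \<omega>))"
  shows "\<bar>(\<integral>\<omega>. h (X \<omega>) \<partial>M) - c\<bar> \<le> L * (\<integral>\<omega>. \<bar>1 - \<phi> (X \<omega>)\<bar> \<partial>M)"
proof -
  have [measurable]: "f' \<in> borel_measurable borel" using f(2) by (rule borel_measurable_continuous_onI)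
  note [measurable] = borel_measurable_DERIV[OF f(1)]
  have Xf: "integrable M (\<lambda>\<omega>. X \<omega> * f (X \<omega>))"
    by (rule integrable_mult_L2) (use X_L2 integrable_lipschitz_L2[OF X_meas X_L2 f(1,3)] in auto)
  have f'_int: "integrable M (\<lambda>\<omega>. f' (X \<omega>))"
    by (rule integrable_const_bound[of _ L]) (use f(3) in auto)
  have bd: "integrable M (\<lambda>\<omega>. f' (X \<omega>) * g (X \<omega>))" "\<bar>\<integral>\<omega>. f' (X \<omega>) * g (X \<omega>) \<partial>M\<bar> \<le> L * (\<integral>\<omega>. \<bar>g (X \<omega>)\<bar> \<partial>M)"
    if g: "integrable M (\<lambda>\<omega>. g (X \<omega>))" and [measurable]: "g \<in> borel_measurable borel" for g
  proof -
    have le: "\<bar>f' (X \<omega>) * g (X \<omega>)\<bar> \<le> L * \<bar>g (X \<omega>)\<bar>" for \<omega>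
      unfolding abs_mult using f(3) by (intro mult_right_mono) auto
    show i: "integrable M (\<lambda>\<omega>. f' (X \<omega>) * g (X \<omega>))"
      by (rule integrable_bounded_mult[OF g _ f(3)]) measurable
    have "\<bar>\<integral>\<omega>. f' (X \<omega>) * g (X \<omega>) \<partial>M\<bar> \<le> (\<integral>\<omega>. \<bar>f' (X \<omega>) * g (X \<omega>)\<bar> \<partial>M)"
      by (rule integral_abs_bound)
    also have "\<dots> \<le> (\<integral>\<omega>. L * \<bar>g (X \<omega>)\<bar> \<partial>M)"
      using i g le by (intro integral_mono) auto
    finally show "\<bar>\<integral>\<omega>. f' (X \<omega>) * g (X \<omega>) \<partial>M\<bar> \<le> L * (\<integral>\<omega>. \<bar>g (X \<omega>)\<bar> \<partial>M)" by simp
  qed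
  have "(\<integral>\<omega>. h (X \<omega>) \<partial>M) - c = (\<integral>\<omega>. h (X \<omega>) - c \<partial>M)"
    using h prob_space by simp
  also have "\<dots> = (\<integral>\<omega>. f' (X \<omega>) - X \<omega> * f (X \<omega>) \<partial>M)" by (simp add: eq)
  also have "\<dots> = (\<integral>\<omega>. f' (X \<omega>) \<partial>M) - (\<integral>\<omega>. f' (X \<omega>) * \<phi> (X \<omega>) \<partial>M)"
    using f'_int Xf by (simp add: by_parts[OF f])
  also have "\<dots> = (\<integral>\<omega>. f' (X \<omega>) * (1 - \<phi> (X \<omega>)) \<partial>M)"
    using f'_int bd(1)[OF phi_int] by (simp add: right_diff_distrib)
  finally show ?thesis using bd(2)[of "\<lambda>x. 1 - \<phi> x"] phi_int by simp
qed

end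

text \<open>\<open>k\<close> is the moving average of \<open>h\<close> over [x, x + e], written as a
  difference quotient of a primitive. Its derivative is a difference quotient of \<open>h\<close>,
  hence at most 1 in modulus, and the mean value theorem gives the distance to
  \<open>h\<close>.\<close>

lemma smoothing:
  fixes h :: "real \<Rightarrow> real"
  assumes h: "continuous_on UNIV h" "\<And>x y. \<bar>h x - h y\<bar> \<le> \<bar>x - y\<bar>" and e: "e > 0"
  obtains k where "\<And>x. (k has_real_derivative (h (x + e) - h x) / e) (at x)" "\<And>x. \<bar>k x - h x\<bar> \<le> e"
    "\<And>x. \<bar>(h (x + e) - h x) / e\<bar> \<le> 1"
proof -
  obtain H where H: "\<And>x. (H has_real_derivative h x) (at x)"
    using einterval_antiderivative[of "-\<infinity>" "\<infinity>" h] h(1)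
    unfolding has_real_derivative_iff_has_vector_derivative[symmetric]
    by (auto simp: continuous_on_eq_continuous_at)
  show thesis
  proof (rule that[of "\<lambda>x. (H (x + e) - H x) / e"])
    fix x
    have "((\<lambda>x. H (x + e)) has_real_derivative h (x + e)) (at x)"
      using H[of "x + e"] by (simp add: DERIV_shift)
    then show "((\<lambda>x. (H (x + e) - H x) / e) has_real_derivative (h (x + e) - h x) / e) (at x)"
      by (intro DERIV_cdivide DERIV_diff H)
    obtain z where z: "x < z" "z < x + e" "H (x + e) - H x = (x + e - x) * h z"
      using MVT2[of x "x + e" H h] e H by auto
    then have "(H (x + e) - H x) / e = h z" using e by simp
    then show "\<bar>(H (x + e) - H x) / e - h x\<bar> \<le> e" using h(2)[of z x] z by simp
    show "\<bar>(h (x + e) - h x) / e\<bar> \<le> 1" using h(2)[of "x + e" x] e by (simp add: abs_divide)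
  qed
qed

section \<open>The Wasserstein bound\<close>

context stein_kernel begin

lemma wasserstein_bound:
  assumes h: "1-lipschitz_on UNIV h"
  shows "\<bar>(\<integral>\<omega>. h (X \<omega>) \<partial>M) - (\<integral>z. h z \<partial>std_normal_law)\<bar> \<le> (\<integral>\<omega>. \<bar>1 - \<phi> (X \<omega>)\<bar> \<partial>M)"
proof (rule field_le_epsilon)
  fix \<epsilon> :: real assume "\<epsilon> > 0"
  \<comment> \<open>Two smoothings move \<open>h\<close> by at most 2e, and this is paid under both
    laws.\<close>
  define e where "e = \<epsilon> / 4"
  have e: "e > 0" using \<open>\<epsilon> > 0\<close> by (simp add: e_def)
  have lip: "\<bar>h x - h y\<bar> \<le> \<bar>x - y\<bar>" for x y
    using lipschitz_onD[OF h, of x y] by (simp add: dist_real_def)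
  have hc: "continuous_on UNIV h" using lipschitz_on_continuous_on[OF h] .
  obtain k where k: "\<And>x. (k has_real_derivative (h (x + e) - h x) / e) (at x)" "\<And>x. \<bar>k x - h x\<bar> \<le> e"
    "\<And>x. \<bar>(h (x + e) - h x) / e\<bar> \<le> 1"
    using smoothing[OF hc lip e] by metis
  have kc: "continuous_on UNIV k" by (rule DERIV_continuous_on[OF k(1)])
  have klip: "\<bar>k x - k y\<bar> \<le> \<bar>x - y\<bar>" for x y
    using bounded_deriv_lipschitz[OF k(1,3), of x y] by simp
  \<comment> \<open>A single moving average is C1 only, whereas the Stein solution is built for
    functions with a continuous second derivative. Averaging again preserves the slope bound
    1.\<close>
  obtain j where j: "\<And>x. (j has_real_derivative (k (x + e) - k x) / e) (at x)" "\<And>x. \<bar>j x - k x\<bar> \<le> e"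
    "\<And>x. \<bar>(k (x + e) - k x) / e\<bar> \<le> 1"
    using smoothing[OF kc klip e] by metis
  have jc: "continuous_on UNIV j" by (rule DERIV_continuous_on[OF j(1)])
  note [measurable] = borel_measurable_continuous_onI[OF hc] borel_measurable_continuous_onI[OF jc]
  let ?j'' = "\<lambda>x. ((h (x + e + e) - h (x + e)) / e - (h (x + e) - h x) / e) / e"
  have j'': "((\<lambda>x. (k (x + e) - k x) / e) has_real_derivative ?j'' x) (at x)" for x
  proof -
    have "((\<lambda>x. k (x + e)) has_real_derivative (h (x + e + e) - h (x + e)) / e) (at x)"
      using k(1)[of "x + e"] by (simp add: DERIV_shift)
    then show ?thesis by (intro DERIV_cdivide DERIV_diff k)
  qed
  have c: "continuous_on UNIV ?j''"
    using e by (intro continuous_intros continuous_on_compose2[OF hc]) auto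
  \<comment> \<open>Any finite bound will do: the estimate |f'| \<le> 1 supplied by
    \<open>stein_solution_lipschitz\<close> is uniform in it, so \<open>e\<close> may tend to
    0.\<close>
  have bd: "\<bar>?j'' x\<bar> \<le> 2 / e" for x
  proof -
    have "\<bar>(h (x + e + e) - h (x + e)) / e - (h (x + e) - h x) / e\<bar> \<le> 2"
      using k(3)[of "x + e"] k(3)[of x] by linarith
    then show ?thesis
      unfolding abs_divide[of "(h (x + e + e) - h (x + e)) / e - (h (x + e) - h x) / e" e]
      using e by (simp add: divide_right_mono del: abs_divide)
  qed
  obtain f f' where f: "\<And>x. (f has_real_derivative f' x) (at x)" "continuous_on UNIV f'"
    "\<And>x. \<bar>f' x\<bar> \<le> 1" "\<And>x. f' x - x * f x = j x - (\<integral>z. j z \<partial>std_normal_law)"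
    using stein_solution_lipschitz[OF j(1) j'' c j(3) bd] by metis
  have jint: "integrable M (\<lambda>\<omega>. j (X \<omega>))"
    using integrable_mult_L2[of "\<lambda>_. 1" M "\<lambda>\<omega>. j (X \<omega>)"] integrable_lipschitz_L2[OF X_meas X_L2 j(1,3)] by simp
  have close: "\<bar>j x - h x\<bar> \<le> 2 * e" for x using j(2)[of x] k(2)[of x] by linarith
  have comp: "\<bar>(\<integral>\<omega>. j (Y \<omega>) \<partial>N) - (\<integral>\<omega>. h (Y \<omega>) \<partial>N)\<bar> \<le> 2 * e"
    if N: "prob_space N" and Y: "integrable N Y" for N and Y :: "'b \<Rightarrow> real"
  proof -
    interpret N: prob_space N by fact
    note [measurable] = borel_measurable_integrable[OF Y]
    have hi: "integrable N (\<lambda>\<omega>. h (Y \<omega>))"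
    proof (rule Bochner_Integration.integrable_bound)
      show "integrable N (\<lambda>\<omega>. \<bar>h 0\<bar> + \<bar>Y \<omega>\<bar>)" using Y by simp
      show "AE \<omega> in N. norm (h (Y \<omega>)) \<le> norm (\<bar>h 0\<bar> + \<bar>Y \<omega>\<bar>)"
        using lip[of _ 0] by (intro AE_I2) (smt (verit) real_norm_def)
    qed measurable
    have di: "integrable N (\<lambda>\<omega>. j (Y \<omega>) - h (Y \<omega>))"
      by (rule N.integrable_const_bound[of _ "2 * e"]) (use close in auto)
    have "(\<integral>\<omega>. j (Y \<omega>) \<partial>N) - (\<integral>\<omega>. h (Y \<omega>) \<partial>N) = (\<integral>\<omega>. j (Y \<omega>) - h (Y \<omega>) \<partial>N)"
      using Bochner_Integration.integrable_add[OF di hi] hi by simp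
    moreover have "\<bar>\<integral>\<omega>. j (Y \<omega>) - h (Y \<omega>) \<partial>N\<bar> \<le> 2 * e"
      by (rule N.abs_integral_le_const) (use close in auto)
    ultimately show ?thesis by simp
  qed
  have "\<bar>(\<integral>\<omega>. j (X \<omega>) \<partial>M) - (\<integral>z. j z \<partial>std_normal_law)\<bar> \<le> (\<integral>\<omega>. \<bar>1 - \<phi> (X \<omega>)\<bar> \<partial>M)"
    using stein_bound[OF f jint] by simp
  then show "\<bar>(\<integral>\<omega>. h (X \<omega>) \<partial>M) - (\<integral>z. h z \<partial>std_normal_law)\<bar> \<le> (\<integral>\<omega>. \<bar>1 - \<phi> (X \<omega>)\<bar> \<partial>M) + \<epsilon>"
    using comp[OF prob_space_axioms X_int] comp[OF prob_space_std_normal_law std_normal_abs_moment(1)]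
    unfolding e_def by linarith
qed

end

section \<open>The total variation bound\<close>

lemma mills_ratio:
  fixes x :: real
  assumes x: "0 < x"
  shows "x * (LINT y:{x..}|lborel. exp (- y\<^sup>2 / 2)) \<le> exp (- x\<^sup>2 / 2)"
    and "set_integrable lborel {x..} (\<lambda>y. exp (- y\<^sup>2 / 2))"
proof -
  let ?w = "\<lambda>y::real. exp (- y\<^sup>2 / 2)"
  \<comment> \<open>y exp(-y^2/2) has the primitive -exp(-y^2/2), and x \<le> y on the half line
    compares the tail with this exact integral.\<close>
  have "(\<integral>\<^sup>+y\<in>{x..}. ennreal (y * ?w y) \<partial>lborel) = ennreal (0 - (- ?w x))"
  proof (rule nn_integral_FTC_atLeast)
    show "((\<lambda>y. - ?w y) has_real_derivative y * ?w y) (at y)" for y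
      by (auto intro!: derivative_eq_intros)
    show "((\<lambda>y. - ?w y) \<longlongrightarrow> 0) at_top" by real_asymp
  qed (use x in auto)
  moreover have "ennreal (y * ?w y) * indicator {x..} y = ennreal (indicator {x..} y * (y * ?w y))" for y
    by (auto simp: indicator_def)
  ultimately have nn: "(\<integral>\<^sup>+y. ennreal (indicator {x..} y * (y * ?w y)) \<partial>lborel) = ennreal (?w x)" by simp
  have pos: "0 \<le> indicator {x..} y * (y * ?w y)" for y using x by (auto simp: indicator_def)
  have i: "integrable lborel (\<lambda>y. indicator {x..} y * (y * ?w y))"
    by (rule integrableI_nn_integral_finite[OF _ _ nn]) (use pos in auto)
  have I: "(\<integral>y. indicator {x..} y * (y * ?w y) \<partial>lborel) = ?w x"
  proof -
    have "(\<integral>y. indicator {x..} y * (y * ?w y) \<partial>lborel)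
        = enn2real (\<integral>\<^sup>+y. ennreal (indicator {x..} y * (y * ?w y)) \<partial>lborel)"
      by (rule integral_eq_nn_integral) (use pos in auto)
    then show ?thesis unfolding nn by simp
  qed
  show si: "set_integrable lborel {x..} ?w"
    unfolding set_integrable_def
  proof (rule Bochner_Integration.integrable_bound)
    show "integrable lborel (\<lambda>y. (1 / x) * (indicator {x..} y * (y * ?w y)))" using i by simp
    show "AE y in lborel. norm (indicator {x..} y *\<^sub>R ?w y) \<le> norm ((1 / x) * (indicator {x..} y * (y * ?w y)))"
      using x by (intro AE_I2) (auto simp: indicator_def abs_mult field_simps)
  qed measurable
  have "x * (LINT y:{x..}|lborel. ?w y) = (\<integral>y. x * (indicator {x..} y * ?w y) \<partial>lborel)"
    by (simp add: set_lebesgue_integral_def)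
  also have "\<dots> \<le> (\<integral>y. indicator {x..} y * (y * ?w y) \<partial>lborel)"
    using si i by (intro integral_mono) (auto simp: set_integrable_def indicator_def)
  finally show "x * (LINT y:{x..}|lborel. ?w y) \<le> ?w x" unfolding I .
qed

text \<open>The integrating factor exp(-x^2/2) gives the solution f = I / w. Since h - c has mean
  zero under the normal law, \<open>I x\<close> can be computed from either tail; the tail on the
  side of \<open>x\<close> is controlled by \<open>mills_ratio\<close>. The constant 2 is the sum of
  |h - c| \<le> 1 and |x f| \<le> 1.\<close>

lemma stein_solution_bounded:
  fixes h :: "real \<Rightarrow> real"
  assumes h: "continuous_on UNIV h" "\<And>x. 0 \<le> h x" "\<And>x. h x \<le> 1"
  obtains f f' where "\<And>x. (f has_real_derivative f' x) (at x)" "continuous_on UNIV f'"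
    "\<And>x. \<bar>f' x\<bar> \<le> 2" "\<And>x. f' x - x * f x = h x - (\<integral>z. h z \<partial>std_normal_law)"
proof -
  define c where "c = (\<integral>z. h z \<partial>std_normal_law)"
  define w where "w y = exp (- y\<^sup>2 / 2)" for y :: real
  define K where "K y = (h y - c) * w y" for y
  define I where "I x = (LINT y:{..x}|lborel. K y)" for x
  have [measurable]: "h \<in> borel_measurable borel" using h(1) by (rule borel_measurable_continuous_onI)
  have [measurable]: "w \<in> borel_measurable borel" unfolding w_def[abs_def] by measurable
  have w0: "0 < w y" for y by (simp add: w_def)
  have wd: "w y = sqrt (2 * pi) * std_normal_density y" for y
    by (simp add: w_def std_normal_density_def)
  have hi: "integrable std_normal_law h"
    by (rule std_normal.integrable_const_bound[of _ 1]) (use h in auto)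
  have c01: "0 \<le> c" "c \<le> 1"
    unfolding c_def using hi h by (auto intro!: integral_nonneg_AE std_normal.integral_le_const)
  have hc: "\<bar>h y - c\<bar> \<le> 1" for y using h(2,3)[of y] c01 by linarith
  have hci: "integrable std_normal_law (\<lambda>y. h y - c)" using hi by simp
  have "integrable lborel (\<lambda>y. sqrt (2 * pi) * (std_normal_density y * (h y - c)))"
    using hci by (subst (asm) integral_std_normal_law(2)) auto
  then have Ki: "integrable lborel K" by (simp add: K_def[abs_def] wd mult.assoc mult.commute[of "h _ - c"])
  have wi: "integrable lborel w"
    using integrable_std_normal_moment[of 0] by (simp add: wd[abs_def])
  have "(\<integral>y. K y \<partial>lborel) = (\<integral>y. sqrt (2 * pi) * (std_normal_density y * (h y - c)) \<partial>lborel)"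
    by (simp add: K_def wd mult.assoc mult.commute[of "h _ - c"])
  also have "\<dots> = sqrt (2 * pi) * (\<integral>y. h y - c \<partial>std_normal_law)"
    by (simp add: integral_std_normal_law)
  also have "(\<integral>y. h y - c \<partial>std_normal_law) = 0" using hi std_normal.prob_space by (simp add: c_def)
  finally have K0: "(\<integral>y. K y \<partial>lborel) = 0" by simp
  have Kw: "\<bar>K y\<bar> \<le> w y" for y
    using hc[of y] w0[of y] by (simp add: K_def abs_mult)
  note abs_le = abs_set_integral_le[OF Ki wi Kw]
  have xI: "\<bar>x * I x\<bar> \<le> w x" for x
  proof -
    consider "x = 0" | "x > 0" | "x < 0" by linarith
    then show ?thesis
    proof cases
      case 2
      \<comment> \<open>For positive x the lower integral is not small by itself; mean zero turns it
        into minus the upper tail.\<close>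
      have "I x = - (LINT y:{x<..}|lborel. K y)"
        using set_integral_atMost_greaterThan[OF Ki, of x] by (simp add: I_def K0)
      then have "\<bar>I x\<bar> \<le> (LINT y:{x<..}|lborel. w y)" using abs_le[of "{x<..}"] by simp
      also have "\<dots> \<le> (LINT y:{x..}|lborel. w y)"
        unfolding set_lebesgue_integral_def
        using set_integrable_lborel[OF wi, of "{x<..}"] set_integrable_lborel[OF wi, of "{x..}"] w0
        by (intro integral_mono) (auto simp: set_integrable_def indicator_def less_imp_le)
      finally have "x * \<bar>I x\<bar> \<le> x * (LINT y:{x..}|lborel. w y)" using 2 by (intro mult_left_mono) auto
      also have "\<dots> \<le> w x" using mills_ratio(1)[OF 2] by (simp add: w_def)
      finally show ?thesis using 2 by (simp add: abs_mult)
    next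
      case 3
      have "\<bar>I x\<bar> \<le> (LINT y:{..x}|lborel. w y)" unfolding I_def by (rule abs_le) simp
      also have "\<dots> = (LINT y:{-x..}|lborel. w y)"
        unfolding set_lebesgue_integral_def
        by (subst lborel_integral_real_affine[of "-1" _ 0])
          (auto intro!: Bochner_Integration.integral_cong simp: indicator_def w_def)
      finally have "(-x) * \<bar>I x\<bar> \<le> (-x) * (LINT y:{-x..}|lborel. w y)" using 3 by (intro mult_left_mono) auto
      also have "\<dots> \<le> w x" using mills_ratio(1)[of "-x"] 3 by (simp add: w_def)
      finally show ?thesis using 3 by (simp add: abs_mult)
    qed (use w0 in \<open>auto simp: less_imp_le\<close>)
  qed
  have Kc: "continuous_on UNIV K"
    unfolding K_def w_def by (intro continuous_intros h) simp
  have dI: "(I has_real_derivative K x) (at x)" for x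
    unfolding I_def by (rule has_real_derivative_cumulative[OF Ki, of UNIV]) (use Kc in auto)
  have dw: "(w has_real_derivative - x * w x) (at x)" for x
    unfolding w_def by (auto intro!: derivative_eq_intros)
  define f where "f x = I x / w x" for x
  have df: "(f has_real_derivative h x - c + x * f x) (at x)" for x
  proof -
    have "(f has_real_derivative (K x * w x - I x * (- x * w x)) / (w x * w x)) (at x)"
      unfolding f_def using w0[of x] by (intro DERIV_divide dI dw) simp
    also have "(K x * w x - I x * (- x * w x)) / (w x * w x) = h x - c + x * f x"
      using w0[of x] by (simp add: K_def f_def field_simps)
    finally show ?thesis .
  qed
  show thesis
  proof (rule that[of f "\<lambda>x. h x - c + x * f x"])
    show "(f has_real_derivative h x - c + x * f x) (at x)" for x by (rule df)
    have "continuous_on UNIV f" by (rule DERIV_continuous_on[OF df])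
    then show "continuous_on UNIV (\<lambda>x. h x - c + x * f x)" by (intro continuous_intros h)
    have xf: "\<bar>x * f x\<bar> \<le> 1" for x
      using xI[of x] w0[of x] by (simp add: f_def abs_divide)
    show "\<bar>h x - c + x * f x\<bar> \<le> 2" for x using hc[of x] xf[of x] by linarith
    show "h x - c + x * f x - x * f x = h x - (\<integral>z. h z \<partial>std_normal_law)" for x
      by (simp add: c_def)
  qed
qed

context stein_kernel begin

lemma continuous_test_bound:
  assumes h: "continuous_on UNIV h" "\<And>x. 0 \<le> h x" "\<And>x. h x \<le> 1"
  shows "\<bar>(\<integral>\<omega>. h (X \<omega>) \<partial>M) - (\<integral>z. h z \<partial>std_normal_law)\<bar> \<le> 2 * (\<integral>\<omega>. \<bar>1 - \<phi> (X \<omega>)\<bar> \<partial>M)"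
proof -
  have [measurable]: "h \<in> borel_measurable borel" using h(1) by (rule borel_measurable_continuous_onI)
  have hi: "integrable M (\<lambda>\<omega>. h (X \<omega>))"
    by (rule integrable_const_bound[of _ 1]) (use h in auto)
  obtain f f' where f: "\<And>x. (f has_real_derivative f' x) (at x)" "continuous_on UNIV f'"
    "\<And>x. \<bar>f' x\<bar> \<le> 2" "\<And>x. f' x - x * f x = h x - (\<integral>z. h z \<partial>std_normal_law)"
    using stein_solution_bounded[OF h] by metis
  show ?thesis using stein_bound[OF f hi] .
qed

text \<open>For an indicator the explicit Stein solution would have a discontinuous derivative,
  outside the reach of \<open>by_parts\<close>. A closed set is a decreasing limit of continuous
  functions, and the bound 2 is uniform along the limit.\<close>

lemma closed_bound:
  assumes "closed K"
  shows "\<bar>measure (distr M borel X) K - measure std_normal_law K\<bar> \<le> 2 * (\<integral>\<omega>. \<bar>1 - \<phi> (X \<omega>)\<bar> \<partial>M)"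
proof (cases "K = {}")
  case False
  \<comment> \<open>The empty set is treated separately because \<open>infdist x {}\<close> is 0 by
    convention, which would make all these functions constantly 1.\<close>
  define h where "h n x = max 0 (1 - real n * infdist x K)" for n :: nat and x :: real
  have hc: "continuous_on UNIV (h n)" for n
    unfolding h_def by (intro continuous_intros)
  have h01: "0 \<le> h n x" "h n x \<le> 1" for n x
    using infdist_nonneg[of x K] by (auto simp: h_def)
  have lim: "(\<lambda>n. h n x) \<longlonglongrightarrow> indicator K x" for x
  proof (cases "x \<in> K")
    case True
    then show ?thesis by (simp add: h_def)
  next
    case out: False
    then have "infdist x K > 0"
      using in_closed_iff_infdist_zero[OF assms False] infdist_nonneg[of x K] by (metis order_le_less)
    then have "\<forall>\<^sub>F n in sequentially. h n x = 0"
    proof -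
      obtain N :: nat where N: "1 / infdist x K < N" using reals_Archimedean2 by blast
      have "h n x = 0" if "n \<ge> N" for n
      proof -
        have "1 / infdist x K \<le> real n" using N that by linarith
        then have "1 \<le> real n * infdist x K" using \<open>infdist x K > 0\<close> by (simp add: field_simps)
        then show ?thesis by (simp add: h_def)
      qed
      then show ?thesis by (auto simp: eventually_sequentially)
    qed
    then show ?thesis using out by (simp add: tendsto_eventually)
  qed
  have conv: "(\<lambda>n. \<integral>x. h n x \<partial>N) \<longlonglongrightarrow> measure N K" if "prob_space N" "sets N = sets borel" for N
  proof -
    interpret N: prob_space N by fact
    note [measurable_cong] = that(2)
    have [measurable]: "K \<in> sets borel" using assms by (rule borel_closed)
    have [measurable]: "h n \<in> borel_measurable borel" for n
      using hc by (rule borel_measurable_continuous_onI)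
    have "(\<lambda>n. \<integral>x. h n x \<partial>N) \<longlonglongrightarrow> (\<integral>x. indicator K x \<partial>N)"
      by (rule integral_dominated_convergence[where w="\<lambda>_. 1"]) (use lim h01 in auto)
    then show ?thesis using sets_eq_imp_space_eq[OF that(2)] by simp
  qed
  have "(\<lambda>n. \<bar>(\<integral>x. h n x \<partial>distr M borel X) - (\<integral>x. h n x \<partial>std_normal_law)\<bar>)
      \<longlonglongrightarrow> \<bar>measure (distr M borel X) K - measure std_normal_law K\<bar>"
    by (intro tendsto_intros conv prob_space_std_normal_law prob_space_distr) auto
  moreover have "\<bar>(\<integral>x. h n x \<partial>distr M borel X) - (\<integral>x. h n x \<partial>std_normal_law)\<bar> \<le> 2 * (\<integral>\<omega>. \<bar>1 - \<phi> (X \<omega>)\<bar> \<partial>M)" for n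
    using continuous_test_bound[OF hc h01]
    by (subst integral_distr) (auto intro: borel_measurable_continuous_onI hc)
  ultimately show ?thesis by (intro LIMSEQ_le_const2) auto
qed (simp add: integral_nonneg_AE)

lemma total_variation_bound:
  assumes A: "A \<in> sets borel"
  shows "\<bar>measure (distr M borel X) A - measure std_normal_law A\<bar> \<le> 2 * (\<integral>\<omega>. \<bar>1 - \<phi> (X \<omega>)\<bar> \<partial>M)"
proof (rule field_le_epsilon)
  fix e :: real assume e: "e > 0"
  have approx: "\<exists>K\<subseteq>A. compact K \<and> measure N A - e / 2 < measure N K"
    if N: "prob_space N" "sets N = sets borel" for N :: "real measure"
  \<comment> \<open>\<open>ennreal\<close> sends negative numbers to 0, so the strict comparison
    with \<open>emeasure N A\<close> is made in the nonnegative case; in the other case the empty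
    set suffices.\<close>
  proof (cases "measure N A - e / 2 < 0")
    case True
    then show ?thesis by (intro exI[of _ "{}"]) auto
  next
    case False
    interpret N: prob_space N by fact
    have "emeasure N A = (SUP K\<in>{K. K \<subseteq> A \<and> compact K}. emeasure N K)"
      by (rule inner_regular) (use N(2) A in auto)
    moreover have "ennreal (measure N A - e / 2) < emeasure N A"
      using False e by (simp add: N.emeasure_eq_measure ennreal_less_iff)
    ultimately obtain K where "K \<subseteq> A" "compact K" "ennreal (measure N A - e / 2) < emeasure N K"
      by (auto simp: less_SUP_iff)
    then show ?thesis
      using False by (auto simp: N.emeasure_eq_measure ennreal_less_iff intro!: exI[of _ K])
  qed
  let ?X = "distr M borel X"
  have X: "prob_space ?X" by (rule prob_space_distr) simp
  interpret X: prob_space ?X by (rule X)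
  obtain K1 where K1: "K1 \<subseteq> A" "compact K1" "measure ?X A - e / 2 < measure ?X K1"
    using approx[OF X] by auto
  obtain K2 where K2: "K2 \<subseteq> A" "compact K2" "measure std_normal_law A - e / 2 < measure std_normal_law K2"
    using approx[OF prob_space_std_normal_law] by auto
  \<comment> \<open>One set has to serve both laws: the union stays inside \<open>A\<close> and is
    at least as large under each law as the set chosen for it.\<close>
  let ?K = "K1 \<union> K2"
  have cl: "closed ?K" using K1 K2 by (auto intro: compact_imp_closed)
  then have "?K \<in> sets borel" by (rule borel_closed)
  note cl = cl this
  have m: "measure ?X K1 \<le> measure ?X ?K" "measure ?X ?K \<le> measure ?X A"
    "measure std_normal_law K2 \<le> measure std_normal_law ?K" "measure std_normal_law ?K \<le> measure std_normal_law A"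
    using K1 K2 cl A
    by (auto intro!: X.finite_measure_mono std_normal.finite_measure_mono)
  from closed_bound[OF cl(1)] m K1(3) K2(3)
  show "\<bar>measure ?X A - measure std_normal_law A\<bar> \<le> 2 * (\<integral>\<omega>. \<bar>1 - \<phi> (X \<omega>)\<bar> \<partial>M) + e"
    by linarith
qed

end

section \<open>Gamma approximation\<close>

text \<open>The square smooths the kink of the positive part, so that the truncation (G - 1)^+ can
  be used as a differentiable test weight in the maximum principle.\<close>

lemma DERIV_pos_part_square:
  "((\<lambda>x::real. (max 0 x)\<^sup>2) has_real_derivative 2 * max 0 x) (at x)"
proof -
  consider "x > 0" | "x < 0" | "x = 0" by linarith
  then show ?thesis
  proof cases
    case 1
    have "((\<lambda>x::real. x\<^sup>2) has_real_derivative 2 * max 0 x) (at x)"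
      using 1 by (auto intro!: derivative_eq_intros)
    then show ?thesis
      by (rule has_field_derivative_transform_within_open[of _ _ _ "{0<..}"]) (use 1 in auto)
  next
    case 2
    have "((\<lambda>x::real. 0) has_real_derivative 2 * max 0 x) (at x)" using 2 by simp
    then show ?thesis
      by (rule has_field_derivative_transform_within_open[of _ _ _ "{..<0}"]) (use 2 in auto)
  next
    case 3
    have "((\<lambda>h::real. ((max 0 (0 + h))\<^sup>2 - (max 0 0)\<^sup>2) / h) \<longlongrightarrow> 0) (at 0)"
    proof (rule Lim_null_comparison)
      have "norm (((max 0 (0 + h))\<^sup>2 - (max 0 0)\<^sup>2) / h) \<le> \<bar>h\<bar>" for h :: real
        by (cases "h > 0") (auto simp: power2_eq_square max_def)
      then show "\<forall>\<^sub>F h :: real in at 0. norm (((max 0 (0 + h))\<^sup>2 - (max 0 0)\<^sup>2) / h) \<le> \<bar>h\<bar>" by simp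
      show "((\<lambda>h::real. \<bar>h\<bar>) \<longlongrightarrow> 0) (at 0)" by (rule tendsto_eq_intros) auto
    qed
    then show ?thesis using 3 by (simp add: DERIV_def)
  qed
qed

text \<open>
  Maximum principle for \<open>u G'' + (a + 2 - u) G' - 2 G = D\<close> with \<open>D \<ge> -2\<close>, in the divergence form
  \<open>q' = u\<^sup>a\<^sup>+\<^sup>1 e\<^sup>-\<^sup>u (D + 2 G)\<close>, \<open>q = u\<^sup>a\<^sup>+\<^sup>2 e\<^sup>-\<^sup>u G'\<close>. If \<open>G > 1\<close> somewhere, then monotonicity of
  \<open>((G - 1)\<^sup>+)\<^sup>2 q\<close> propagates \<open>G > 1\<close> to one of the two ends, where \<open>G\<close> then blows up faster than
  allowed.
\<close>

lemma laguerre_max_principle: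
  fixes G G1 D :: "real \<Rightarrow> real"
  assumes a: "a > 0"
    and G: "\<And>u. u > 0 \<Longrightarrow> (G has_real_derivative G1 u) (at u)"
    and q: "\<And>u. u > 0 \<Longrightarrow> ((\<lambda>u. u powr (a + 2) * exp (- u) * G1 u) has_real_derivative
        u powr (a + 1) * exp (- u) * (D u + 2 * G u)) (at u)"
    and D: "\<And>u. \<bar>D u\<bar> \<le> 2"
    and near_0: "\<And>u. 0 < u \<Longrightarrow> u \<le> 1 \<Longrightarrow> \<bar>G u\<bar> \<le> C / u"
    and near_inf: "\<And>u. 1 \<le> u \<Longrightarrow> \<bar>G u\<bar> \<le> C * exp (u / 2)"
    and "u > 0"
  shows "G u \<le> 1"
proof (rule ccontr)
  define u0 where "u0 = u"
  assume "\<not> G u \<le> 1"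
  then have G0: "G u0 > 1" and u0: "u0 > 0" using \<open>u > 0\<close> by (auto simp: u0_def)
  define Q where "Q u = u powr (a + 2) * exp (- u) * G1 u" for u
  define Q1 where "Q1 u = u powr (a + 1) * exp (- u) * (D u + 2 * G u)" for u
  define m where "m u = max 0 (G u - 1)" for u
  have dQ: "(Q has_real_derivative Q1 u) (at u)" if "u > 0" for u
    using q[OF that] unfolding Q_def Q1_def .
  have dm: "((\<lambda>u. (m u)\<^sup>2) has_real_derivative 2 * m u * G1 u) (at u)" if "u > 0" for u
  proof -
    have "((\<lambda>u. G u - 1) has_real_derivative G1 u) (at u)" using G[OF that] by (auto intro!: derivative_eq_intros)
    then show ?thesis unfolding m_def by (rule DERIV_chain2[OF DERIV_pos_part_square])
  qed
  have G1_Q: "G1 u = Q u * (u powr (- a - 2) * exp u)" if "u > 0" for u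
  proof -
    have "u powr (a + 2) * u powr (- a - 2) = 1"
      using that by (simp add: powr_add[symmetric])
    moreover have "exp (- u) * exp u = 1" by (simp add: exp_add[symmetric])
    ultimately show ?thesis unfolding Q_def by (metis (no_types, opaque_lifting) mult.assoc mult.commute mult_1)
  qed
  have sgn: "0 \<le> m u * G1 u \<longleftrightarrow> 0 \<le> m u * Q u" "m u * G1 u \<le> 0 \<longleftrightarrow> m u * Q u \<le> 0" if "u > 0" for u
    using that by (auto simp: G1_Q zero_le_mult_iff mult_le_0_iff)
  \<comment> \<open>The derivative of m^2 Q has two nonnegative terms: G' Q is a positive weight
    times G'^2, and where G > 1 the source D + 2 G is positive because D \<ge> -2.\<close>
  have R_mono: "(m u)\<^sup>2 * Q u \<le> (m v)\<^sup>2 * Q v" if "0 < u" "u \<le> v" for u v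
  proof (rule DERIV_nonneg_imp_nondecreasing[OF that(2)])
    fix x assume "u \<le> x" "x \<le> v"
    then have x: "x > 0" using that by simp
    have "((\<lambda>u. (m u)\<^sup>2 * Q u) has_real_derivative 2 * m x * G1 x * Q x + Q1 x * (m x)\<^sup>2) (at x)"
      by (rule DERIV_mult[OF dm[OF x] dQ[OF x]])
    moreover have "0 \<le> 2 * m x * G1 x * Q x + Q1 x * (m x)\<^sup>2"
    proof (cases "G x \<le> 1")
      case False
      have "G1 x * Q x = x powr (a + 2) * exp (- x) * (G1 x)\<^sup>2" by (simp add: Q_def power2_eq_square)
      then have "0 \<le> G1 x * Q x" by simp
      moreover have "0 \<le> m x" by (simp add: m_def)
      moreover have "0 \<le> Q1 x" using D[of x] False by (simp add: Q1_def)
      ultimately show ?thesis by (simp add: mult.assoc)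
    qed (simp add: m_def)
    ultimately show "\<exists>y. ((\<lambda>u. (m u)\<^sup>2 * Q u) has_real_derivative y) (at x) \<and> 0 \<le> y" by blast
  qed
  have m0: "m u \<ge> 0" for u by (simp add: m_def)
  have G_ge: "G v \<ge> G u0" if "(m v)\<^sup>2 \<ge> (m u0)\<^sup>2" for v
  proof -
    have "m v \<ge> m u0" using that m0 by (simp add: abs_le_square_iff[symmetric])
    then show ?thesis using G0 by (auto simp: m_def max_def split: if_splits)
  qed
  have Q1_ge: "0 \<le> Q1 u" if "G u \<ge> G u0" for u
    using that G0 D[of u] by (simp add: Q1_def)
  have Q1_gt: "0 < Q1 u" if "G u \<ge> G u0" "u > 0" for u
  proof -
    have "0 < D u + 2 * G u" using that G0 D[of u] by linarith
    then show ?thesis using that(2) by (simp add: Q1_def)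
  qed
  have Q_le: "Q v \<le> Q w" if "0 < v" "v \<le> w" "\<And>x. v \<le> x \<Longrightarrow> x \<le> w \<Longrightarrow> G x \<ge> G u0" for v w
    by (rule DERIV_nonneg_imp_nondecreasing[OF that(2)]) (meson Q1_ge dQ less_le_trans that)
  show False
  \<comment> \<open>\<open>Q\<close> has the sign of G', so its sign at \<open>u0\<close> decides
    whether the excess over 1 is carried to infinity or to 0.\<close>
  proof (cases "0 \<le> Q u0")
    case True
    have "(m u0)\<^sup>2 \<le> (m v)\<^sup>2" if "u0 \<le> v" for v
    proof (rule DERIV_nonneg_imp_nondecreasing[OF that])
      fix x assume "u0 \<le> x" "x \<le> v"
      then have x: "x > 0" using u0 by simp
      have "0 \<le> (m x)\<^sup>2 * Q x"
        using R_mono[OF u0 \<open>u0 \<le> x\<close>] True by (meson mult_nonneg_nonneg order_trans zero_le_power2)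
      then have "0 \<le> m x * Q x" using m0[of x] by (cases "m x = 0") (auto simp: zero_le_mult_iff)
      then show "\<exists>y. ((\<lambda>u. (m u)\<^sup>2) has_real_derivative y) (at x) \<and> 0 \<le> y"
        using dm[OF x] sgn(1)[OF x] by (intro exI[of _ "2 * m x * G1 x"]) (simp add: mult.assoc mult.commute[of "G1 x"])
    qed
    then have Gv: "G v \<ge> G u0" if "u0 \<le> v" for v using that by (intro G_ge) auto
    \<comment> \<open>\<open>Q u0\<close> may vanish. Strict growth over one unit of length gives a
      positive lower bound \<delta> for \<open>Q\<close> from then on.\<close>
    have "Q u0 < Q (u0 + 1)"
      by (rule DERIV_pos_imp_increasing[of u0]) (use dQ Q1_gt Gv u0 in \<open>force+\<close>)
    then have pos: "Q (u0 + 1) > 0" using True by simp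
    define \<delta> where "\<delta> = Q (u0 + 1)"
    have G1_ge: "G1 v \<ge> \<delta> * (v powr (- a - 2) * exp v)" if "u0 + 1 \<le> v" for v
    proof -
      have "\<delta> \<le> Q v" unfolding \<delta>_def using that u0 Gv by (intro Q_le) auto
      then show ?thesis using that u0 by (subst G1_Q) (auto intro!: mult_right_mono)
    qed
    \<comment> \<open>Mean value theorem on [v, v + 1]: the slope there is at least \<delta>
      z^(-a-2) e^z, while both values of G are at most of order e^((v+1)/2).\<close>
    have le: "(v + 1) powr (- a - 2) * exp v / exp ((v + 1) / 2) \<le> 2 * \<bar>C\<bar> / \<delta>" if v: "v \<ge> u0 + 1" for v
    proof -
      have v1: "v \<ge> 1" using v u0 by simp
      obtain z where z: "v < z" "z < v + 1" "G (v + 1) - G v = (v + 1 - v) * G1 z"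
        using MVT2[of v "v + 1" G G1] G v1 by auto
      have "\<delta> * ((v + 1) powr (- a - 2) * exp v) \<le> \<delta> * (z powr (- a - 2) * exp z)"
        using z v1 a pos unfolding \<delta>_def by (intro mult_left_mono mult_mono powr_mono2') auto
      also have "\<dots> \<le> G1 z" using z v by (intro G1_ge) simp
      also have "\<dots> \<le> \<bar>G (v + 1)\<bar> + \<bar>G v\<bar>" using z(3) by simp
      also have "\<dots> \<le> C * exp ((v + 1) / 2) + C * exp (v / 2)"
        using near_inf[of "v + 1"] near_inf[of v] v1 by (intro add_mono) auto
      also have "\<dots> \<le> \<bar>C\<bar> * exp ((v + 1) / 2) + \<bar>C\<bar> * exp ((v + 1) / 2)"
        by (intro add_mono mult_mono) auto
      finally show ?thesis using pos by (simp add: \<delta>_def field_simps)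
    qed
    have "filterlim (\<lambda>v. (v + 1) powr (- a - 2) * exp v / exp ((v + 1) / 2)) at_top at_top"
      using a by real_asymp
    then have "\<forall>\<^sub>F v in at_top. 2 * \<bar>C\<bar> / \<delta> < (v + 1) powr (- a - 2) * exp v / exp ((v + 1) / 2)"
      by (simp add: filterlim_at_top_dense)
    from eventually_happens'[OF _ eventually_conj[OF this eventually_ge_at_top[of "u0 + 1"]]]
    obtain v where "2 * \<bar>C\<bar> / \<delta> < (v + 1) powr (- a - 2) * exp v / exp ((v + 1) / 2)" "u0 + 1 \<le> v"
      by auto
    with le[of v] show False by simp
  next
    case False
    define \<delta> where "\<delta> = - Q u0"
    have d: "\<delta> > 0" using False by (simp add: \<delta>_def)
    have mm: "0 < m u0" using G0 by (simp add: m_def)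
    have "(m u0)\<^sup>2 \<le> (m v)\<^sup>2" if v: "0 < v" "v \<le> u0" for v
    proof (rule DERIV_nonpos_imp_nonincreasing[OF v(2)])
      fix x assume x': "v \<le> x" "x \<le> u0"
      then have x: "x > 0" using v by simp
      have "(m x)\<^sup>2 * Q x \<le> 0"
        using R_mono[OF x x'(2)] False mm by (smt (verit) mult_nonneg_nonpos zero_le_power2)
      then have "m x * Q x \<le> 0" using m0[of x] by (cases "m x = 0") (auto simp: mult_le_0_iff)
      then show "\<exists>y. ((\<lambda>u. (m u)\<^sup>2) has_real_derivative y) (at x) \<and> y \<le> 0"
        using dm[OF x] sgn(2)[OF x] by (intro exI[of _ "2 * m x * G1 x"]) (simp add: mult.assoc mult.commute[of "G1 x"])
    qed
    then have Gv: "G v \<ge> G u0" if "0 < v" "v \<le> u0" for v using that by (intro G_ge) auto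
    have G1_le: "G1 v \<le> - \<delta> * v powr (- a - 2)" if v: "0 < v" "v \<le> u0" for v
    proof -
      have "Q v \<le> - \<delta>" unfolding \<delta>_def using v Gv by (simp, intro Q_le) auto
      then have "Q v * (v powr (- a - 2) * exp v) \<le> - \<delta> * (v powr (- a - 2) * exp v)"
        by (rule mult_right_mono) simp
      then have "G1 v \<le> - \<delta> * (v powr (- a - 2) * exp v)" using v by (simp only: G1_Q)
      also have "\<dots> \<le> - \<delta> * (v powr (- a - 2) * 1)"
        using d v by (intro mult_left_mono_neg mult_left_mono) auto
      finally show ?thesis by simp
    qed
    \<comment> \<open>Mean value theorem on [v/2, v]: a slope of order v^(-a-2) over a length v/2
      has to fit below C/(v/2) + C/v = 3C/v. As a > 0, this fails when v is close to 0.\<close>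
    have le: "v powr (- a) \<le> 6 * C / \<delta>" if v: "0 < v" "v < min u0 1" for v
    proof -
      obtain z where z: "v / 2 < z" "z < v" "G v - G (v / 2) = (v - v / 2) * G1 z"
        using MVT2[of "v / 2" v G G1] G v by auto
      have "v powr (- a - 2) \<le> z powr (- a - 2)"
        using z v a by (intro powr_mono2') auto
      then have "\<delta> * v powr (- a - 2) \<le> \<delta> * z powr (- a - 2)" using d by (intro mult_left_mono) auto
      also have "\<dots> \<le> - G1 z" using G1_le[of z] z v by auto
      finally have "(v / 2) * (\<delta> * v powr (- a - 2)) \<le> (v / 2) * (- G1 z)" using v by (intro mult_left_mono) auto
      also have "\<dots> = G (v / 2) - G v" using z(3) by simp
      also have "\<dots> \<le> \<bar>G (v / 2)\<bar> + \<bar>G v\<bar>" by simp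
      also have "\<dots> \<le> C / (v / 2) + C / v" using v by (intro add_mono near_0) auto
      finally have "(v / 2) * (\<delta> * v powr (- a - 2)) \<le> 3 * C / v" by simp
      then have "(2 * v) * ((v / 2) * (\<delta> * v powr (- a - 2))) \<le> (2 * v) * (3 * C / v)"
        using v by (intro mult_left_mono) auto
      moreover have "v powr (- a) = v powr (- a - 2) * v\<^sup>2"
        using v by (simp add: powr_diff power2_eq_square powr_numeral)
      ultimately have "\<delta> * v powr (- a) \<le> 6 * C"
        using v by (simp add: power2_eq_square algebra_simps)
      then show ?thesis using d by (simp add: field_simps)
    qed
    have "filterlim (\<lambda>v. v powr (- a)) at_top (at_right 0)" using a by real_asymp
    then have "\<forall>\<^sub>F v in at_right 0. 6 * C / \<delta> < v powr (- a)"
      by (simp add: filterlim_at_top_dense)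
    moreover have "\<forall>\<^sub>F v in at_right 0. 0 < v \<and> v < min u0 1"
      using u0 by (auto simp: eventually_at_right intro!: exI[of _ "min u0 1"])
    ultimately have "\<forall>\<^sub>F v in at_right 0. 6 * C / \<delta> < v powr (- a) \<and> 0 < v \<and> v < min u0 1"
      by (rule eventually_conj)
    from eventually_happens'[OF _ this]
    obtain v where "6 * C / \<delta> < v powr (- a)" "0 < v" "v < min u0 1" by auto
    with le[of v] show False by simp
  qed
qed

section \<open>Tails of the gamma weight and the solution of its Stein equation\<close>

definition gamma_weight :: "real \<Rightarrow> real \<Rightarrow> real" where
  "gamma_weight a v = (if 0 < v then v powr (a - 1) * exp (- v) else 0)"

lemma measurable_gamma_weight [measurable]: "gamma_weight a \<in> borel_measurable borel"
  unfolding gamma_weight_def [abs_def] by measurable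

lemma gamma_weight_nonneg: "0 \<le> gamma_weight a v"
  by (simp add: gamma_weight_def)

lemma has_bochner_integral_gamma_weight:
  assumes a: "a > 0"
  shows "integrable lborel (gamma_weight a)" "(\<integral>v. gamma_weight a v \<partial>lborel) = Gamma a"
proof -
  have "((\<lambda>t. t powr (a - 1) / exp t) has_integral Gamma a) {0..}"
    using Gamma_integral_real[OF a] .
  then have "(gamma_weight a has_integral Gamma a) {0..}"
    by (rule has_integral_spike[of "{0}", rotated 2]) (auto simp: gamma_weight_def exp_minus divide_inverse)
  then have "(\<integral>\<^sup>+v. ennreal (indicator {0..} v * gamma_weight a v) \<partial>lborel) = ennreal (Gamma a)"
    by (intro nn_integral_has_integral_lebesgue) (auto simp: gamma_weight_nonneg)
  moreover have "indicator {0..} v * gamma_weight a v = gamma_weight a v" for v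
    by (auto simp: gamma_weight_def indicator_def)
  ultimately have nn: "(\<integral>\<^sup>+v. ennreal (gamma_weight a v) \<partial>lborel) = ennreal (Gamma a)" by simp
  show "integrable lborel (gamma_weight a)"
    by (rule integrableI_nn_integral_finite[OF _ _ nn]) (auto simp: gamma_weight_nonneg)
  have "(\<integral>v. gamma_weight a v \<partial>lborel) = enn2real (\<integral>\<^sup>+v. ennreal (gamma_weight a v) \<partial>lborel)"
    by (rule integral_eq_nn_integral) (auto simp: gamma_weight_nonneg)
  then show "(\<integral>v. gamma_weight a v \<partial>lborel) = Gamma a"
    unfolding nn using Gamma_real_pos[OF a] by simp
qed

lemma gamma_weight_lower:
  assumes a: "a > 0" and u: "u > 0"
  shows "(LINT v:{..u}|lborel. gamma_weight a v) \<le> u powr a / a"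
proof -
  have si: "set_integrable lborel {0..u} (gamma_weight a)"
    unfolding set_integrable_def
    by (rule integrable_mult_indicator) (use has_bochner_integral_gamma_weight[OF a] in auto)
  have pw: "((\<lambda>x. x powr (a - 1)) has_integral (u powr (a - 1 + 1) / (a - 1 + 1))) {0..u}"
    using a u by (intro has_integral_powr_from_0) auto
  have "(LINT v:{..u}|lborel. gamma_weight a v) = (LINT v:{0..u}|lborel. gamma_weight a v)"
    unfolding set_lebesgue_integral_def
    by (intro Bochner_Integration.integral_cong) (auto simp: gamma_weight_def indicator_def)
  also have "\<dots> = integral {0..u} (gamma_weight a)"
    by (rule set_borel_integral_eq_integral[OF si])
  also have "\<dots> \<le> integral {0..u} (\<lambda>x. x powr (a - 1))"
    using set_borel_integral_eq_integral(1)[OF si] pw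
    by (intro integral_le) (auto simp: gamma_weight_def intro!: mult_left_le)
  also have "\<dots> = u powr a / a" using integral_unique[OF pw] by simp
  finally show ?thesis .
qed

text \<open>The power of v is absorbed by exp(-v/4). The loss is harmless: after multiplication by
  e^u the Stein solution is of order e^(u/4), within the growth e^(u/2) that
  \<open>laguerre_max_principle\<close> admits.\<close>

lemma gamma_weight_upper:
  assumes a: "a > 0"
  obtains C where "0 \<le> C" "\<And>u. u \<ge> 1 \<Longrightarrow> (LINT v:{u<..}|lborel. gamma_weight a v) \<le> C * exp (- (3 / 4) * u)"
proof -
  have "((\<lambda>v. v powr (a - 1) * exp (- (1 / 4) * v)) \<longlongrightarrow> 0) at_top" by real_asymp
  then have "\<forall>\<^sub>F v in at_top. v powr (a - 1) * exp (- (1 / 4) * v) < 1"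
    by (rule order_tendstoD) simp
  then obtain N where N: "\<And>v. v \<ge> N \<Longrightarrow> v powr (a - 1) * exp (- (1 / 4) * v) < 1"
    by (auto simp: eventually_at_top_linorder)
  have "compact ((\<lambda>v. v powr (a - 1) * exp (- (1 / 4) * v)) ` {1..max 1 N})"
    by (intro compact_continuous_image continuous_intros) auto
  from compact_imp_bounded[OF this] obtain B
    where "\<forall>y\<in>(\<lambda>v. v powr (a - 1) * exp (- (1 / 4) * v)) ` {1..max 1 N}. norm y \<le> B"
    unfolding bounded_iff by blast
  then have B: "\<bar>v powr (a - 1) * exp (- (1 / 4) * v)\<bar> \<le> B" if "v \<in> {1..max 1 N}" for v
    using that unfolding real_norm_def by blast
  define C where "C = max 1 B"
  have C: "v powr (a - 1) * exp (- (1 / 4) * v) \<le> C" if "v \<ge> 1" for v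
  proof (cases "v \<ge> N")
    case True
    then show ?thesis using N[of v] by (simp add: C_def)
  next
    case False
    then have "\<bar>v powr (a - 1) * exp (- (1 / 4) * v)\<bar> \<le> B" using that by (intro B) auto
    then have "v powr (a - 1) * exp (- (1 / 4) * v) \<le> B" by (rule order_trans[OF abs_ge_self])
    then show ?thesis unfolding C_def by (rule order_trans) simp
  qed
  have C1: "C \<ge> 1" by (simp add: C_def)
  have le: "gamma_weight a v \<le> C * exp (- (3 / 4) * v)" if "v \<ge> 1" for v
  proof -
    have "exp (- v) = exp (- (1 / 4) * v) * exp (- (3 / 4) * v)" by (simp add: exp_add[symmetric])
    then have "gamma_weight a v = (v powr (a - 1) * exp (- (1 / 4) * v)) * exp (- (3 / 4) * v)"
      using that by (simp add: gamma_weight_def)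
    also have "\<dots> \<le> C * exp (- (3 / 4) * v)" using C[OF that] by (intro mult_right_mono) auto
    finally show ?thesis .
  qed
  show thesis
  proof (rule that[of "C * (4 / 3)"])
    show "0 \<le> C * (4 / 3)" using C1 by simp
    fix u :: real assume u: "u \<ge> 1"
    have "(\<integral>\<^sup>+v\<in>{u..}. ennreal (C * exp (- (3 / 4) * v)) \<partial>lborel) = ennreal (0 - (- (C * (4 / 3) * exp (- (3 / 4) * u))))"
    proof (rule nn_integral_FTC_atLeast)
      show "((\<lambda>v. - (C * (4 / 3) * exp (- (3 / 4) * v))) has_real_derivative C * exp (- (3 / 4) * v)) (at v)" for v
        by (auto intro!: derivative_eq_intros)
      show "((\<lambda>v. - (C * (4 / 3) * exp (- (3 / 4) * v))) \<longlongrightarrow> 0) at_top"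
        by real_asymp
    qed (use C1 in auto)
    moreover have "ennreal (gamma_weight a v * indicator {u<..} v) \<le> ennreal (C * exp (- (3 / 4) * v)) * indicator {u..} v" for v
      using le[of v] u by (auto simp: indicator_def intro!: ennreal_leI)
    ultimately have nn: "(\<integral>\<^sup>+v. ennreal (gamma_weight a v * indicator {u<..} v) \<partial>lborel) \<le> ennreal (C * (4 / 3) * exp (- (3 / 4) * u))"
      by (metis (no_types, lifting) nn_integral_mono diff_0 minus_minus)
    have "(LINT v:{u<..}|lborel. gamma_weight a v) = enn2real (\<integral>\<^sup>+v. ennreal (gamma_weight a v * indicator {u<..} v) \<partial>lborel)"
      unfolding set_lebesgue_integral_def
      by (subst integral_eq_nn_integral) (auto simp: gamma_weight_nonneg mult.commute)
    also have "\<dots> \<le> C * (4 / 3) * exp (- (3 / 4) * u)"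
      using nn C1 by (intro enn2real_leI) auto
    finally show "(LINT v:{u<..}|lborel. gamma_weight a v) \<le> C * (4 / 3) * exp (- (3 / 4) * u)" .
  qed
qed

text \<open>The integrating factor u^a e^(-u) yields an explicit solution \<open>F\<close>, but
  bounding its derivative \<open>G\<close> directly is delicate. Explicit estimates give only the
  crude growth of \<open>G\<close> at 0 and at infinity; the maximum principle, applied to
  \<open>G\<close> and to -G, turns this into |G| \<le> 1.\<close>

lemma gamma_stein_solution:
  fixes H H' H'' :: "real \<Rightarrow> real"
  assumes a: "a > 0"
    and H: "\<And>u. (H has_real_derivative H' u) (at u)" "\<And>u. (H' has_real_derivative H'' u) (at u)"
    and b: "\<And>u. \<bar>H u\<bar> \<le> 1" "\<And>u. \<bar>H'' u\<bar> \<le> 2"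
    and mean: "(\<integral>v. H v * gamma_weight a v \<partial>lborel) = 0"
  obtains F G where "\<And>u. u > 0 \<Longrightarrow> (F has_real_derivative G u) (at u)" "continuous_on {0<..} G"
    "\<And>u. u > 0 \<Longrightarrow> \<bar>G u\<bar> \<le> 1" "\<And>u. u > 0 \<Longrightarrow> u * G u + (a - u) * F u = H u"
proof -
  define K where "K v = H v * gamma_weight a v" for v
  define J where "J u = (LINT v:{..u}|lborel. K v)" for u
  define F where "F u = u powr (- a) * exp u * J u" for u
  define G where "G u = (H u - (a - u) * F u) / u" for u
  \<comment> \<open>Obtained by differentiating u G + (a - u) F = H and solving for G'.\<close>
  define G1 where "G1 u = (H' u + F u - (a + 1 - u) * G u) / u" for u
  have Hc: "continuous_on A H" for A
    by (rule continuous_on_subset[OF DERIV_continuous_on[OF H(1)] subset_UNIV])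
  note [measurable] = borel_measurable_DERIV[OF H(1)]
  note wi = has_bochner_integral_gamma_weight(1)[OF a]
  have Kw: "\<bar>K v\<bar> \<le> gamma_weight a v" for v
    using b(1)[of v] gamma_weight_nonneg[of a v] by (simp add: K_def abs_mult mult_left_le_one_le)
  have Ki: "integrable lborel K"
    unfolding K_def by (rule integrable_bounded_mult[OF wi _ b(1)]) measurable
  note abs_le = abs_set_integral_le[OF Ki wi Kw]
  have dJ: "(J has_real_derivative H u * (u powr (a - 1) * exp (- u))) (at u)" if u: "u > 0" for u
  proof -
    have "continuous_on {0<..} (\<lambda>v. H v * (v powr (a - 1) * exp (- v)))"
      by (intro continuous_intros Hc) auto
    then have "continuous_on {0<..} K"
      by (rule continuous_on_eq) (auto simp: K_def gamma_weight_def)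
    then have "(J has_real_derivative K u) (at u)"
      unfolding J_def by (intro has_real_derivative_cumulative[OF Ki, of "{0<..}"]) (use u in auto)
    then show ?thesis using u by (simp add: K_def gamma_weight_def)
  qed
  have dF: "(F has_real_derivative G u) (at u)" if u: "u > 0" for u
  proof -
    have dp: "((\<lambda>u. u powr (- a)) has_real_derivative (- a) * u powr (- a - 1)) (at u)"
      using u by (rule has_real_derivative_powr)
    have p: "u powr (- a - 1) = u powr (- a) / u" "u powr (a - 1) = u powr a / u" "u powr a = 1 / u powr (- a)"
      using u by (simp_all add: powr_diff powr_minus field_simps)
    have "(F has_real_derivative ((- a) * u powr (- a - 1) * exp u + exp u * u powr (- a)) * J u
        + H u * (u powr (a - 1) * exp (- u)) * (u powr (- a) * exp u)) (at u)"
      unfolding F_def by (intro DERIV_mult dJ[OF u] dp DERIV_exp)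
    also have "((- a) * u powr (- a - 1) * exp u + exp u * u powr (- a)) * J u
        + H u * (u powr (a - 1) * exp (- u)) * (u powr (- a) * exp u) = G u"
    proof -
      have "u powr (a - 1) * u powr (- a) = 1 / u" using u unfolding p(2,3) by simp
      moreover have "exp (- u) * exp u = 1" by (simp add: exp_add[symmetric])
      ultimately have "H u * (u powr (a - 1) * exp (- u)) * (u powr (- a) * exp u) = H u / u"
        by (metis (no_types, opaque_lifting) mult.assoc mult.commute mult_1_right divide_inverse mult_1)
      moreover have "((- a) * u powr (- a - 1) * exp u + exp u * u powr (- a)) * J u = - ((a - u) * F u) / u"
        using u unfolding p(1) F_def by (simp add: field_simps)
      ultimately show ?thesis unfolding G_def by (simp add: diff_divide_distrib)
    qed
    finally show ?thesis .
  qed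
  have dG: "(G has_real_derivative G1 u) (at u)" if u: "u > 0" for u
  proof -
    have "((\<lambda>u. H u - (a - u) * F u) has_real_derivative H' u - ((0 - 1) * F u + G u * (a - u))) (at u)"
      by (intro DERIV_diff DERIV_mult H dF[OF u] DERIV_const DERIV_ident)
    then have "(G has_real_derivative ((H' u - ((0 - 1) * F u + G u * (a - u))) * u - (H u - (a - u) * F u) * 1) / (u * u)) (at u)"
      unfolding G_def by (intro DERIV_divide DERIV_ident) (use u in auto)
    also have "H u - (a - u) * F u = G u * u" using u by (simp add: G_def)
    also have "((H' u - ((0 - 1) * F u + G u * (a - u))) * u - G u * u * 1) / (u * u) = G1 u"
      using u by (simp add: G1_def field_simps)
    finally show ?thesis .
  qed
  \<comment> \<open>Differentiating the equation twice gives u G'' + (a + 2 - u) G' - 2 G = H''; the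
    integrating factor u^(a+1) e^(-u) brings it into divergence form.\<close>
  have dq: "((\<lambda>u. u powr (a + 2) * exp (- u) * G1 u) has_real_derivative
      u powr (a + 1) * exp (- u) * (H'' u + 2 * G u)) (at u)" if u: "u > 0" for u
  proof -
    have dp: "((\<lambda>u. u powr (a + 1)) has_real_derivative (a + 1) * u powr (a + 1 - 1)) (at u)"
      using u by (rule has_real_derivative_powr)
    have de: "((\<lambda>u. exp (- u)) has_real_derivative - exp (- u)) (at u)"
      by (auto intro!: derivative_eq_intros)
    have p: "u powr (a + 1 - 1) = u powr (a + 1) / u" using u by (simp add: powr_diff powr_add)
    let ?E = "\<lambda>u. H' u + F u - (a + 1 - u) * G u"
    have "(?E has_real_derivative H'' u + G u - ((0 - 1) * G u + G1 u * (a + 1 - u))) (at u)"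
      by (intro DERIV_diff DERIV_add DERIV_mult H dF[OF u] dG[OF u] DERIV_const DERIV_ident)
    then have "((\<lambda>u. u powr (a + 1) * exp (- u) * ?E u) has_real_derivative
        ((a + 1) * u powr (a + 1 - 1) * exp (- u) + - exp (- u) * u powr (a + 1)) * ?E u
        + (H'' u + G u - ((0 - 1) * G u + G1 u * (a + 1 - u))) * (u powr (a + 1) * exp (- u))) (at u)"
      by (intro DERIV_mult dp de)
    also have "?E u = G1 u * u" using u by (simp add: G1_def)
    also have "((a + 1) * u powr (a + 1 - 1) * exp (- u) + - exp (- u) * u powr (a + 1)) * (G1 u * u)
        + (H'' u + G u - ((0 - 1) * G u + G1 u * (a + 1 - u))) * (u powr (a + 1) * exp (- u))
        = u powr (a + 1) * exp (- u) * (H'' u + 2 * G u)"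
      using u unfolding p by (simp add: field_simps)
    finally show ?thesis
    proof (rule has_field_derivative_transform_within_open[of _ _ _ "{0<..}"])
      fix v :: real assume "v \<in> {0<..}"
      then have "v powr (a + 2) = v powr (a + 1) * v" "G1 v * v = ?E v"
        by (auto simp: G1_def powr_mult_base[symmetric] powr_add powr_numeral power2_eq_square)
      then show "v powr (a + 1) * exp (- v) * ?E v = v powr (a + 2) * exp (- v) * G1 v"
        by (simp add: mult.assoc mult.left_commute mult.commute)
    qed (use u in auto)
  qed
  have F_0: "\<bar>F u\<bar> \<le> exp u / a" if u: "u > 0" for u
  proof -
    have "\<bar>J u\<bar> \<le> u powr a / a"
      unfolding J_def using abs_le[of "{..u}"] gamma_weight_lower[OF a u] by simp
    then have "u powr (- a) * exp u * \<bar>J u\<bar> \<le> u powr (- a) * exp u * (u powr a / a)"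
      by (intro mult_left_mono) auto
    also have "\<dots> = (u powr (- a) * u powr a) * exp u / a" by simp
    also have "u powr (- a) * u powr a = 1" using u by (simp add: powr_add[symmetric])
    finally show ?thesis by (simp add: F_def abs_mult)
  qed
  obtain C where C: "0 \<le> C" "\<And>u. u \<ge> 1 \<Longrightarrow> (LINT v:{u<..}|lborel. gamma_weight a v) \<le> C * exp (- (3 / 4) * u)"
    using gamma_weight_upper[OF a] by metis
  have F_inf: "\<bar>F u\<bar> \<le> C * exp (u / 4)" if u: "u \<ge> 1" for u
  proof -
    \<comment> \<open>Mean zero exchanges the lower integral for the upper tail, whose decay has to
      beat the factor e^u in \<open>F\<close>.\<close>
    have "J u = - (LINT v:{u<..}|lborel. K v)"
      using set_integral_atMost_greaterThan[OF Ki, of u] mean by (simp add: J_def K_def)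
    then have "\<bar>J u\<bar> \<le> C * exp (- (3 / 4) * u)"
      using abs_le[of "{u<..}"] C(2)[OF u] by simp
    then have "u powr (- a) * exp u * \<bar>J u\<bar> \<le> 1 * exp u * (C * exp (- (3 / 4) * u))"
      using u a C(1) powr_mono[of "- a" 0 u] by (intro mult_mono) auto
    also have "\<dots> = C * exp (u / 4)" by (simp add: exp_add[symmetric])
    finally show ?thesis by (simp add: F_def abs_mult)
  qed
  \<comment> \<open>The larger of the constants at the two ends. Near 0, \<open>F\<close> is at most
    e / a; for u \<ge> 1 it is at most C e^(u/4), and |a - u| \<le> (a + 1) u is compensated by the
    division by u in \<open>G\<close>.\<close>
  define B where "B = max (1 + (a + 1) * (exp 1 / a)) (1 + (a + 1) * C)"
  have near_0: "\<bar>G u\<bar> \<le> B / u" if u: "0 < u" "u \<le> 1" for u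
  proof -
    have "\<bar>F u\<bar> \<le> exp 1 / a" 
      by (rule order_trans[OF F_0[OF u(1)]]) (use u a in \<open>simp add: divide_right_mono\<close>)
    then have "\<bar>a - u\<bar> * \<bar>F u\<bar> \<le> (a + 1) * (exp 1 / a)"
      using u a by (intro mult_mono) auto
    then have "\<bar>H u - (a - u) * F u\<bar> \<le> 1 + (a + 1) * (exp 1 / a)"
      using b(1)[of u] abs_triangle_ineq4[of "H u" "(a - u) * F u"]
      unfolding abs_mult by linarith
    also have "\<dots> \<le> B" by (simp add: B_def)
    finally show ?thesis unfolding G_def abs_divide using u by (simp add: divide_right_mono)
  qed
  have near_inf: "\<bar>G u\<bar> \<le> B * exp (u / 2)" if u: "1 \<le> u" for u
  proof -
    have "\<bar>a - u\<bar> \<le> (a + 1) * u"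
    proof -
      have au: "a * 1 \<le> a * u" using u a by (intro mult_left_mono) auto
      have "(a + 1) * u = a * u + u" by (simp add: distrib_right)
      then show ?thesis unfolding abs_le_iff using au u a by linarith
    qed
    then have "\<bar>a - u\<bar> * \<bar>F u\<bar> \<le> ((a + 1) * u) * (C * exp (u / 4))"
      using F_inf[OF u] u a by (intro mult_mono) auto
    then have "\<bar>H u - (a - u) * F u\<bar> \<le> 1 + ((a + 1) * u) * (C * exp (u / 4))"
      using b(1)[of u] abs_triangle_ineq4[of "H u" "(a - u) * F u"]
      unfolding abs_mult by linarith
    also have "\<dots> \<le> u * exp (u / 4) + ((a + 1) * u) * (C * exp (u / 4))"
    proof -
      have "1 * 1 \<le> u * exp (u / 4)" using u by (intro mult_mono) auto
      then show ?thesis by simp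
    qed
    also have "\<dots> = u * ((1 + (a + 1) * C) * exp (u / 4))" by (simp add: algebra_simps)
    also have "\<dots> \<le> u * (B * exp (u / 2))"
      using u by (intro mult_left_mono mult_mono) (auto simp: B_def a C(1) less_imp_le max_def add_nonneg_nonneg)
    finally have "\<bar>H u - (a - u) * F u\<bar> / u \<le> B * exp (u / 2)" using u by (simp add: field_simps)
    then show ?thesis unfolding G_def abs_divide using u by simp
  qed
  have up: "G u \<le> 1" if "u > 0" for u
    by (rule laguerre_max_principle[OF a dG dq b(2) near_0 near_inf that])
  \<comment> \<open>The equation is linear, so -G solves it with source -H'', which obeys the same
    bound.\<close>
  have dn: "- G u \<le> 1" if "u > 0" for u
  proof (rule laguerre_max_principle[OF a, of "\<lambda>u. - G u" "\<lambda>u. - G1 u" "\<lambda>u. - H'' u"])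
    fix u :: real assume u: "u > 0"
    show "((\<lambda>u. - G u) has_real_derivative - G1 u) (at u)" by (rule DERIV_minus[OF dG[OF u]])
    show "((\<lambda>u. u powr (a + 2) * exp (- u) * - G1 u) has_real_derivative
        u powr (a + 1) * exp (- u) * (- H'' u + 2 * - G u)) (at u)"
      using DERIV_minus[OF dq[OF u]] by (simp add: algebra_simps)
  qed (use b near_0 near_inf that in auto)
  show thesis
  proof
    show "(F has_real_derivative G u) (at u)" if "u > 0" for u by (rule dF[OF that])
    show "continuous_on {0<..} G"
      using dG by (intro continuous_at_imp_continuous_on) (auto intro: DERIV_isCont)
    show "\<bar>G u\<bar> \<le> 1" if "u > 0" for u using up[OF that] dn[OF that] by (simp add: abs_le_iff)
    show "u * G u + (a - u) * F u = H u" if "u > 0" for u using that by (simp add: G_def)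
  qed
qed

section \<open>Transfer to the centered gamma law\<close>

lemma gamma_density_eq: "gamma_density a x = gamma_weight a x / Gamma a"
  by (simp add: gamma_density_def gamma_weight_def)

lemma integral_centered_gamma_law:
  fixes h :: "real \<Rightarrow> real"
  assumes \<nu>: "\<nu> > 0" and [measurable]: "h \<in> borel_measurable borel"
  shows "(\<integral>x. h x \<partial>centered_gamma_law \<nu>)
    = (\<integral>u. h (2 * u - \<nu>) * gamma_weight (\<nu> / 2) u \<partial>lborel) / Gamma (\<nu> / 2)"
proof -
  have G: "Gamma (\<nu> / 2) > 0" using \<nu> by (intro Gamma_real_pos) auto
  have [measurable]: "gamma_density (\<nu> / 2) \<in> borel_measurable borel"
    unfolding gamma_density_eq[abs_def] by measurable
  have "(\<integral>x. h x \<partial>centered_gamma_law \<nu>) = (\<integral>u. h (2 * u - \<nu>) \<partial>density lborel (gamma_density (\<nu> / 2)))"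
    unfolding centered_gamma_law_def by (rule integral_distr) auto
  also have "\<dots> = (\<integral>u. gamma_density (\<nu> / 2) u *\<^sub>R h (2 * u - \<nu>) \<partial>lborel)"
    using G by (intro integral_density) (auto simp: gamma_density_eq gamma_weight_nonneg)
  also have "\<dots> = (\<integral>u. h (2 * u - \<nu>) * gamma_weight (\<nu> / 2) u / Gamma (\<nu> / 2) \<partial>lborel)"
    by (intro Bochner_Integration.integral_cong) (auto simp: gamma_density_eq)
  also have "\<dots> = (\<integral>u. h (2 * u - \<nu>) * gamma_weight (\<nu> / 2) u \<partial>lborel) / Gamma (\<nu> / 2)"
    by simp
  finally show ?thesis .
qed

lemma borel_measurable_C2b_unit: "h \<in> C2b_unit \<Longrightarrow> h \<in> borel_measurable borel"
  unfolding C2b_unit_def using borel_measurable_DERIV by blast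

text \<open>Affine change of variable x = 2u - \<nu> with a = \<nu>/2 and f(x) = F(u). The bound on
  f' goes through the second derivative of \<open>h\<close>, which is what membership in
  \<open>C2b_unit\<close> controls.\<close>

lemma centered_gamma_stein_solution:
  assumes \<nu>: "\<nu> > 0" and h: "h \<in> C2b_unit"
  obtains f f' where "\<And>x. x > - \<nu> \<Longrightarrow> (f has_real_derivative f' x) (at x)" "continuous_on {- \<nu><..} f'"
    "\<And>x. x > - \<nu> \<Longrightarrow> \<bar>f' x\<bar> \<le> 1"
    "\<And>x. x > - \<nu> \<Longrightarrow> 2 * (x + \<nu>) * f' x - x * f x = h x - (\<integral>x. h x \<partial>centered_gamma_law \<nu>)"
proof -
  obtain h' h'' where h1: "\<And>x. (h has_real_derivative h' x) (at x)" and h2: "\<And>x. (h' has_real_derivative h'' x) (at x)"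
    and b: "\<And>x. \<bar>h x\<bar> \<le> 1" "\<And>x. \<bar>h'' x\<bar> \<le> 1"
    using h unfolding C2b_unit_def by blast
  define a where "a = \<nu> / 2"
  have a: "a > 0" using \<nu> by (simp add: a_def)
  define c where "c = (\<integral>x. h x \<partial>centered_gamma_law \<nu>)"
  \<comment> \<open>In the variable x the left side of Stein's equation doubles, which accounts for
    the 1/2. It also gives |H| \<le> 1 from |h - c| \<le> 2, and a second derivative 2 h'' within
    the bound 2 of the maximum principle.\<close>
  define H where "H u = (h (2 * u - \<nu>) - c) / 2" for u
  note [measurable] = borel_measurable_DERIV[OF h1]
  have Gm: "Gamma a > 0" by (rule Gamma_real_pos[OF a])
  note w = has_bochner_integral_gamma_weight[OF a]
  have hw: "integrable lborel (\<lambda>u. h (2 * u - \<nu>) * gamma_weight a u)"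
    by (rule integrable_bounded_mult[OF w(1) _ b(1)]) measurable
  have c_eq: "c = (\<integral>u. h (2 * u - \<nu>) * gamma_weight a u \<partial>lborel) / Gamma a"
    unfolding c_def a_def by (rule integral_centered_gamma_law[OF \<nu>]) simp
  have c1: "\<bar>c\<bar> \<le> 1"
  proof -
    have "\<bar>\<integral>u. h (2 * u - \<nu>) * gamma_weight a u \<partial>lborel\<bar> \<le> (\<integral>u. \<bar>h (2 * u - \<nu>) * gamma_weight a u\<bar> \<partial>lborel)"
      by (rule integral_abs_bound)
    also have "\<dots> \<le> (\<integral>u. gamma_weight a u \<partial>lborel)"
    proof (rule integral_mono[OF integrable_abs[OF hw] w(1)])
      show "\<bar>h (2 * u - \<nu>) * gamma_weight a u\<bar> \<le> gamma_weight a u" for u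
        by (auto simp: abs_mult b gamma_weight_nonneg intro!: mult_left_le_one_le)
    qed
    finally show ?thesis using Gm by (simp add: c_eq w(2) abs_divide)
  qed
  have dlin: "((\<lambda>u. 2 * u - \<nu>) has_real_derivative 2) (at u)" for u
    by (auto intro!: derivative_eq_intros)
  obtain F G where F: "\<And>u. u > 0 \<Longrightarrow> (F has_real_derivative G u) (at u)" and G: "continuous_on {0<..} G"
    "\<And>u. u > 0 \<Longrightarrow> \<bar>G u\<bar> \<le> 1" and eq: "\<And>u. u > 0 \<Longrightarrow> u * G u + (a - u) * F u = H u"
  proof (rule gamma_stein_solution[OF a, of H "\<lambda>u. h' (2 * u - \<nu>)" "\<lambda>u. 2 * h'' (2 * u - \<nu>)"])
    show "(H has_real_derivative h' (2 * u - \<nu>)) (at u)" for u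
      unfolding H_def using DERIV_chain2[OF h1 dlin, of u] by (auto intro!: derivative_eq_intros)
    show "((\<lambda>u. h' (2 * u - \<nu>)) has_real_derivative 2 * h'' (2 * u - \<nu>)) (at u)" for u
      using DERIV_chain2[OF h2 dlin, of u] by (simp add: mult.commute)
    show "\<bar>H u\<bar> \<le> 1" for u using b(1)[of "2 * u - \<nu>"] c1 by (auto simp: H_def abs_le_iff)
    show "\<bar>2 * h'' (2 * u - \<nu>)\<bar> \<le> 2" for u using b(2)[of "2 * u - \<nu>"] by (simp add: abs_mult)
    have "(\<integral>v. H v * gamma_weight a v \<partial>lborel)
        = (\<integral>v. (h (2 * v - \<nu>) * gamma_weight a v - c * gamma_weight a v) / 2 \<partial>lborel)"
      by (intro Bochner_Integration.integral_cong) (auto simp: H_def algebra_simps)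
    also have "\<dots> = ((\<integral>u. h (2 * u - \<nu>) * gamma_weight a u \<partial>lborel) - c * Gamma a) / 2"
      using hw w by simp
    also have "\<dots> = 0" using Gm by (simp add: c_eq)
    finally show "(\<integral>v. H v * gamma_weight a v \<partial>lborel) = 0" .
  qed metis
  let ?u = "\<lambda>x. (x + \<nu>) / 2"
  show thesis
  proof (rule that[of "\<lambda>x. F (?u x)" "\<lambda>x. G (?u x) / 2"])
    fix x assume x: "x > - \<nu>"
    then have u: "?u x > 0" by simp
    have "((\<lambda>x. ?u x) has_real_derivative 1 / 2) (at x)" by (auto intro!: derivative_eq_intros)
    from DERIV_chain2[OF F[OF u] this] show "((\<lambda>x. F (?u x)) has_real_derivative G (?u x) / 2) (at x)" by simp
    show "\<bar>G (?u x) / 2\<bar> \<le> 1" using G(2)[OF u] by simp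
    have "2 * (x + \<nu>) * (G (?u x) / 2) - x * F (?u x) = 2 * (?u x * G (?u x) + (a - ?u x) * F (?u x))"
      by (simp add: a_def field_simps)
    also have "\<dots> = 2 * H (?u x)" by (simp only: eq[OF u])
    also have "\<dots> = h x - c"
    proof -
      have "2 * ?u x - \<nu> = x" by (simp add: field_simps)
      then show ?thesis unfolding H_def by simp
    qed
    finally show "2 * (x + \<nu>) * (G (?u x) / 2) - x * F (?u x) = h x - (\<integral>x. h x \<partial>centered_gamma_law \<nu>)"
      by (simp add: c_def)
  next
    show "continuous_on {- \<nu><..} (\<lambda>x. G (?u x) / 2)"
      by (intro continuous_intros continuous_on_compose2[OF G(1)]) auto
  qed
qed

section \<open>The gamma bound on the half line\<close>

context stein_kernel begin

text \<open>f' is controlled on the open half line only and may have no limit at \<open>b\<close>,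
  whereas \<open>by_parts\<close> asks for a C1 function on the whole line. Shifting inward by e n
  repairs this, and the limit is taken afterwards under domination.\<close>

lemma by_parts_half_line:
  assumes X: "AE \<omega> in M. b < X \<omega>" and b: "b < 0"
    and f: "\<And>x. x > b \<Longrightarrow> (f has_real_derivative f' x) (at x)" and f': "continuous_on {b<..} f'"
    and L: "\<And>x. x > b \<Longrightarrow> \<bar>f' x\<bar> \<le> 1"
  defines "f0 \<equiv> \<lambda>x. if b < x then f x else 0" and "g0 \<equiv> \<lambda>x. if b < x then f' x else 0"
  shows "f0 \<in> borel_measurable borel" "g0 \<in> borel_measurable borel"
    "integrable M (\<lambda>\<omega>. X \<omega> * f0 (X \<omega>))"
    "(\<integral>\<omega>. X \<omega> * f0 (X \<omega>) \<partial>M) = (\<integral>\<omega>. g0 (X \<omega>) * \<phi> (X \<omega>) \<partial>M)"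
proof -
  have fc: "continuous_on {b<..} f"
    using f by (intro continuous_at_imp_continuous_on) (auto intro: DERIV_isCont)
  have "(\<lambda>x. if x \<in> {b<..} then f x else 0) \<in> borel_measurable borel"
    by (rule borel_measurable_continuous_on_if) (auto intro: fc)
  then show [measurable]: "f0 \<in> borel_measurable borel" by (simp add: f0_def)
  have "(\<lambda>x. if x \<in> {b<..} then f' x else 0) \<in> borel_measurable borel"
    by (rule borel_measurable_continuous_on_if) (auto intro: f')
  then show [measurable]: "g0 \<in> borel_measurable borel" by (simp add: g0_def)
  define e where "e n = inverse (real (Suc n))" for n
  have e: "e n > 0" "e n \<le> 1" for n by (auto simp: e_def divide_simps)
  have elim: "e \<longlonglongrightarrow> 0" unfolding e_def by (rule LIMSEQ_inverse_real_of_nat)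
  \<comment> \<open>Moved inward by \<open>e n\<close> and frozen to the left of \<open>b\<close>,
    f' becomes bounded and continuous on the whole line.\<close>
  define g where "g n x = f' (max x b + e n)" for n x
  have gc: "continuous_on UNIV (g n)" for n
  proof -
    have "b < max x b + e n" for x using e(1)[of n] by (simp add: max_def)
    then show ?thesis
      unfolding g_def by (intro continuous_on_compose2[OF f'] continuous_intros) auto
  qed
  have g1: "\<bar>g n x\<bar> \<le> 1" for n x
    unfolding g_def by (rule L) (use e[of n] in \<open>auto simp: max_def\<close>)
  have ex: "\<exists>k. (\<forall>x. (k has_real_derivative g n x) (at x)) \<and> (\<forall>x>b. k x = f (x + e n))" for n
  proof -
    obtain H where H: "\<And>x. (H has_real_derivative g n x) (at x)"
      using einterval_antiderivative[of "-\<infinity>" "\<infinity>" "g n"] gc[of n]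
      unfolding has_real_derivative_iff_has_vector_derivative[symmetric]
      by (auto simp: continuous_on_eq_continuous_at)
    \<comment> \<open>A primitive is determined up to a constant. Fixing it so that
      \<open>k n\<close> is the shifted \<open>f\<close> on the half line makes the sequence
      converge.\<close>
    have "\<exists>c. \<forall>x\<in>{b<..}. H x - f (x + e n) = c"
    proof (rule has_field_derivative_zero_constant)
      show "convex {b<..}" by simp
      fix x assume "x \<in> {b<..}"
      then have x: "x > b" by simp
      have "((\<lambda>x. f (x + e n)) has_real_derivative f' (x + e n)) (at x)"
        using f[of "x + e n"] x e[of n] by (simp add: DERIV_shift)
      moreover have "g n x = f' (x + e n)" using x by (simp add: g_def)
      ultimately have "((\<lambda>x. H x - f (x + e n)) has_real_derivative 0) (at x)"
        using DERIV_diff[OF H[of x]] by fastforce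
      then show "((\<lambda>x. H x - f (x + e n)) has_real_derivative 0) (at x within {b<..})"
        by (rule has_field_derivative_at_within)
    qed
    then obtain c where c: "\<And>x. x > b \<Longrightarrow> H x - f (x + e n) = c" by auto
    have "((\<lambda>x. H x - c) has_real_derivative g n x) (at x)" for x
      using DERIV_diff[OF H DERIV_const] by simp
    moreover have "H x - c = f (x + e n)" if "x > b" for x using c[OF that] by simp
    ultimately show ?thesis by (intro exI[of _ "\<lambda>x. H x - c"]) auto
  qed
  obtain k where k: "\<And>n x. (k n has_real_derivative g n x) (at x)" "\<And>n x. x > b \<Longrightarrow> k n x = f (x + e n)"
    using ex by metis
  note [measurable] = borel_measurable_DERIV[OF k(1)] borel_measurable_continuous_onI[OF gc]
  have parts: "(\<integral>\<omega>. X \<omega> * k n (X \<omega>) \<partial>M) = (\<integral>\<omega>. g n (X \<omega>) * \<phi> (X \<omega>) \<partial>M)" for n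
    by (rule by_parts[OF k(1) gc g1])
  \<comment> \<open>Since \<open>k n 0\<close> is \<open>f (e n)\<close>, this anchors all
    \<open>k n\<close> at 0 uniformly in n; b < 0 places 0 inside the half line.\<close>
  have f_lip: "\<bar>f (e n)\<bar> \<le> \<bar>f 0\<bar> + 1" for n
  proof -
    obtain z where z: "0 < z" "f (e n) - f 0 = (e n - 0) * f' z"
      using MVT2[of 0 "e n" f f'] e[of n] f b by auto
    have "\<bar>e n * f' z\<bar> \<le> 1 * 1" unfolding abs_mult using e[of n] L[of z] z b by (intro mult_mono) auto
    then show ?thesis using z by simp
  qed
  have k_le: "\<bar>k n x\<bar> \<le> \<bar>f 0\<bar> + 1 + \<bar>x\<bar>" for n x
    using bounded_deriv_lipschitz[OF k(1) g1, of n x 0] k(2)[of 0 n] f_lip[of n] b by auto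
  have dom: "integrable M (\<lambda>\<omega>. \<bar>X \<omega>\<bar> * (\<bar>f 0\<bar> + 1 + \<bar>X \<omega>\<bar>))"
  proof -
    have "integrable M (\<lambda>\<omega>. (\<bar>f 0\<bar> + 1) * \<bar>X \<omega>\<bar> + (X \<omega>)\<^sup>2)"
      using X_int X_L2 by auto
    then show ?thesis by (simp add: algebra_simps power2_eq_square)
  qed
  have conv: "(\<lambda>n. k n x) \<longlonglongrightarrow> f0 x" "(\<lambda>n. g n x) \<longlonglongrightarrow> g0 x" if x: "x > b" for x
  proof -
    have xe: "(\<lambda>n. x + e n) \<longlonglongrightarrow> x" using tendsto_add[OF tendsto_const elim, of x] by simp
    have "isCont f x" using f[OF x] by (rule DERIV_isCont)
    from isCont_tendsto_compose[OF this xe] show "(\<lambda>n. k n x) \<longlonglongrightarrow> f0 x"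
      using x by (simp add: f0_def k(2))
    have "isCont f' x" using f' x by (auto simp: continuous_on_eq_continuous_at)
    from isCont_tendsto_compose[OF this xe] show "(\<lambda>n. g n x) \<longlonglongrightarrow> g0 x"
      using x by (simp add: g0_def g_def)
  qed
  have cX: "AE \<omega> in M. (\<lambda>n. X \<omega> * k n (X \<omega>)) \<longlonglongrightarrow> X \<omega> * f0 (X \<omega>)"
    using X by eventually_elim (intro tendsto_mult tendsto_const conv)
  have bX: "AE \<omega> in M. norm (X \<omega> * k n (X \<omega>)) \<le> \<bar>X \<omega>\<bar> * (\<bar>f 0\<bar> + 1 + \<bar>X \<omega>\<bar>)" for n
    by (intro AE_I2) (auto simp: abs_mult intro!: mult_left_mono k_le)
  show "integrable M (\<lambda>\<omega>. X \<omega> * f0 (X \<omega>))"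
    by (rule integrable_dominated_convergence[OF _ _ dom cX bX]) measurable
  have 1: "(\<lambda>n. \<integral>\<omega>. X \<omega> * k n (X \<omega>) \<partial>M) \<longlonglongrightarrow> (\<integral>\<omega>. X \<omega> * f0 (X \<omega>) \<partial>M)"
    by (rule integral_dominated_convergence[OF _ _ dom cX bX]) measurable
  have 2: "(\<lambda>n. \<integral>\<omega>. g n (X \<omega>) * \<phi> (X \<omega>) \<partial>M) \<longlonglongrightarrow> (\<integral>\<omega>. g0 (X \<omega>) * \<phi> (X \<omega>) \<partial>M)"
  proof (rule integral_dominated_convergence)
    show "integrable M (\<lambda>\<omega>. \<bar>\<phi> (X \<omega>)\<bar>)" using phi_int by simp
    show "AE \<omega> in M. (\<lambda>n. g n (X \<omega>) * \<phi> (X \<omega>)) \<longlonglongrightarrow> g0 (X \<omega>) * \<phi> (X \<omega>)"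
      using X by eventually_elim (intro tendsto_mult tendsto_const conv)
    show "AE \<omega> in M. norm (g n (X \<omega>) * \<phi> (X \<omega>)) \<le> \<bar>\<phi> (X \<omega>)\<bar>" for n
      by (intro AE_I2) (auto simp: abs_mult g1 intro!: mult_left_le_one_le)
  qed measurable
  show "(\<integral>\<omega>. X \<omega> * f0 (X \<omega>) \<partial>M) = (\<integral>\<omega>. g0 (X \<omega>) * \<phi> (X \<omega>) \<partial>M)"
    using 1 2 unfolding parts by (rule LIMSEQ_unique)
qed

text \<open>The argument of \<open>stein_bound\<close> with the constant kernel 1 of the normal law
  replaced by 2(x + \<nu>), the Stein kernel of the centered gamma law. Off the half line the
  solution is set to 0, which \<open>X\<close> does not see.\<close>

lemma centered_gamma_bound:
  assumes \<nu>: "\<nu> > 0" and X: "AE \<omega> in M. - \<nu> < X \<omega>" and h: "h \<in> C2b_unit"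
  shows "\<bar>(\<integral>\<omega>. h (X \<omega>) \<partial>M) - (\<integral>x. h x \<partial>centered_gamma_law \<nu>)\<bar> \<le> (\<integral>\<omega>. \<bar>2 * (X \<omega> + \<nu>) - \<phi> (X \<omega>)\<bar> \<partial>M)"
proof -
  obtain f f' where f: "\<And>x. x > - \<nu> \<Longrightarrow> (f has_real_derivative f' x) (at x)" "continuous_on {- \<nu><..} f'"
    "\<And>x. x > - \<nu> \<Longrightarrow> \<bar>f' x\<bar> \<le> 1"
    and eq: "\<And>x. x > - \<nu> \<Longrightarrow> 2 * (x + \<nu>) * f' x - x * f x = h x - (\<integral>x. h x \<partial>centered_gamma_law \<nu>)"
    using centered_gamma_stein_solution[OF \<nu> h] by metis
  define f0 where "f0 x = (if - \<nu> < x then f x else 0)" for x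
  define g0 where "g0 x = (if - \<nu> < x then f' x else 0)" for x
  note p = by_parts_half_line[OF X _ f, folded f0_def g0_def]
  have [measurable]: "f0 \<in> borel_measurable borel" "g0 \<in> borel_measurable borel"
    using p(1,2) \<nu> by (simp_all add: f0_def[abs_def] g0_def[abs_def])
  have Xf0: "integrable M (\<lambda>\<omega>. X \<omega> * f0 (X \<omega>))"
    and parts: "(\<integral>\<omega>. X \<omega> * f0 (X \<omega>) \<partial>M) = (\<integral>\<omega>. g0 (X \<omega>) * \<phi> (X \<omega>) \<partial>M)"
    using p(3,4) \<nu> by (simp_all add: f0_def g0_def)
  let ?c = "\<integral>x. h x \<partial>centered_gamma_law \<nu>"
  note [measurable] = borel_measurable_C2b_unit[OF h]
  have h1: "\<bar>h x\<bar> \<le> 1" for x using h unfolding C2b_unit_def by blast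
  have hi: "integrable M (\<lambda>\<omega>. h (X \<omega>))" by (rule integrable_const_bound[of _ 1]) (use h1 in auto)
  have g1: "\<bar>g0 x\<bar> \<le> 1" for x using f(3)[of x] by (simp add: g0_def)
  have bd: "integrable M (\<lambda>\<omega>. g0 (X \<omega>) * Y \<omega>)" if "integrable M Y" for Y
    by (rule integrable_bounded_mult[OF that _ g1]) measurable
  have i1: "integrable M (\<lambda>\<omega>. 2 * (X \<omega> + \<nu>))" using X_int by simp
  have i2: "integrable M (\<lambda>\<omega>. 2 * (X \<omega> + \<nu>) - \<phi> (X \<omega>))" using i1 phi_int by simp
  have "(\<integral>\<omega>. h (X \<omega>) \<partial>M) - ?c = (\<integral>\<omega>. h (X \<omega>) - ?c \<partial>M)"
    using hi prob_space by simp
  also have "\<dots> = (\<integral>\<omega>. g0 (X \<omega>) * (2 * (X \<omega> + \<nu>)) - X \<omega> * f0 (X \<omega>) \<partial>M)"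
  proof (rule integral_cong_AE)
    show "AE \<omega> in M. h (X \<omega>) - ?c = g0 (X \<omega>) * (2 * (X \<omega> + \<nu>)) - X \<omega> * f0 (X \<omega>)"
      using X
    proof eventually_elim
      case (elim \<omega>)
      then show ?case using eq[of "X \<omega>"] by (simp add: g0_def f0_def mult.commute)
    qed
  qed measurable
  also have "\<dots> = (\<integral>\<omega>. g0 (X \<omega>) * (2 * (X \<omega> + \<nu>)) \<partial>M) - (\<integral>\<omega>. g0 (X \<omega>) * \<phi> (X \<omega>) \<partial>M)"
    using bd[OF i1] Xf0 by (simp only: Bochner_Integration.integral_diff parts)
  also have "\<dots> = (\<integral>\<omega>. g0 (X \<omega>) * (2 * (X \<omega> + \<nu>)) - g0 (X \<omega>) * \<phi> (X \<omega>) \<partial>M)"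
    by (rule Bochner_Integration.integral_diff[OF bd[OF i1] bd[OF phi_int], symmetric])
  also have "\<dots> = (\<integral>\<omega>. g0 (X \<omega>) * (2 * (X \<omega> + \<nu>) - \<phi> (X \<omega>)) \<partial>M)"
    by (simp only: right_diff_distrib)
  finally have "\<bar>(\<integral>\<omega>. h (X \<omega>) \<partial>M) - ?c\<bar> \<le> (\<integral>\<omega>. \<bar>g0 (X \<omega>) * (2 * (X \<omega> + \<nu>) - \<phi> (X \<omega>))\<bar> \<partial>M)"
    using integral_abs_bound by metis
  also have "\<dots> \<le> (\<integral>\<omega>. \<bar>2 * (X \<omega> + \<nu>) - \<phi> (X \<omega>)\<bar> \<partial>M)"
  proof (rule integral_mono[OF integrable_abs[OF bd[OF i2]] integrable_abs[OF i2]])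
    show "\<bar>g0 (X \<omega>) * (2 * (X \<omega> + \<nu>) - \<phi> (X \<omega>))\<bar> \<le> \<bar>2 * (X \<omega> + \<nu>) - \<phi> (X \<omega>)\<bar>" for \<omega>
      unfolding abs_mult using g1 by (intro mult_left_le_one_le) auto
  qed
  finally show ?thesis .
qed

end

section \<open>From expectations to L2 norms, and the final assembly\<close>

lemma (in prob_space) nn_integral_abs_le_L2_norm:
  assumes [measurable]: "Y \<in> borel_measurable M"
  shows "(\<integral>\<^sup>+\<omega>. ennreal \<bar>Y \<omega>\<bar> \<partial>M) \<le> L2_norm M Y"
proof (cases "(\<integral>\<^sup>+\<omega>. ennreal ((Y \<omega>)\<^sup>2) \<partial>M) = \<infinity>")
  case True
  then show ?thesis by (simp add: L2_norm_def)
next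
  case False
  then have Y2: "integrable M (\<lambda>\<omega>. (Y \<omega>)\<^sup>2)"
    by (intro integrableI_bounded) (auto simp: less_top[symmetric])
  then have Y: "integrable M Y" using integrable_mult_L2[of "\<lambda>_. 1" M Y] by simp
  \<comment> \<open>Cauchy-Schwarz on a probability space, as Jensen's inequality for the
    square.\<close>
  have "(\<integral>\<omega>. \<bar>Y \<omega>\<bar> \<partial>M)\<^sup>2 \<le> (\<integral>\<omega>. \<bar>Y \<omega>\<bar>\<^sup>2 \<partial>M)"
    using jensens_inequality[where q="\<lambda>x. x\<^sup>2" and X="\<lambda>\<omega>. \<bar>Y \<omega>\<bar>" and I=UNIV] Y Y2 convex_power2 by auto
  then have "(\<integral>\<omega>. \<bar>Y \<omega>\<bar> \<partial>M) \<le> sqrt (\<integral>\<omega>. (Y \<omega>)\<^sup>2 \<partial>M)" by (simp add: real_le_rsqrt)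
  moreover have "(\<integral>\<^sup>+\<omega>. ennreal \<bar>Y \<omega>\<bar> \<partial>M) = ennreal (\<integral>\<omega>. \<bar>Y \<omega>\<bar> \<partial>M)"
    using Y by (intro nn_integral_eq_integral) auto
  moreover have "(\<integral>\<^sup>+\<omega>. ennreal ((Y \<omega>)\<^sup>2) \<partial>M) = ennreal (\<integral>\<omega>. (Y \<omega>)\<^sup>2 \<partial>M)"
    using Y2 by (intro nn_integral_eq_integral) auto
  ultimately show ?thesis by (simp add: L2_norm_def ennreal_leI)
qed

text \<open>The kernel identity for h x = x. It is the reason why the second moment of
  \<open>X\<close> stands for the mean of \<open>\<phi> (X \<omega>)\<close> in the right-hand
  bounds.\<close>

lemma (in stein_kernel) expectation_phi: "(\<integral>\<omega>. (X \<omega>)\<^sup>2 \<partial>M) = (\<integral>\<omega>. \<phi> (X \<omega>) \<partial>M)"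
  using by_parts[of "\<lambda>x. x" "\<lambda>_. 1" 1] by (simp add: power2_eq_square)

lemma (in stein_kernel) nn_integral_phi:
  assumes "integrable M Y"
  shows "(\<integral>\<^sup>+\<omega>. ennreal \<bar>Y \<omega> - \<phi> (X \<omega>)\<bar> \<partial>M) = ennreal (\<integral>\<omega>. \<bar>Y \<omega> - \<phi> (X \<omega>)\<bar> \<partial>M)"
  using assms phi_int by (intro nn_integral_eq_integral) auto

text \<open>Insertion of the mean of the kernel. Y = 1 serves the normal bounds and Y = 2(X + \<nu>)
  the gamma bound.\<close>

lemma (in stein_kernel) phi_triangle:
  assumes [measurable]: "Y \<in> borel_measurable M"
  shows "(\<integral>\<^sup>+\<omega>. ennreal \<bar>Y \<omega> - \<phi> (X \<omega>)\<bar> \<partial>M)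
    \<le> (\<integral>\<^sup>+\<omega>. ennreal \<bar>Y \<omega> - (\<integral>\<omega>. (X \<omega>)\<^sup>2 \<partial>M)\<bar> \<partial>M)
      + L2_norm M (\<lambda>\<omega>. \<phi> (X \<omega>) - (\<integral>\<omega>'. \<phi> (X \<omega>') \<partial>M))"
proof -
  let ?e = "\<integral>\<omega>. \<phi> (X \<omega>) \<partial>M"
  have "(\<integral>\<^sup>+\<omega>. ennreal \<bar>Y \<omega> - \<phi> (X \<omega>)\<bar> \<partial>M)
      \<le> (\<integral>\<^sup>+\<omega>. ennreal \<bar>Y \<omega> - ?e\<bar> + ennreal \<bar>\<phi> (X \<omega>) - ?e\<bar> \<partial>M)"
    by (intro nn_integral_mono) (auto simp: ennreal_plus[symmetric] simp del: ennreal_plus intro!: ennreal_leI)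
  also have "\<dots> = (\<integral>\<^sup>+\<omega>. ennreal \<bar>Y \<omega> - ?e\<bar> \<partial>M) + (\<integral>\<^sup>+\<omega>. ennreal \<bar>\<phi> (X \<omega>) - ?e\<bar> \<partial>M)"
    by (rule nn_integral_add) auto
  also have "(\<integral>\<^sup>+\<omega>. ennreal \<bar>\<phi> (X \<omega>) - ?e\<bar> \<partial>M) \<le> L2_norm M (\<lambda>\<omega>. \<phi> (X \<omega>) - ?e)"
    by (rule nn_integral_abs_le_L2_norm) measurable
  finally show ?thesis by (simp add: expectation_phi add_left_mono)
qed

theorem proposition3p1:
  fixes M :: "'a measure" and U :: "nat \<Rightarrow> 'a \<Rightarrow> real" and X :: "'a \<Rightarrow> real"
    and \<phi> :: "real \<Rightarrow> real"
  assumes "prob_space M"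
    and "uniform_iid M U"
    and "X \<in> gradient_domain M U"
    and "(\<integral>\<omega>. X \<omega> \<partial>M) = 0"
    and "is_phi M U X \<phi>"
  shows
    "(d_W (distr M borel X) std_normal_law \<le> (\<integral>\<^sup>+\<omega>. ennreal \<bar>1 - \<phi> (X \<omega>)\<bar> \<partial>M) \<and>
      (\<integral>\<^sup>+\<omega>. ennreal \<bar>1 - \<phi> (X \<omega>)\<bar> \<partial>M)
        \<le> ennreal \<bar>1 - (\<integral>\<omega>. (X \<omega>)\<^sup>2 \<partial>M)\<bar>
          + L2_norm M (\<lambda>\<omega>. \<phi> (X \<omega>) - (\<integral>\<omega>'. \<phi> (X \<omega>') \<partial>M))) \<and>
     (d_TV (distr M borel X) std_normal_law \<le> 2 * (\<integral>\<^sup>+\<omega>. ennreal \<bar>1 - \<phi> (X \<omega>)\<bar> \<partial>M) \<and>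
      2 * (\<integral>\<^sup>+\<omega>. ennreal \<bar>1 - \<phi> (X \<omega>)\<bar> \<partial>M)
        \<le> 2 * ennreal \<bar>1 - (\<integral>\<omega>. (X \<omega>)\<^sup>2 \<partial>M)\<bar>
          + 2 * L2_norm M (\<lambda>\<omega>. \<phi> (X \<omega>) - (\<integral>\<omega>'. \<phi> (X \<omega>') \<partial>M))) \<and>
     (\<forall>\<nu>>0. (AE \<omega> in M. - \<nu> < X \<omega>) \<longrightarrow>
       d_H (distr M borel X) (centered_gamma_law \<nu>)
         \<le> (\<integral>\<^sup>+\<omega>. ennreal \<bar>2 * (X \<omega> + \<nu>) - \<phi> (X \<omega>)\<bar> \<partial>M) \<and>
       (\<integral>\<^sup>+\<omega>. ennreal \<bar>2 * (X \<omega> + \<nu>) - \<phi> (X \<omega>)\<bar> \<partial>M)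
         \<le> L2_norm M (\<lambda>\<omega>. 2 * (X \<omega> + \<nu>) - (\<integral>\<omega>'. (X \<omega>')\<^sup>2 \<partial>M))
           + L2_norm M (\<lambda>\<omega>. \<phi> (X \<omega>) - (\<integral>\<omega>'. \<phi> (X \<omega>') \<partial>M)))"
proof -
  interpret uniform_sequence M U
    using assms(1,2) by (intro uniform_sequence.intro uniform_sequence_axioms.intro)
  interpret stein_kernel M X \<phi>
    by unfold_locales (fact stein_identity[OF assms(5,4)])+
  let ?E = "\<integral>\<^sup>+\<omega>. ennreal \<bar>1 - \<phi> (X \<omega>)\<bar> \<partial>M"
  let ?L = "L2_norm M (\<lambda>\<omega>. \<phi> (X \<omega>) - (\<integral>\<omega>'. \<phi> (X \<omega>') \<partial>M))"
  \<comment> \<open>The kernel is integrable, so this middle quantity is finite and the real-valued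
    bounds transfer to \<open>ennreal\<close>; only the L2 norms can be infinite.\<close>
  have E: "?E = ennreal (\<integral>\<omega>. \<bar>1 - \<phi> (X \<omega>)\<bar> \<partial>M)" by (rule nn_integral_phi) simp
  have W: "d_W (distr M borel X) std_normal_law \<le> ?E"
    unfolding d_W_def E
  proof (rule SUP_least)
    fix h :: "real \<Rightarrow> real" assume "h \<in> {h. 1-lipschitz_on UNIV h}"
    then have h: "1-lipschitz_on UNIV h" by simp
    have "h \<in> borel_measurable borel"
      by (rule borel_measurable_continuous_onI[OF lipschitz_on_continuous_on[OF h]])
    then have "(\<integral>x. h x \<partial>distr M borel X) = (\<integral>\<omega>. h (X \<omega>) \<partial>M)" by (intro integral_distr) simp
    then show "ennreal \<bar>(\<integral>x. h x \<partial>distr M borel X) - (\<integral>x. h x \<partial>std_normal_law)\<bar>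
        \<le> ennreal (\<integral>\<omega>. \<bar>1 - \<phi> (X \<omega>)\<bar> \<partial>M)"
      using wasserstein_bound[OF h] by (simp add: ennreal_leI)
  qed
  have TV: "d_TV (distr M borel X) std_normal_law \<le> 2 * ?E"
  proof -
    have "d_TV (distr M borel X) std_normal_law \<le> ennreal (2 * (\<integral>\<omega>. \<bar>1 - \<phi> (X \<omega>)\<bar> \<partial>M))"
      unfolding d_TV_def by (intro SUP_least ennreal_leI total_variation_bound)
    also have "\<dots> = 2 * ?E" unfolding E by (simp add: ennreal_mult)
    finally show ?thesis .
  qed
  have E_le: "?E \<le> ennreal \<bar>1 - (\<integral>\<omega>. (X \<omega>)\<^sup>2 \<partial>M)\<bar> + ?L"
    using phi_triangle[of "\<lambda>_. 1"] by (simp add: emeasure_space_1)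
  have E_le2: "2 * ?E \<le> 2 * ennreal \<bar>1 - (\<integral>\<omega>. (X \<omega>)\<^sup>2 \<partial>M)\<bar> + 2 * ?L"
    using mult_left_mono[OF E_le, of 2] by (simp add: distrib_left)
  have H: "d_H (distr M borel X) (centered_gamma_law \<nu>) \<le> (\<integral>\<^sup>+\<omega>. ennreal \<bar>2 * (X \<omega> + \<nu>) - \<phi> (X \<omega>)\<bar> \<partial>M)"
    if \<nu>: "\<nu> > 0" "AE \<omega> in M. - \<nu> < X \<omega>" for \<nu>
  proof -
    have eq: "(\<integral>\<^sup>+\<omega>. ennreal \<bar>2 * (X \<omega> + \<nu>) - \<phi> (X \<omega>)\<bar> \<partial>M) = ennreal (\<integral>\<omega>. \<bar>2 * (X \<omega> + \<nu>) - \<phi> (X \<omega>)\<bar> \<partial>M)"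
      by (rule nn_integral_phi) (use X_int in simp)
    show ?thesis
      unfolding d_H_def eq
    proof (rule SUP_least)
      fix h assume h: "h \<in> C2b_unit"
      then have "h \<in> borel_measurable borel" by (rule borel_measurable_C2b_unit)
      then have "(\<integral>x. h x \<partial>distr M borel X) = (\<integral>\<omega>. h (X \<omega>) \<partial>M)" by (intro integral_distr) simp
      then show "ennreal \<bar>(\<integral>x. h x \<partial>distr M borel X) - (\<integral>x. h x \<partial>centered_gamma_law \<nu>)\<bar>
          \<le> ennreal (\<integral>\<omega>. \<bar>2 * (X \<omega> + \<nu>) - \<phi> (X \<omega>)\<bar> \<partial>M)"
        using centered_gamma_bound[OF \<nu> h] by (simp add: ennreal_leI)
    qed
  qed
  have H_le: "(\<integral>\<^sup>+\<omega>. ennreal \<bar>2 * (X \<omega> + \<nu>) - \<phi> (X \<omega>)\<bar> \<partial>M)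
      \<le> L2_norm M (\<lambda>\<omega>. 2 * (X \<omega> + \<nu>) - (\<integral>\<omega>'. (X \<omega>')\<^sup>2 \<partial>M)) + ?L" for \<nu>
  proof -
    have "(\<integral>\<^sup>+\<omega>. ennreal \<bar>2 * (X \<omega> + \<nu>) - \<phi> (X \<omega>)\<bar> \<partial>M)
        \<le> (\<integral>\<^sup>+\<omega>. ennreal \<bar>2 * (X \<omega> + \<nu>) - (\<integral>\<omega>. (X \<omega>)\<^sup>2 \<partial>M)\<bar> \<partial>M) + ?L"
      by (rule phi_triangle) measurable
    also have "\<dots> \<le> L2_norm M (\<lambda>\<omega>. 2 * (X \<omega> + \<nu>) - (\<integral>\<omega>'. (X \<omega>')\<^sup>2 \<partial>M)) + ?L"
      by (intro add_right_mono nn_integral_abs_le_L2_norm) measurable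
    finally show ?thesis .
  qed
  show ?thesis using W E_le TV E_le2 H H_le by blast
qed

end
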